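(* Suppose $1\leq\alpha<\infty$ and $1<s<\infty$. Let $\mu$ be a finite positive Borel measure on $[0,1)$ with moments $\mu_n=\int_{[0,1)} t^n\,d\mu(t)$, $n\ge 0$, and let $X$ be a Banach subspace of $H(\mathbb{D})$ with $\Lambda^{s}_{1/s}\subset X\subset\mathcal{B}$. Then the following statements are equivalent. (1) The operator $\mathcal{C}_{\mu,\alpha}$ is bounded from $X$ to $B_1$. (2) The operator $\mathcal{C}_{\mu,\alpha}$ is compact from $X$ to $B_1$. (3) The measure $\mu$ satisfies $$\sum_{n=0}^{\infty}(n+1)^{\alpha-1}\mu_n\log(n+2)<\infty.$$ (4) The measure $\mu$ satisfies $$\int_{[0,1)}\frac{\log\frac{e}{1-t}}{(1-t)^{\alpha}}\,d\mu(t)<\infty.$$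
   Context: $\mathbb{D}=\{z\in\mathbb{C}:|z|<1\}$ is the open unit disk, $H(\mathbb{D})$ is the space of all analytic functions on $\mathbb{D}$, and $dA(z)=\frac{dx\,dy}{\pi}$ is the normalized area measure on $\mathbb{D}$. Generalized Cesàro-like operator: for a finite positive Borel measure $\mu$ on $[0,1)$, $0<\alpha<\infty$ and $f(z)=\sum_{n=0}^\infty a_nz^n\in H(\mathbb{D})$, $$\mathcal{C}_{\mu,\alpha}(f)(z)=\sum_{n=0}^\infty\left(\mu_n\sum_{k=0}^n\frac{\Gamma(n-k+\alpha)}{\Gamma(\alpha)(n-k)!}a_k\right)z^n=\int_{[0,1)}\frac{f(tz)}{(1-tz)^\alpha}\,d\mu(t),\quad z\in\mathbb{D},$$ where $\mu_n=\int_{[0,1)}t^n\,d\mu(t)$. Bloch space $\mathcal{B}$: those $f\in H(\mathbb{D})$ with $\|f\|_{\mathcal{B}}=|f(0)|+\sup_{z\in\mathbb{D}}(1-|z|^2)|f'(z)|<\infty$. The space $B_1$ consists of those $f\in H(\mathbb{D})$ with $\int_{\mathbb{D}}|f''(z)|\,dA(z)<\infty$, with norm $\|f\|_{B_1}=|f(0)|+|f'(0)|+\int_{\mathbb{D}}|f''(z)|\,dA(z)$. Mean Lipschitz space: for $1<s<\infty$, $\Lambda^s_{1/s}$ consists of those $f\in H(\mathbb{D})$ with $\|f\|_{\Lambda^s_{1/s}}=|f(0)|+\sup_{0\le r<1}(1-r)^{1-1/s}M_s(r,f')<\infty$, where $M_s(r,g)=\left(\frac{1}{2\pi}\int_0^{2\pi}|g(re^{i\theta})|^s\,d\theta\right)^{1/s}$.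 A Banach subspace $X$ of $H(\mathbb{D})$ is a linear subspace of $H(\mathbb{D})$ equipped with a complete norm for which the inclusion into $H(\mathbb{D})$ (with the topology of uniform convergence on compact subsets of $\mathbb{D}$) is continuous. The inclusions $\Lambda^s_{1/s}\subset X\subset\mathcal{B}$ are inclusions of sets; by the closed graph theorem they are then automatically continuous. "Bounded (compact) from $X$ to $B_1$" means that $\mathcal{C}_{\mu,\alpha}$ maps $X$ into $B_1$ and is a bounded (compact) linear operator. *)

theory Defs
  imports "HOL-Complex_Analysis.Complex_Analysis"
begin

text \<open>
  An analytic function on the unit disk is represented by a total function that vanishes
  outside the disk, so that equality of functions is equality on the disk.
\<close>

definition hol_disk :: "(complex \<Rightarrow> complex) set" where
  "hol_disk = {f. f holomorphic_on ball 0 1 \<and> (\<forall>z. z \<notin> ball 0 1 \<longrightarrow> f z = 0)}"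

definition bloch :: "(complex \<Rightarrow> complex) set" where
  "bloch = {f \<in> hol_disk. bdd_above ((\<lambda>z. (1 - (norm z)\<^sup>2) * norm (deriv f z)) ` ball 0 1)}"

definition integral_mean :: "real \<Rightarrow> real \<Rightarrow> (complex \<Rightarrow> complex) \<Rightarrow> real" where
  "integral_mean s r g =
     (1 / (2 * pi) * (LINT \<theta>:{0..2*pi}|lborel. norm (g (of_real r * exp (\<i> * of_real \<theta>))) powr s))
       powr (1 / s)"

text \<open>The mean Lipschitz space \<open>\<Lambda>\<^sup>s\<^bsub>1/s\<^esub>\<close>.\<close>

definition mean_lipschitz :: "real \<Rightarrow> (complex \<Rightarrow> complex) set" where
  "mean_lipschitz s = {f \<in> hol_disk.
     bdd_above ((\<lambda>r. (1 - r) powr (1 - 1 / s) * integral_mean s r (deriv f)) ` {0..<1})}"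

definition B1_space :: "(complex \<Rightarrow> complex) set" where
  "B1_space = {f \<in> hol_disk. set_integrable lborel (ball 0 1) (\<lambda>z. norm (deriv (deriv f) z))}"

text \<open>The factor \<open>1 / pi\<close> normalizes the area measure on the disk.\<close>

definition B1_norm :: "(complex \<Rightarrow> complex) \<Rightarrow> real" where
  "B1_norm f = norm (f 0) + norm (deriv f 0)
     + 1 / pi * (LINT z:ball 0 1|lborel. norm (deriv (deriv f) z))"

definition moment :: "real measure \<Rightarrow> nat \<Rightarrow> real" where
  "moment \<mu> n = (LINT t|\<mu>. t ^ n)"

definition taylor_coeff :: "(complex \<Rightarrow> complex) \<Rightarrow> nat \<Rightarrow> complex" where
  "taylor_coeff f k = (deriv ^^ k) f 0 / fact k"

definition cesaro_like ::
  "real measure \<Rightarrow> real \<Rightarrow> (complex \<Rightarrow> complex) \<Rightarrow> complex \<Rightarrow> complex" where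
  "cesaro_like \<mu> \<alpha> f z =
     (if z \<in> ball 0 1
      then (\<Sum>n. of_real (moment \<mu> n)
              * (\<Sum>k\<le>n. of_real (Gamma (real (n - k) + \<alpha>) / (Gamma \<alpha> * fact (n - k)))
                      * taylor_coeff f k)
              * z ^ n)
      else 0)"

definition subspace_hol_disk :: "(complex \<Rightarrow> complex) set \<Rightarrow> bool" where
  "subspace_hol_disk X \<longleftrightarrow> X \<subseteq> hol_disk \<and> (\<lambda>z. 0) \<in> X
     \<and> (\<forall>f\<in>X. \<forall>g\<in>X. (\<lambda>z. f z + g z) \<in> X)
     \<and> (\<forall>c. \<forall>f\<in>X. (\<lambda>z. c * f z) \<in> X)"

definition norm_on :: "(complex \<Rightarrow> complex) set \<Rightarrow> ((complex \<Rightarrow> complex) \<Rightarrow> real) \<Rightarrow> bool" where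
  "norm_on X N \<longleftrightarrow>
       (\<forall>f\<in>X. 0 \<le> N f \<and> (N f = 0 \<longleftrightarrow> f = (\<lambda>z. 0)))
     \<and> (\<forall>c. \<forall>f\<in>X. N (\<lambda>z. c * f z) = norm c * N f)
     \<and> (\<forall>f\<in>X. \<forall>g\<in>X. N (\<lambda>z. f z + g z) \<le> N f + N g)"

definition complete_on :: "(complex \<Rightarrow> complex) set \<Rightarrow> ((complex \<Rightarrow> complex) \<Rightarrow> real) \<Rightarrow> bool" where
  "complete_on X N \<longleftrightarrow>
     (\<forall>F :: nat \<Rightarrow> complex \<Rightarrow> complex.
        (\<forall>n. F n \<in> X) \<and> (\<forall>e>0. \<exists>M. \<forall>m\<ge>M. \<forall>n\<ge>M. N (\<lambda>z. F m z - F n z) < e)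
        \<longrightarrow> (\<exists>f\<in>X. (\<lambda>n. N (\<lambda>z. F n z - f z)) \<longlonglongrightarrow> 0))"

text \<open>
  The last conjunct is continuity of the inclusion of \<open>(X, N)\<close> into the space of analytic
  functions with the topology of uniform convergence on compact subsets of the disk.
\<close>

definition banach_subspace ::
  "(complex \<Rightarrow> complex) set \<Rightarrow> ((complex \<Rightarrow> complex) \<Rightarrow> real) \<Rightarrow> bool" where
  "banach_subspace X N \<longleftrightarrow> subspace_hol_disk X \<and> norm_on X N \<and> complete_on X N
     \<and> (\<forall>f\<in>X. \<forall>K e. compact K \<and> K \<subseteq> ball 0 1 \<and> 0 < e
          \<longrightarrow> (\<exists>d>0. \<forall>g\<in>X. N (\<lambda>z. g z - f z) < d \<longrightarrow> (\<forall>z\<in>K. dist (g z) (f z) < e)))"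

definition linear_between ::
  "(complex \<Rightarrow> complex) set \<Rightarrow> (complex \<Rightarrow> complex) set
     \<Rightarrow> ((complex \<Rightarrow> complex) \<Rightarrow> complex \<Rightarrow> complex) \<Rightarrow> bool" where
  "linear_between X Y T \<longleftrightarrow> (\<forall>f\<in>X. T f \<in> Y)
     \<and> (\<forall>f\<in>X. \<forall>g\<in>X. T (\<lambda>z. f z + g z) = (\<lambda>z. T f z + T g z))
     \<and> (\<forall>c. \<forall>f\<in>X. T (\<lambda>z. c * f z) = (\<lambda>z. c * T f z))"

definition bounded_operator ::
  "(complex \<Rightarrow> complex) set \<Rightarrow> ((complex \<Rightarrow> complex) \<Rightarrow> real)
     \<Rightarrow> (complex \<Rightarrow> complex) set \<Rightarrow> ((complex \<Rightarrow> complex) \<Rightarrow> real)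
     \<Rightarrow> ((complex \<Rightarrow> complex) \<Rightarrow> complex \<Rightarrow> complex) \<Rightarrow> bool" where
  "bounded_operator X N Y P T \<longleftrightarrow> linear_between X Y T \<and> (\<exists>C. \<forall>f\<in>X. P (T f) \<le> C * N f)"

text \<open>
  Compactness: the image of every bounded sequence has a subsequence converging in the target.
\<close>

definition compact_operator ::
  "(complex \<Rightarrow> complex) set \<Rightarrow> ((complex \<Rightarrow> complex) \<Rightarrow> real)
     \<Rightarrow> (complex \<Rightarrow> complex) set \<Rightarrow> ((complex \<Rightarrow> complex) \<Rightarrow> real)
     \<Rightarrow> ((complex \<Rightarrow> complex) \<Rightarrow> complex \<Rightarrow> complex) \<Rightarrow> bool" where
  "compact_operator X N Y P T \<longleftrightarrow> linear_between X Y T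
     \<and> (\<forall>F :: nat \<Rightarrow> complex \<Rightarrow> complex. (\<forall>n. F n \<in> X) \<and> (\<exists>C. \<forall>n. N (F n) \<le> C)
          \<longrightarrow> (\<exists>g\<in>Y. \<exists>r :: nat \<Rightarrow> nat. strict_mono r
                \<and> (\<lambda>n. P (\<lambda>z. T (F (r n)) z - g z)) \<longlonglongrightarrow> 0))"

end

theory Submission
  imports Defs
begin

text \<open>
Write \<open>F(w) = f(w) (1 - w)\<^bsup>-\<alpha>\<^esup>\<close>. Interchanging the sum and the moment integral
shows that the operator sends \<open>f\<close> to the average \<open>\<integral> F(tz) d\<mu>(t)\<close> of the dilates of \<open>F\<close>, so
that the second derivative of the image is \<open>\<integral> t\<^sup>2 F''(tz) d\<mu>(t)\<close>. All of the first three
conditions are compared with the fourth, the finiteness of the integral of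
\<open>G(t) = log(e/(1-t)) (1-t)\<^bsup>-\<alpha>\<^esup>\<close>.

The fourth condition suffices. A Bloch function grows at most like \<open>log(e/(1-|w|))\<close>, and each
derivative costs one more factor \<open>1/(1-|w|)\<close>. Hence \<open>|F''|\<close> is dominated by an explicit kernel,
whose mean over the dilated disk is at most a constant times \<open>G(t)\<close>, by polar coordinates and two
one-dimensional integrals (\<open>area_integral_majorant_le\<close>). Tonelli then bounds the area integral of
the second derivative of the image by the Bloch norm of \<open>f\<close>. The inclusion of \<open>X\<close> in the Bloch
space is bounded by the uniform boundedness principle (\<open>banach_subspace_bloch_bound\<close>). For
compactness, a bounded sequence in \<open>X\<close> is a normal family; along a subsequence it converges
locally uniformly to a Bloch function, which may lie outside \<open>X\<close>, and since the kernel is an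
integrable majorant on the product of \<open>\<mu>\<close> and the disk, dominated convergence turns this into
convergence of the images in the norm of \<open>B\<^sub>1\<close> (\<open>B1_norm_cesaro_like_tendsto_zero\<close>).

The fourth condition is necessary. The function \<open>1 - log(1 - z)\<close> belongs to every mean Lipschitz
space of the statement, hence to \<open>X\<close>, and its image \<open>g\<close> lies in \<open>B\<^sub>1\<close> as soon as the operator
maps \<open>X\<close> into \<open>B\<^sub>1\<close>. A function in \<open>B\<^sub>1\<close> is bounded on the radius \<open>[0,1)\<close>
(\<open>B1_bounded_on_radius\<close>). Since \<open>g(x) = \<integral> G(xt) d\<mu>(t)\<close>, letting \<open>x\<close> tend to 1 gives the claim by
Fatou's lemma.

Finally the third condition says that \<open>\<Sum> (n+1)\<^bsup>\<alpha>-1\<^esup> log(n+2) t\<^sup>n\<close> has a finite integral, and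
this power series is comparable with \<open>G(t)\<close> on \<open>[0,1)\<close> (\<open>log_weight_series\<close>).
\<close>

section \<open>Polar coordinates on the unit disk\<close>

lemma nn_integral_lborel_complex:
  fixes F :: "complex \<Rightarrow> ennreal"
  assumes [measurable]: "F \<in> borel_measurable borel"
  shows "(\<integral>\<^sup>+z. F z \<partial>lborel) = (\<integral>\<^sup>+x. \<integral>\<^sup>+y. F (Complex x y) \<partial>lborel \<partial>lborel)"
proof -
  let ?\<Phi> = "\<lambda>p::real \<times> real. Complex (fst p) (snd p)"
  have [measurable]: "?\<Phi> \<in> lborel \<Otimes>\<^sub>M lborel \<rightarrow>\<^sub>M borel"
    unfolding Complex_eq by measurable
  have *: "distr (lborel \<Otimes>\<^sub>M lborel) borel ?\<Phi> = (lborel :: complex measure)"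
  proof (rule lborel_eqI[symmetric])
    fix l u :: complex assume lu: "\<And>b. b \<in> Basis \<Longrightarrow> l \<bullet> b \<le> u \<bullet> b"
    have r: "Re l \<le> Re u" "Im l \<le> Im u"
      using lu[of 1] lu[of \<i>] by (auto simp: Basis_complex_def)
    have "?\<Phi> -` box l u \<inter> space (lborel \<Otimes>\<^sub>M lborel) = box (Re l) (Re u) \<times> box (Im l) (Im u)"
      by (auto simp: box_def Basis_complex_def space_pair_measure)
    then show "emeasure (distr (lborel \<Otimes>\<^sub>M lborel) borel ?\<Phi>) (box l u) = (\<Prod>b\<in>Basis. (u - l) \<bullet> b)"
      using r by (subst emeasure_distr) (auto simp: lborel.emeasure_pair_measure_Times
          Basis_complex_def ennreal_mult)
  qed simp
  have "(\<integral>\<^sup>+z. F z \<partial>lborel) = (\<integral>\<^sup>+p. F (?\<Phi> p) \<partial>(lborel \<Otimes>\<^sub>M lborel))"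
    by (subst *[symmetric], subst nn_integral_distr) auto
  also have "\<dots> = (\<integral>\<^sup>+x. \<integral>\<^sup>+y. F (?\<Phi> (x, y)) \<partial>lborel \<partial>lborel)"
    by (rule lborel.nn_integral_fst[symmetric]) measurable
  finally show ?thesis by simp
qed

lemma nn_integral_lborel_complex':
  fixes F :: "complex \<Rightarrow> ennreal"
  assumes [measurable]: "F \<in> borel_measurable borel"
  shows "(\<integral>\<^sup>+z. F z \<partial>lborel) = (\<integral>\<^sup>+y. \<integral>\<^sup>+x. F (Complex x y) \<partial>lborel \<partial>lborel)"
  unfolding nn_integral_lborel_complex[OF assms]
  by (rule lborel_pair.Fubini'[symmetric]) (simp add: Complex_eq split_beta)

text \<open>
Shears preserve area because on each horizontal line they are translations. Every rotation is a
product of three shears, which makes area rotation invariant without a change of variables formula.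
\<close>

lemma nn_integral_shear_Re:
  fixes F :: "complex \<Rightarrow> ennreal"
  assumes [measurable]: "F \<in> borel_measurable borel"
  shows "(\<integral>\<^sup>+z. F (Complex (Re z + k * Im z) (Im z)) \<partial>lborel) = (\<integral>\<^sup>+z. F z \<partial>lborel)"
proof -
  have [measurable]: "(\<lambda>z. Complex (Re z + k * Im z) (Im z)) \<in> borel_measurable borel"
    unfolding Complex_eq by measurable
  have "(\<integral>\<^sup>+x. F (Complex x y) \<partial>lborel) = (\<integral>\<^sup>+x. F (Complex (x + k * y) y) \<partial>lborel)" for y
  proof -
    have [measurable]: "(\<lambda>x. F (Complex x y)) \<in> borel_measurable borel"
      unfolding Complex_eq by measurable
    show ?thesis
      using nn_integral_real_affine[of "\<lambda>x. F (Complex x y)" 1 "k * y"] by (simp add: add.commute)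
  qed
  then show ?thesis by (simp add: nn_integral_lborel_complex')
qed

lemma nn_integral_shear_Im:
  fixes F :: "complex \<Rightarrow> ennreal"
  assumes [measurable]: "F \<in> borel_measurable borel"
  shows "(\<integral>\<^sup>+z. F (Complex (Re z) (Im z + k * Re z)) \<partial>lborel) = (\<integral>\<^sup>+z. F z \<partial>lborel)"
proof -
  have [measurable]: "(\<lambda>z. Complex (Re z) (Im z + k * Re z)) \<in> borel_measurable borel"
    unfolding Complex_eq by measurable
  have "(\<integral>\<^sup>+y. F (Complex x y) \<partial>lborel) = (\<integral>\<^sup>+y. F (Complex x (y + k * x)) \<partial>lborel)" for x
  proof -
    have [measurable]: "(\<lambda>y. F (Complex x y)) \<in> borel_measurable borel"
      unfolding Complex_eq by measurable
    show ?thesis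
      using nn_integral_real_affine[of "\<lambda>y. F (Complex x y)" 1 "k * x"] by (simp add: add.commute)
  qed
  then show ?thesis by (simp add: nn_integral_lborel_complex)
qed

text \<open>
The factorization of the rotation by \<open>\<theta>\<close> into three shears involves \<open>k = - tan(\<theta>/2)\<close>, which
is finite exactly when the rotation is not the half turn.
\<close>

lemma nn_integral_rotate_aux:
  fixes F :: "complex \<Rightarrow> ennreal"
  assumes [measurable]: "F \<in> borel_measurable borel" and u: "norm u = 1" "u \<noteq> -1"
  shows "(\<integral>\<^sup>+z. F (u * z) \<partial>lborel) = (\<integral>\<^sup>+z. F z \<partial>lborel)"
proof -
  define c s where "c = Re u" and "s = Im u"
  define k where "k = - s / (1 + c)"
  have cs: "c\<^sup>2 + s\<^sup>2 = 1" using u(1) by (simp add: c_def s_def cmod_def)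
  have c1: "1 + c \<noteq> 0"
  proof
    assume "1 + c = 0"
    then have "c = -1" by simp
    with cs have "s = 0" by simp
    with \<open>c = -1\<close> u(2) show False by (simp add: c_def s_def complex_eq_iff)
  qed
  have k1: "1 + k * s = c" using c1 cs by (simp add: k_def field_simps power2_eq_square)
  have k2: "k * (1 + c) = - s" using c1 by (simp add: k_def)
  let ?A = "\<lambda>z. Complex (Re z + k * Im z) (Im z)" and ?B = "\<lambda>z. Complex (Re z) (Im z + s * Re z)"
  have [measurable]: "?A \<in> borel_measurable borel" "?B \<in> borel_measurable borel"
    unfolding Complex_eq by measurable
  have "u * z = ?A (?B (?A z))" for z
  proof -
    have "c * Re z - s * Im z = (1 + k * s) * Re z + k * (1 + (1 + k * s)) * Im z"
      using k1 k2 by (simp add: algebra_simps)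
    moreover have "c * Im z + s * Re z = (1 + k * s) * Im z + s * Re z" using k1 by simp
    ultimately show ?thesis
      by (simp add: complex_eq_iff c_def s_def algebra_simps)
  qed
  then have "(\<integral>\<^sup>+z. F (u * z) \<partial>lborel) = (\<integral>\<^sup>+z. F (?A (?B (?A z))) \<partial>lborel)" by simp
  also have "\<dots> = (\<integral>\<^sup>+z. F (?A (?B z)) \<partial>lborel)"
    by (rule nn_integral_shear_Re[of "\<lambda>z. F (?A (?B z))"]) measurable
  also have "\<dots> = (\<integral>\<^sup>+z. F (?A z) \<partial>lborel)"
    by (rule nn_integral_shear_Im[of "\<lambda>z. F (?A z)"]) measurable
  also have "\<dots> = (\<integral>\<^sup>+z. F z \<partial>lborel)"
    by (rule nn_integral_shear_Re) measurable
  finally show ?thesis .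
qed

lemma nn_integral_rotate:
  fixes F :: "complex \<Rightarrow> ennreal"
  assumes [measurable]: "F \<in> borel_measurable borel" and u: "norm u = 1"
  shows "(\<integral>\<^sup>+z. F (u * z) \<partial>lborel) = (\<integral>\<^sup>+z. F z \<partial>lborel)"
proof (cases "u = -1")
  case True
  have "(\<integral>\<^sup>+z. F (\<i> * (\<i> * z)) \<partial>lborel) = (\<integral>\<^sup>+z. F (\<i> * z) \<partial>lborel)"
    by (rule nn_integral_rotate_aux[of "\<lambda>z. F (\<i> * z)"]) (auto simp: complex_eq_iff)
  also have "\<dots> = (\<integral>\<^sup>+z. F z \<partial>lborel)"
    by (rule nn_integral_rotate_aux) (auto simp: complex_eq_iff)
  finally show ?thesis using True by (simp flip: mult.assoc)
qed (use nn_integral_rotate_aux assms in auto)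

text \<open>
The norm pushes area on the disk forward to the density \<open>2 \<pi> r\<close>, because both measures
give the half line beyond \<open>x\<close> the area \<open>\<pi>(1 - x\<^sup>2)\<close> of an annulus.
\<close>

lemma nn_integral_radial:
  fixes G :: "real \<Rightarrow> ennreal"
  assumes [measurable]: "G \<in> borel_measurable borel"
  shows "(\<integral>\<^sup>+z\<in>ball (0::complex) 1. G (norm z) \<partial>lborel) =
         (\<integral>\<^sup>+r\<in>{0..<1}. ennreal (2 * pi * r) * G r \<partial>lborel)"
proof -
  let ?M = "distr (density lborel (indicator (ball (0::complex) 1))) borel norm"
  let ?N = "density lborel (\<lambda>r. ennreal (2 * pi * r) * indicator {0..<1} r)"
  have M: "emeasure ?M {x<..} = ennreal (pi * (1 - (max 0 x)\<^sup>2))" if "x < 1" for x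
  proof -
    have "emeasure ?M {x<..} = emeasure lborel (ball (0::complex) 1 \<inter> (norm -` {x<..}))"
      by (subst emeasure_distr, simp, simp, subst emeasure_restricted)
        (auto intro!: measurable_sets[of norm borel borel, simplified])
    also have "ball (0::complex) 1 \<inter> (norm -` {x<..}) =
        (if x \<ge> 0 then ball (0::complex) 1 - cball 0 x else ball 0 1)"
      by (auto simp: not_le intro: order.strict_trans2[OF _ norm_ge_zero])
    also have "emeasure lborel \<dots> = ennreal (pi * (1 - (max 0 x)\<^sup>2))"
    proof (cases "x \<ge> 0")
      case True
      then have "emeasure lborel (ball (0::complex) 1 - cball 0 x) =
         emeasure lborel (ball (0::complex) 1) - emeasure lborel (cball (0::complex) x)"
        using \<open>x < 1\<close> by (intro emeasure_Diff) (auto simp: emeasure_cball)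
      also have "\<dots> = ennreal (pi * (1 - x\<^sup>2))"
        using True \<open>x < 1\<close> by (simp add: emeasure_cball emeasure_ball unit_ball_vol_2 ennreal_minus
            right_diff_distrib)
      finally show ?thesis using True by simp
    next
      case False
      then show ?thesis by (simp add: emeasure_ball unit_ball_vol_2)
    qed
    finally show ?thesis .
  qed
  have N: "emeasure ?N {x<..} = ennreal (pi * (1 - (max 0 x)\<^sup>2))" if "x < 1" for x
  proof -
    let ?a = "max 0 x"
    have "emeasure ?N {x<..} = (\<integral>\<^sup>+r. ennreal (2 * pi * r) * indicator {0..<1} r * indicator {x<..} r \<partial>lborel)"
      by (subst emeasure_density) auto
    also have "\<dots> = (\<integral>\<^sup>+r. ennreal (2 * pi * r) * indicator {?a..1} r \<partial>lborel)"
      by (intro nn_integral_cong_AE)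
       (use AE_lborel_singleton[of 1] AE_lborel_singleton[of x] in \<open>eventually_elim, auto simp: indicator_def\<close>)
    also have "\<dots> = ennreal (pi * 1\<^sup>2 - pi * ?a\<^sup>2)"
      using that by (intro nn_integral_FTC_Icc) (auto intro!: derivative_eq_intros)
    finally show ?thesis by (simp add: algebra_simps)
  qed
  have eq: "?M = ?N"
  proof (rule measure_eqI_lessThan)
    fix x :: real
    have z: "emeasure ?M {x<..} = 0 \<and> emeasure ?N {x<..} = 0" if "x \<ge> 1"
    proof
      show "emeasure ?M {x<..} = 0"
      proof -
        have "ball (0::complex) 1 \<inter> norm -` {x<..} = {}" using that by auto
        then show ?thesis
          by (subst emeasure_distr, simp, simp, subst emeasure_restricted)
            (auto intro!: measurable_sets[of norm borel borel, simplified])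
      qed
      show "emeasure ?N {x<..} = 0"
        by (subst emeasure_density) (use that in \<open>auto simp: nn_integral_0_iff_AE indicator_def\<close>)
    qed
    show "emeasure ?M {x<..} < \<infinity>" "emeasure ?M {x<..} = emeasure ?N {x<..}"
      using M[of x] N[of x] z by (cases "x < 1"; simp)+
  qed auto
  have "(\<integral>\<^sup>+z\<in>ball (0::complex) 1. G (norm z) \<partial>lborel) = (\<integral>\<^sup>+r. G r \<partial>?M)"
    by (subst nn_integral_distr, simp, simp, subst nn_integral_density)
      (auto simp: mult.commute intro!: borel_measurable_indicator)
  also have "\<dots> = (\<integral>\<^sup>+r. G r \<partial>?N)" by (simp only: eq)
  also have "\<dots> = (\<integral>\<^sup>+r\<in>{0..<1}. ennreal (2 * pi * r) * G r \<partial>lborel)"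
    by (subst nn_integral_density) (auto simp: ac_simps)
  finally show ?thesis .
qed

lemma nn_integral_periodic_shift:
  fixes H :: "real \<Rightarrow> ennreal"
  assumes [measurable]: "H \<in> borel_measurable borel" and per: "\<And>x. H (x + 2 * pi) = H x"
    and a: "0 \<le> a" "a \<le> 2 * pi"
  shows "(\<integral>\<^sup>+x\<in>{0..2*pi}. H (x + a) \<partial>lborel) = (\<integral>\<^sup>+x\<in>{0..2*pi}. H x \<partial>lborel)"
proof -
  have split: "(\<integral>\<^sup>+x\<in>{p..r}. H x \<partial>lborel) = (\<integral>\<^sup>+x\<in>{p..q}. H x \<partial>lborel) + (\<integral>\<^sup>+x\<in>{q..r}. H x \<partial>lborel)"
    if "p \<le> q" "q \<le> r" for p q r
  proof -
    have "AE x in lborel. H x * indicator {p..r} x =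
        H x * indicator {p..q} x + H x * indicator {q..r} x"
      using AE_lborel_singleton[of q] by eventually_elim (use that in \<open>auto simp: indicator_def\<close>)
    then show ?thesis
      by (subst nn_integral_add[symmetric]) (auto intro: nn_integral_cong_AE)
  qed
  have "(\<integral>\<^sup>+x\<in>{0..2*pi}. H (x + a) \<partial>lborel) = (\<integral>\<^sup>+x\<in>{a..a+2*pi}. H x \<partial>lborel)"
    by (subst (2) nn_integral_real_affine[of _ 1 a]) (auto simp: add.commute indicator_def intro!: nn_integral_cong)
  also have "\<dots> = (\<integral>\<^sup>+x\<in>{a..2*pi}. H x \<partial>lborel) + (\<integral>\<^sup>+x\<in>{2*pi..a+2*pi}. H x \<partial>lborel)"
    by (rule split) (use a in auto)
  also have "(\<integral>\<^sup>+x\<in>{2*pi..a+2*pi}. H x \<partial>lborel) = (\<integral>\<^sup>+x\<in>{0..a}. H x \<partial>lborel)"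
    by (subst nn_integral_real_affine[of _ 1 "2*pi"])
      (auto simp: add.commute[of "2*pi"] per indicator_def intro!: nn_integral_cong)
  also have "(\<integral>\<^sup>+x\<in>{a..2*pi}. H x \<partial>lborel) + \<dots> = (\<integral>\<^sup>+x\<in>{0..2*pi}. H x \<partial>lborel)"
    using split[of 0 a "2*pi"] a by (simp add: add.commute)
  finally show ?thesis .
qed

lemma cis_measurable[measurable]: "cis \<in> borel_measurable borel"
  by (intro borel_measurable_continuous_onI continuous_intros)

text \<open>
By rotation invariance the integrand may be replaced by its average over all rotations, which
is a radial function; for radial functions the density of the norm is known.
\<close>

lemma nn_integral_polar:
  fixes F :: "complex \<Rightarrow> ennreal"
  assumes [measurable]: "F \<in> borel_measurable borel"
  shows "(\<integral>\<^sup>+z\<in>ball 0 1. F z \<partial>lborel) =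
    (\<integral>\<^sup>+r\<in>{0..<1}. ennreal r * (\<integral>\<^sup>+\<theta>\<in>{0..2*pi}. F (of_real r * cis \<theta>) \<partial>lborel) \<partial>lborel)"
proof -
  let ?A = "\<lambda>w. \<integral>\<^sup>+\<theta>\<in>{0..2*pi}. F (w * cis \<theta>) \<partial>lborel"
  have Am[measurable]: "(\<lambda>w. ?A w) \<in> borel_measurable borel" by measurable
  have rot: "?A w = ?A (of_real (norm w))" for w
  proof -
    obtain a where a: "w = of_real (norm w) * cis a" "0 \<le> a" "a \<le> 2 * pi"
    proof -
      have "w = of_real (norm w) * cis (Arg2pi w)"
        by (metis Arg2pi_eq cis_conv_exp)
      then show ?thesis using that Arg2pi_ge_0 Arg2pi_lt_2pi less_imp_le by blast
    qed
    have "?A w = (\<integral>\<^sup>+\<theta>\<in>{0..2*pi}. F (of_real (norm w) * cis (\<theta> + a)) \<partial>lborel)"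
      by (subst (1) a(1)) (simp add: cis_mult mult.assoc add.commute)
    also have "\<dots> = ?A (of_real (norm w))"
      by (rule nn_integral_periodic_shift[of "\<lambda>\<theta>. F (of_real (norm w) * cis \<theta>)"])
         (use a in \<open>auto simp: cis_mult[symmetric]\<close>)
    finally show ?thesis .
  qed
  let ?I = "\<integral>\<^sup>+z\<in>ball 0 1. F z \<partial>lborel"
  have [measurable]: "ball (0::complex) 1 \<in> sets borel" by simp
  have I: "?I = (\<integral>\<^sup>+z\<in>ball 0 1. F (z * cis \<theta>) \<partial>lborel)" for \<theta>
    using nn_integral_rotate[of "\<lambda>z. F z * indicator (ball 0 1) z" "cis \<theta>"]
    by (simp add: mult.commute[of "cis _"] indicator_def norm_mult)
  have "ennreal (2 * pi) * ?I = (\<integral>\<^sup>+\<theta>\<in>{0..2*pi}. ?I \<partial>lborel)"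
    by (subst nn_integral_cmult) (auto simp: mult.commute)
  also have "\<dots> = (\<integral>\<^sup>+\<theta>\<in>{0..2*pi}. (\<integral>\<^sup>+z\<in>ball 0 1. F (z * cis \<theta>) \<partial>lborel) \<partial>lborel)"
    using I by simp
  also have "\<dots> = (\<integral>\<^sup>+\<theta>. (\<integral>\<^sup>+z. F (z * cis \<theta>) * indicator (ball 0 1) z * indicator {0..2*pi} \<theta> \<partial>lborel) \<partial>lborel)"
    by (rule nn_integral_cong, rule nn_integral_multc[symmetric])
      (intro borel_measurable_times_ennreal borel_measurable_indicator; simp)+
  also have "\<dots> = (\<integral>\<^sup>+z. (\<integral>\<^sup>+\<theta>. F (z * cis \<theta>) * indicator (ball 0 1) z * indicator {0..2*pi} \<theta> \<partial>lborel) \<partial>lborel)"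
    by (rule lborel_pair.Fubini', unfold split_beta,
        intro borel_measurable_times_ennreal borel_measurable_indicator'; measurable)
  also have "\<dots> = (\<integral>\<^sup>+z\<in>ball 0 1. ?A z \<partial>lborel)"
    by (intro nn_integral_cong, subst nn_integral_multc[symmetric]) (measurable, simp add: ac_simps)
  also have "\<dots> = (\<integral>\<^sup>+z\<in>ball (0::complex) 1. ?A (of_real (norm z)) \<partial>lborel)"
    using rot by (intro nn_integral_cong) (auto simp: indicator_def)
  also have "\<dots> = (\<integral>\<^sup>+r\<in>{0..<1}. ennreal (2 * pi * r) * ?A (of_real r) \<partial>lborel)"
    by (rule nn_integral_radial[of "\<lambda>r. ?A (of_real r)"]) measurable
  also have "\<dots> = (\<integral>\<^sup>+r. ennreal (2 * pi) * (ennreal r * ?A (of_real r) * indicator {0..<1} r) \<partial>lborel)"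
    by (intro nn_integral_cong) (auto simp: indicator_def ennreal_mult' mult.assoc)
  also have "\<dots> = ennreal (2 * pi) * (\<integral>\<^sup>+r\<in>{0..<1}. ennreal r * ?A (of_real r) \<partial>lborel)"
    by (rule nn_integral_cmult) measurable
  finally show ?thesis
    by (simp add: ennreal_mult_cancel_left)
qed

section \<open>Circle and area means of the singular kernels\<close>

text \<open>
Half of the Jordan bound is enough here. It follows from \<open>y cos y \<le> sin y\<close> at \<open>y = x/2\<close> and
the double angle formulas.
\<close>

lemma sin_ge_half: fixes x :: real assumes "0 \<le> x" "x \<le> pi / 2" shows "x / 2 \<le> sin x"
proof (cases "x = 0")
  case False
  then have x: "0 < x" using assms by simp
  have y: "0 < x / 2" "x / 2 < pi / 2" using x assms pi_gt_zero by linarith+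
  have cpos: "cos (x/2) > 0" by (rule cos_gt_zero) (use y in auto)
  obtain \<xi> where \<xi>: "0 < \<xi>" "\<xi> < x / 2" "sin (x / 2) - sin 0 = (x / 2 - 0) * cos \<xi>"
    using MVT2[of 0 "x / 2" sin cos] y by (auto intro: DERIV_sin)
  have "cos (x / 2) \<le> cos \<xi>" using \<xi> y by (intro cos_monotone_0_pi_le) auto
  then have 1: "x / 2 * cos (x / 2) \<le> sin (x / 2)" using \<xi>(3) x by simp
  have "cos x \<ge> 0" using assms by (intro cos_ge_zero) auto
  then have c2: "(cos (x/2))\<^sup>2 \<ge> 1 / 2" using cos_double_cos[of "x/2"] by simp
  have "x / 2 \<le> x * (cos (x/2))\<^sup>2" using mult_left_mono[OF c2, of x] x by simp
  also have "\<dots> = 2 * (x / 2 * cos (x / 2)) * cos (x/2)" by (simp add: power2_eq_square)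
  also have "\<dots> \<le> 2 * sin (x / 2) * cos (x / 2)"
    using 1 cpos by (intro mult_right_mono) auto
  also have "\<dots> = sin x" using sin_double[of "x/2"] by simp
  finally show ?thesis .
qed simp

text \<open>
Up to a constant the distance from \<open>r e\<^bsup>it\<^esup>\<close> to 1 is at least the radial gap plus the angle,
for angles up to \<open>\<pi>\<close>. This replaces all later integrals over circles by integrals of powers of \<open>1 - r + t\<close>.
\<close>

lemma norm_one_minus_cis_ge:
  assumes r: "0 \<le> r" "r < 1" and t: "0 \<le> t" "t \<le> pi"
  shows "(1 - r + t) / 10 \<le> norm (1 - of_real r * cis t)"
proof (cases "r \<le> 1 / 2")
  case True
  have "1 - r \<le> norm (1 - of_real r * cis t)"
    using norm_triangle_ineq2[of 1 "of_real r * cis t"] r by (simp add: norm_mult)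
  moreover have "t \<le> 4" using t pi_less_4 by linarith
  ultimately show ?thesis using True by simp
next
  case False
  have s: "t / 4 \<le> sin (t / 2)" using sin_ge_half[of "t/2"] t by simp
  have "(norm (1 - of_real r * cis t))\<^sup>2 = (1 - r * cos t)\<^sup>2 + (r * sin t)\<^sup>2"
    by (simp add: cmod_power2)
  also have "\<dots> = 1 - 2 * r * cos t + r\<^sup>2 * ((cos t)\<^sup>2 + (sin t)\<^sup>2)"
    by algebra
  also have "\<dots> = (1 - r)\<^sup>2 + 4 * r * (sin (t/2))\<^sup>2"
  proof -
    have ct: "cos t = 1 - 2 * (sin (t/2))\<^sup>2" using cos_double_sin[of "t/2"] by simp
    show ?thesis
      unfolding sin_cos_squared_add2 unfolding ct by (simp add: power2_eq_square algebra_simps)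
  qed
  finally have "(norm (1 - of_real r * cis t))\<^sup>2 = (1 - r)\<^sup>2 + 4 * r * (sin (t/2))\<^sup>2" .
  moreover have "(t / 4)\<^sup>2 \<le> (sin (t / 2))\<^sup>2" using s t by (intro power_mono) auto
  moreover have "4 * r * (sin (t / 2))\<^sup>2 \<ge> 2 * (sin (t/2))\<^sup>2"
    using False by (intro mult_right_mono) auto
  ultimately have "(norm (1 - of_real r * cis t))\<^sup>2 \<ge> (1 - r)\<^sup>2 + t\<^sup>2 / 8"
    by (simp add: power2_eq_square)
  moreover have "((1 - r + t) / 3)\<^sup>2 \<le> (1 - r)\<^sup>2 + t\<^sup>2 / 8"
    using zero_le_power2[of "8 * (1 - r) - t"] by (simp add: power2_eq_square field_simps)
  ultimately have "((1 - r + t) / 3)\<^sup>2 \<le> (norm (1 - of_real r * cis t))\<^sup>2" by simp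
  then have "(1 - r + t) / 3 \<le> norm (1 - of_real r * cis t)"
    by (rule power2_le_imp_le) simp
  then show ?thesis using r t by simp
qed

lemma circle_integral_le:
  fixes h :: "real \<Rightarrow> real"
  assumes [measurable]: "h \<in> borel_measurable borel"
    and anti: "\<And>x y. 0 < x \<Longrightarrow> x \<le> y \<Longrightarrow> h y \<le> h x"
    and r: "0 \<le> r" "r < 1"
  shows "(\<integral>\<^sup>+t\<in>{0..2*pi}. ennreal (h (norm (1 - of_real r * cis t))) \<partial>lborel)
     \<le> 2 * (\<integral>\<^sup>+t\<in>{0..pi}. ennreal (h ((1 - r + t) / 10)) \<partial>lborel)"
proof -
  let ?g = "\<lambda>t. ennreal (h (norm (1 - of_real r * cis t)))"
  have [measurable]: "?g \<in> borel_measurable borel" by measurable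
  have "norm (1 - of_real r * cis (2 * pi - t)) = norm (1 - of_real r * cis t)" for t
  proof -
    have "1 - of_real r * cis (2 * pi - t) = cnj (1 - of_real r * cis t)"
      by (simp add: complex_eq_iff cos_diff sin_diff)
    then show ?thesis by (metis complex_mod_cnj)
  qed
  then have sym: "?g (2 * pi - t) = ?g t" for t by simp
  have "(\<integral>\<^sup>+t\<in>{0..2*pi}. ?g t \<partial>lborel)
      \<le> (\<integral>\<^sup>+t. ?g t * indicator {0..pi} t + ?g t * indicator {pi..2*pi} t \<partial>lborel)"
    by (intro nn_integral_mono) (auto simp: indicator_def)
  also have "\<dots> = (\<integral>\<^sup>+t\<in>{0..pi}. ?g t \<partial>lborel) + (\<integral>\<^sup>+t\<in>{pi..2*pi}. ?g t \<partial>lborel)"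
    by (rule nn_integral_add) auto
  also have "(\<integral>\<^sup>+t\<in>{pi..2*pi}. ?g t \<partial>lborel) = (\<integral>\<^sup>+t\<in>{0..pi}. ?g t \<partial>lborel)"
    by (subst nn_integral_real_affine[of _ "-1" "2*pi"])
      (auto simp: sym indicator_def intro!: nn_integral_cong)
  also have "\<dots> + \<dots> = 2 * (\<integral>\<^sup>+t\<in>{0..pi}. ?g t \<partial>lborel)" by (simp add: mult_2)
  also have "(\<integral>\<^sup>+t\<in>{0..pi}. ?g t \<partial>lborel) \<le> (\<integral>\<^sup>+t\<in>{0..pi}. ennreal (h ((1 - r + t) / 10)) \<partial>lborel)"
  proof (intro nn_integral_mono)
    fix t
    show "?g t * indicator {0..pi} t \<le> ennreal (h ((1 - r + t) / 10)) * indicator {0..pi} t"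
      using anti[OF _ norm_one_minus_cis_ge[OF r, of t]] r
      by (auto simp: indicator_def intro!: ennreal_leI)
  qed
  finally show ?thesis by (simp add: mult_left_mono)
qed

lemma two_mult_ennreal: "2 * ennreal x = ennreal (2 * x)"
  by (simp add: ennreal_mult')

text \<open>
The exponent 1 is the critical one: the integral of \<open>1/(1 - r + t)\<close> is a logarithm and not a
power.
\<close>

lemma circle_integral_inverse_le:
  assumes r: "0 \<le> r" "r < 1"
  shows "(\<integral>\<^sup>+t\<in>{0..2*pi}. ennreal (1 / norm (1 - of_real r * cis t)) \<partial>lborel)
     \<le> ennreal (40 * ln (exp 1 / (1 - r)))"
proof -
  have "(\<integral>\<^sup>+t\<in>{0..2*pi}. ennreal (1 / norm (1 - of_real r * cis t)) \<partial>lborel)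
     \<le> 2 * (\<integral>\<^sup>+t\<in>{0..pi}. ennreal (1 / ((1 - r + t) / 10)) \<partial>lborel)"
    by (rule circle_integral_le[OF _ _ r]) (auto simp: frac_le)
  also have "(\<integral>\<^sup>+t\<in>{0..pi}. ennreal (1 / ((1 - r + t) / 10)) \<partial>lborel)
     = ennreal (10 * ln (1 - r + pi) - 10 * ln (1 - r + 0))"
    by (intro nn_integral_FTC_Icc) (use r in \<open>auto intro!: derivative_eq_intros simp: field_simps\<close>)
  also have "10 * ln (1 - r + pi) - 10 * ln (1 - r + 0) \<le> 20 * ln (exp 1 / (1 - r))"
  proof -
    have "1 - r + pi \<le> 5" using r pi_less_4 by simp
    \<comment> \<open>The bound \<open>1 + 1 + 1/2\<close> for \<open>e\<close> suffices for \<open>1 + \<pi> < e\<^sup>2\<close>.\<close>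
    also have "(5::real) \<le> 2.5 * 2.5" by simp
    also have "\<dots> \<le> exp 1 * exp 1"
      using exp_lower_Taylor_quadratic[of 1] by (intro mult_mono) auto
    also have "\<dots> = exp 2" by (simp flip: exp_add)
    finally have "ln (1 - r + pi) \<le> ln (exp 2)" using r pi_gt_zero by (subst ln_le_cancel_iff) (auto intro: add_pos_pos)
    then have "ln (1 - r + pi) \<le> 2" by simp
    moreover have "ln (1 - r) \<le> 0" using r by simp
    moreover have "ln (exp 1 / (1 - r)) = 1 - ln (1 - r)" using r by (simp add: ln_div)
    ultimately show ?thesis by simp
  qed
  also have "2 * ennreal (20 * ln (exp 1 / (1 - r))) = ennreal (40 * ln (exp 1 / (1 - r)))"
    by (simp add: two_mult_ennreal)
  finally show ?thesis by (simp add: mult_left_mono ennreal_leI)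
qed

lemma circle_integral_powr_le:
  assumes r: "0 \<le> r" "r < 1" and s: "1 < s"
  shows "(\<integral>\<^sup>+t\<in>{0..2*pi}. ennreal (norm (1 - of_real r * cis t) powr (- s)) \<partial>lborel)
     \<le> ennreal (20 * 10 powr (s - 1) / (s - 1) * (1 - r) powr (1 - s))"
proof -
  have "(\<integral>\<^sup>+t\<in>{0..2*pi}. ennreal (norm (1 - of_real r * cis t) powr (- s)) \<partial>lborel)
     \<le> 2 * (\<integral>\<^sup>+t\<in>{0..pi}. ennreal (((1 - r + t) / 10) powr (- s)) \<partial>lborel)"
    by (rule circle_integral_le[OF _ _ r]) (use s in \<open>auto intro!: powr_mono2'\<close>)
  also have "(\<integral>\<^sup>+t\<in>{0..pi}. ennreal (((1 - r + t) / 10) powr (- s)) \<partial>lborel)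
     = ennreal (- 10 / (s - 1) * ((1 - r + pi) / 10) powr (1 - s)
          - - 10 / (s - 1) * ((1 - r + 0) / 10) powr (1 - s))"
    by (intro nn_integral_FTC_Icc)
       (use r s in \<open>auto intro!: derivative_eq_intros simp: divide_simps\<close>, simp_all add: algebra_simps)
  also have "\<dots> \<le> ennreal (10 / (s - 1) * ((1 - r) / 10) powr (1 - s))"
    using s by (intro ennreal_leI) auto
  also have "((1 - r) / 10) powr (1 - s) = 10 powr (s - 1) * (1 - r) powr (1 - s)"
    using r by (simp add: powr_divide powr_minus[of 10 "s - 1", simplified] field_simps)
  also have "2 * ennreal (10 / (s - 1) * (10 powr (s - 1) * (1 - r) powr (1 - s)))
    = ennreal (20 * 10 powr (s - 1) / (s - 1) * (1 - r) powr (1 - s))"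
    by (simp add: two_mult_ennreal mult.assoc)
  finally show ?thesis by (simp add: mult_left_mono)
qed

text \<open>
This function dominates the second derivative of \<open>f(w) (1 - w)\<^bsup>-\<alpha>\<^esup>\<close> for Bloch functions
\<open>f\<close>. Powers of \<open>1/|1 - w|\<close> beyond the first or second have been traded for powers of the larger
\<open>1/(1 - |w|)\<close>, so that only two circle means are needed for all \<open>\<alpha>\<close>. The term
that comes with \<open>|1 - w|\<^sup>-\<^sup>1\<close> must carry no logarithm, since its circle mean already produces one; the term with \<open>|1 - w|\<^sup>-\<^sup>2\<close> produces none and may carry it.
\<close>

definition majorant :: "real \<Rightarrow> complex \<Rightarrow> real" where
  "majorant \<alpha> w = 1 / norm (1 - w) * (1 - norm w) powr (- \<alpha> - 1)
     + norm (1 - w) powr (- 2) * ((1 - norm w) powr (- \<alpha>) * ln (exp 1 / (1 - norm w)))"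

lemma ln_ge_one: "0 \<le> r \<Longrightarrow> r < 1 \<Longrightarrow> 1 \<le> ln (exp 1 / (1 - r :: real))"
  by (simp add: ln_div)

lemma majorant_measurable[measurable]: "majorant \<alpha> \<in> borel_measurable borel"
  unfolding majorant_def by measurable

lemma circle_integral_majorant_le:
  assumes r: "0 \<le> r" "r < 1"
  shows "(\<integral>\<^sup>+t\<in>{0..2*pi}. ennreal (majorant \<alpha> (of_real r * cis t)) \<partial>lborel)
     \<le> ennreal (240 * ln (exp 1 / (1 - r)) * (1 - r) powr (- \<alpha> - 1))"
proof -
  let ?a = "(1 - r) powr (- \<alpha> - 1)" and ?L = "ln (exp 1 / (1 - r))"
  let ?b = "(1 - r) powr (- \<alpha>) * ?L"
  note L = ln_ge_one[OF r]
  have "ennreal (majorant \<alpha> (of_real r * cis t)) =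
      ennreal ?a * ennreal (1 / norm (1 - of_real r * cis t))
      + ennreal ?b * ennreal (norm (1 - of_real r * cis t) powr (- 2))" for t
    using r L unfolding majorant_def
    by (subst ennreal_plus) (auto intro!: mult_nonneg_nonneg simp del: ln_ge_zero_iff simp: norm_mult mult.commute simp flip: ennreal_mult')
  then have "(\<integral>\<^sup>+t\<in>{0..2*pi}. ennreal (majorant \<alpha> (of_real r * cis t)) \<partial>lborel) =
     (\<integral>\<^sup>+t. ennreal ?a * (ennreal (1 / norm (1 - of_real r * cis t)) * indicator {0..2*pi} t)
      + ennreal ?b * (ennreal (norm (1 - of_real r * cis t) powr (- 2)) * indicator {0..2*pi} t) \<partial>lborel)"
    by (intro nn_integral_cong) (simp add: distrib_right mult.assoc)
  also have "\<dots> = ennreal ?a * (\<integral>\<^sup>+t\<in>{0..2*pi}. ennreal (1 / norm (1 - of_real r * cis t)) \<partial>lborel)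
      + ennreal ?b * (\<integral>\<^sup>+t\<in>{0..2*pi}. ennreal (norm (1 - of_real r * cis t) powr (- 2)) \<partial>lborel)"
    by (simp add: nn_integral_add nn_integral_cmult)
  also have "\<dots> \<le> ennreal ?a * ennreal (40 * ?L) + ennreal ?b * ennreal (200 * (1 - r) powr (-1))"
    using circle_integral_inverse_le[OF r] circle_integral_powr_le[OF r, of 2]
    by (intro add_mono mult_left_mono) auto
  also have "\<dots> = ennreal (?a * (40 * ?L) + ?b * (200 * (1 - r) powr (-1)))"
  proof -
    have "0 \<le> ?a" "0 \<le> ?b" "0 \<le> ?L" using L by (auto intro: mult_nonneg_nonneg simp del: ln_ge_zero_iff)
    then show ?thesis by (subst ennreal_plus; (simp only: ennreal_mult'[symmetric])?) simp_all
  qed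
  also have "?a * (40 * ?L) + ?b * (200 * (1 - r) powr (-1)) = 240 * ?L * ?a"
  proof -
    have "- \<alpha> - 1 = - \<alpha> + (-1)" by simp
    then have "?a = (1 - r) powr (- \<alpha>) * (1 - r) powr (-1)" by (simp only: powr_add)
    then show ?thesis by (simp only:) (simp add: algebra_simps)
  qed
  finally show ?thesis .
qed

text \<open>
After the circle integration the factor \<open>t\<close> in front makes \<open>t (1 - tr)\<^bsup>-\<alpha>-1\<^esup>\<close> the derivative of
\<open>(1 - tr)\<^bsup>-\<alpha>\<^esup> / \<alpha>\<close>, so that the estimate is uniform down to \<open>t = 0\<close>.
\<close>

lemma area_integral_majorant_le:
  assumes t: "0 \<le> t" "t < 1" and \<alpha>: "1 \<le> \<alpha>"
  shows "(\<integral>\<^sup>+z\<in>ball 0 1. ennreal (t * majorant \<alpha> (of_real t * z)) \<partial>lborel)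
     \<le> ennreal (240 * (ln (exp 1 / (1 - t)) / (1 - t) powr \<alpha>))"
proof -
  let ?L = "ln (exp 1 / (1 - t))"
  note L = ln_ge_one[OF t]
  have 1: "ennreal r * (\<integral>\<^sup>+\<theta>\<in>{0..2*pi}. ennreal (t * majorant \<alpha> (of_real t * (of_real r * cis \<theta>))) \<partial>lborel)
      \<le> ennreal (240 * ?L * (t * (1 - t * r) powr (- \<alpha> - 1)))" if r: "0 \<le> r" "r < 1" for r
  proof -
    have tr: "0 \<le> t * r" "t * r < 1" "t * r \<le> t"
      using t r mult_strict_mono'[of t 1 r 1] mult_left_mono[of r 1 t] by auto
    have "(\<integral>\<^sup>+\<theta>\<in>{0..2*pi}. ennreal (t * majorant \<alpha> (of_real t * (of_real r * cis \<theta>))) \<partial>lborel)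
      = ennreal t * (\<integral>\<^sup>+\<theta>\<in>{0..2*pi}. ennreal (majorant \<alpha> (of_real (t * r) * cis \<theta>)) \<partial>lborel)"
      using t by (subst nn_integral_cmult[symmetric])
        (auto simp: ennreal_mult' mult.assoc intro!: nn_integral_cong)
    also have "\<dots> \<le> ennreal t * ennreal (240 * ln (exp 1 / (1 - t * r)) * (1 - t * r) powr (- \<alpha> - 1))"
      using circle_integral_majorant_le[OF tr(1,2)] by (intro mult_left_mono) auto
    also have "\<dots> = ennreal (t * (240 * ln (exp 1 / (1 - t * r)) * (1 - t * r) powr (- \<alpha> - 1)))"
      using t by (simp add: ennreal_mult')
    also have "\<dots> \<le> ennreal (t * (240 * ?L * (1 - t * r) powr (- \<alpha> - 1)))"
      using tr t by (intro ennreal_leI mult_left_mono mult_right_mono) (auto simp: frac_le)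
    finally have "ennreal r * (\<integral>\<^sup>+\<theta>\<in>{0..2*pi}. ennreal (t * majorant \<alpha> (of_real t * (of_real r * cis \<theta>))) \<partial>lborel)
      \<le> 1 * ennreal (t * (240 * ?L * (1 - t * r) powr (- \<alpha> - 1)))"
      using r by (intro mult_mono) auto
    then show ?thesis by (simp add: algebra_simps)
  qed
  have "(\<integral>\<^sup>+z\<in>ball 0 1. ennreal (t * majorant \<alpha> (of_real t * z)) \<partial>lborel)
    = (\<integral>\<^sup>+r\<in>{0..<1}. ennreal r * (\<integral>\<^sup>+\<theta>\<in>{0..2*pi}. ennreal (t * majorant \<alpha> (of_real t * (of_real r * cis \<theta>))) \<partial>lborel) \<partial>lborel)"
    by (rule nn_integral_polar) measurable
  also have "\<dots> \<le> (\<integral>\<^sup>+r\<in>{0..1}. ennreal (240 * ?L * (t * (1 - t * r) powr (- \<alpha> - 1))) \<partial>lborel)"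
    using 1 by (intro nn_integral_mono) (auto simp: indicator_def)
  also have "\<dots> = ennreal (240 * ?L / \<alpha> * (1 - t * 1) powr (- \<alpha>) - 240 * ?L / \<alpha> * (1 - t * 0) powr (- \<alpha>))"
  proof (rule nn_integral_FTC_Icc[where F = "\<lambda>r. 240 * ?L / \<alpha> * (1 - t * r) powr (- \<alpha>)"])
    fix r :: real assume "r \<in> {0..1}"
    then have r: "0 \<le> r" "r \<le> 1" by auto
    have tr: "0 \<le> t * r" "t * r < 1"
      using t r mult_left_mono[of r 1 t] by auto
    show "((\<lambda>r. 240 * ?L / \<alpha> * (1 - t * r) powr (- \<alpha>)) has_real_derivative 240 * ?L * (t * (1 - t * r) powr (- \<alpha> - 1))) (at r)"
      using tr \<alpha> by (auto intro!: derivative_eq_intros simp: field_simps)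
    show "0 \<le> 240 * ?L * (t * (1 - t * r) powr (- \<alpha> - 1))"
      using L t by (intro mult_nonneg_nonneg) (auto simp del: ln_ge_zero_iff)
  qed auto
  also have "\<dots> \<le> ennreal (240 * (?L / (1 - t) powr \<alpha>))"
  proof (rule ennreal_leI)
    have "240 * ?L / \<alpha> * (1 - t) powr (- \<alpha>) \<le> 240 * ?L / 1 * (1 - t) powr (- \<alpha>)"
      using L \<alpha> by (intro mult_right_mono divide_left_mono) auto
    moreover have "240 * ?L / \<alpha> \<ge> 0" using L \<alpha> by simp
    moreover have "?L / (1 - t) powr \<alpha> = ?L * (1 - t) powr (- \<alpha>)" by (simp add: powr_minus_divide)
    ultimately show "240 * ?L / \<alpha> * (1 - t * 1) powr (- \<alpha>) - 240 * ?L / \<alpha> * (1 - t * 0) powr (- \<alpha>)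
       \<le> 240 * (?L / (1 - t) powr \<alpha>)" by simp
  qed
  finally show ?thesis .
qed

section \<open>The operator as an average of dilates\<close>

lemma unit_interval_measure:
  assumes "finite_measure \<mu>" and s: "sets \<mu> = sets (restrict_space borel {0..<1::real})"
  shows "space \<mu> = {0..<1}" "\<And>f :: real \<Rightarrow> 'b::topological_space. f \<in> borel_measurable borel \<Longrightarrow> f \<in> borel_measurable \<mu>"
proof -
  show "space \<mu> = {0..<1}" using sets_eq_imp_space_eq[OF s] by (simp add: space_restrict_space)
  show "f \<in> borel_measurable \<mu>" if "f \<in> borel_measurable borel" for f :: "real \<Rightarrow> 'b"
    using measurable_restrict_space1[OF that, of "{0..<1}"] measurable_cong_sets[OF s refl] by blast
qed

text \<open>
Integrating a power series in \<open>tz\<close> against \<open>t\<^sup>m d\<mu>(t)\<close> multiplies its coefficients by shifted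
moments. The exponents \<open>m = 0, 1, 2\<close> serve the operator and its first two derivatives.
\<close>

lemma power_series_moments:
  fixes c :: "nat \<Rightarrow> complex"
  assumes "finite_measure \<mu>" and s: "sets \<mu> = sets (restrict_space borel {0..<1::real})"
    and sm: "\<And>z. norm z < 1 \<Longrightarrow> summable (\<lambda>n. c n * z ^ n)"
    and z: "norm z < 1"
  shows "(\<lambda>n. of_real (moment \<mu> (n + m)) * c n * z ^ n) sums
           (LINT t|\<mu>. of_real t ^ m * (\<Sum>n. c n * (of_real t * z) ^ n))"
    and "integrable \<mu> (\<lambda>t. of_real t ^ m * (\<Sum>n. c n * (of_real t * z) ^ n))"
proof -
  interpret finite_measure \<mu> by fact
  note sp = unit_interval_measure(1)[OF assms(1,2)]
  note meas = unit_interval_measure(2)[OF assms(1,2)]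
  have abs_sm: "summable (\<lambda>n. norm (c n * z ^ n))"
  proof -
    obtain \<rho> where \<rho>: "norm z < \<rho>" "\<rho> < 1" using z dense by blast
    have "summable (\<lambda>n. c n * (of_real \<rho>) ^ n)" using \<rho> sm[of "of_real \<rho>"] norm_ge_zero[of z] by simp
    then show ?thesis by (rule powser_insidea) (use \<rho> in auto)
  qed
  let ?f = "\<lambda>n t. of_real t ^ m * (c n * (of_real t * z) ^ n) :: complex"
  have le: "norm (?f n t) \<le> norm (c n * z ^ n)" if "t \<in> {0..<1}" for n t
  proof -
    have "norm (?f n t) = t ^ (m + n) * norm (c n * z ^ n)" using that
      by (simp add: norm_mult norm_power power_mult_distrib power_add)
    also have "\<dots> \<le> 1 * norm (c n * z ^ n)" using that by (intro mult_right_mono power_le_one) auto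
    finally show ?thesis by simp
  qed
  have fm: "?f n \<in> borel_measurable \<mu>" for n by (rule meas) measurable
  have fi: "integrable \<mu> (?f n)" for n
    by (rule integrable_const_bound[where B="norm (c n * z ^ n)", OF _ fm]) (use le sp in auto)
  have f_int: "integral\<^sup>L \<mu> (?f n) = of_real (moment \<mu> (n + m)) * c n * z ^ n" for n
  proof -
    have "?f n t = of_real (t ^ (n + m)) * (c n * z ^ n)" for t
      by (simp add: power_mult_distrib power_add)
    then have "integral\<^sup>L \<mu> (?f n) = (LINT t|\<mu>. of_real (t ^ (n + m)) * (c n * z ^ n))" by (simp only:)
    also have "\<dots> = of_real (moment \<mu> (n + m)) * (c n * z ^ n)"
      unfolding moment_def by (subst integral_mult_left_zero) (simp only: integral_complex_of_real)
    finally show ?thesis by (simp add: mult.assoc)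
  qed
  have ae: "AE t in \<mu>. summable (\<lambda>n. norm (?f n t))"
    using le sp by (intro AE_I2 summable_comparison_test'[OF abs_sm, of 0]) auto
  have nsm: "summable (\<lambda>n. LINT t|\<mu>. norm (?f n t))"
  proof (rule summable_comparison_test')
    show "summable (\<lambda>n. norm (c n * z ^ n) * measure \<mu> (space \<mu>))" by (intro summable_mult2 abs_sm)
    fix n :: nat
    have "(LINT t|\<mu>. norm (?f n t)) \<le> (LINT t|\<mu>. norm (c n * z ^ n))"
      using fi le sp by (intro integral_mono) auto
    moreover have "(LINT t|\<mu>. norm (?f n t)) \<ge> 0" by simp
    ultimately show "norm (LINT t|\<mu>. norm (?f n t)) \<le> norm (c n * z ^ n) * measure \<mu> (space \<mu>)"
      by (simp add: mult.commute)
  qed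
  have sumeq: "(\<Sum>n. ?f n t) = of_real t ^ m * (\<Sum>n. c n * (of_real t * z) ^ n)" if "t \<in> space \<mu>" for t
  proof (rule suminf_mult)
    have "norm (of_real t * z) < 1" using that z sp mult_strict_mono'[of t 1 "norm z" 1] by (auto simp: norm_mult)
    then show "summable (\<lambda>n. c n * (of_real t * z) ^ n)" by (rule sm)
  qed
  have 1: "(\<lambda>n. integral\<^sup>L \<mu> (?f n)) sums (LINT t|\<mu>. (\<Sum>n. ?f n t))"
    by (rule sums_integral[OF fi ae nsm])
  have 2: "integrable \<mu> (\<lambda>t. (\<Sum>n. ?f n t))"
    by (rule integrable_suminf[OF fi ae nsm])
  show "(\<lambda>n. of_real (moment \<mu> (n + m)) * c n * z ^ n) sums
           (LINT t|\<mu>. of_real t ^ m * (\<Sum>n. c n * (of_real t * z) ^ n))"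
    using 1 sumeq by (simp add: f_int cong: Bochner_Integration.integral_cong)
  show "integrable \<mu> (\<lambda>t. of_real t ^ m * (\<Sum>n. c n * (of_real t * z) ^ n))"
    using 2 sumeq by (simp cong: Bochner_Integration.integrable_cong)
qed

text \<open>
The Gamma quotients in the definition of the operator are the binomial coefficients of
\<open>(1 - z)\<^bsup>-\<alpha>\<^esup>\<close>.
\<close>

lemma one_minus_powr_sums:
  fixes z :: complex
  assumes "norm z < 1" and "\<alpha> > 0"
  shows "(\<lambda>n. of_real (Gamma (real n + \<alpha>) / (Gamma \<alpha> * fact n)) * z ^ n) sums (1 - z) powr (- of_real \<alpha>)"
proof -
  have "(\<lambda>n. ((- of_real \<alpha>) gchoose n) * (- z) ^ n) sums (1 + (- z)) powr (- of_real \<alpha>)"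
    using assms by (intro gen_binomial_complex) simp
  moreover have "((- of_real \<alpha>) gchoose n) * (- z) ^ n = of_real (Gamma (real n + \<alpha>) / (Gamma \<alpha> * fact n)) * z ^ n" for n
  proof -
    have nn: "\<alpha> \<notin> \<int>\<^sub>\<le>\<^sub>0" using \<open>\<alpha> > 0\<close> by (auto elim!: nonpos_Ints_cases)
    have "pochhammer \<alpha> n = Gamma (\<alpha> + real n) / Gamma \<alpha>"
      using pochhammer_Gamma[OF nn] by simp
    then have p: "pochhammer (of_real \<alpha> :: complex) n = of_real (Gamma (real n + \<alpha>) / Gamma \<alpha>)"
      by (simp add: pochhammer_of_real add.commute)
    have "((- of_real \<alpha> :: complex) gchoose n) = (- 1) ^ n / fact n * pochhammer (of_real \<alpha>) n"
      by (simp add: gbinomial_pochhammer)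
    then have "((- of_real \<alpha> :: complex) gchoose n) * (- z) ^ n
        = ((- 1) ^ n * (- 1) ^ n) * (pochhammer (of_real \<alpha>) n / fact n) * z ^ n"
      by (subst power_minus[of z]) simp
    also have "(- 1) ^ n * (- 1) ^ n = (1::complex)" by (simp flip: power_mult_distrib)
    finally show ?thesis by (simp add: p)
  qed
  ultimately show ?thesis by simp
qed

definition weighted :: "real \<Rightarrow> (complex \<Rightarrow> complex) \<Rightarrow> complex \<Rightarrow> complex" where
  "weighted \<alpha> f w = f w * (1 - w) powr (- of_real \<alpha>)"

lemma one_minus_not_nonpos:
  fixes w :: complex assumes "norm w < 1" shows "1 - w \<notin> \<real>\<^sub>\<le>\<^sub>0"
proof
  assume "1 - w \<in> \<real>\<^sub>\<le>\<^sub>0"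
  then have "Re w \<ge> 1" by (auto simp: complex_nonpos_Reals_iff)
  then show False using complex_Re_le_cmod[of w] assms by simp
qed

lemma holomorphic_weighted:
  assumes "f holomorphic_on ball 0 1"
  shows "weighted \<alpha> f holomorphic_on ball 0 1"
  unfolding weighted_def using one_minus_not_nonpos by (intro holomorphic_intros assms) auto

definition wcoeff :: "real \<Rightarrow> (complex \<Rightarrow> complex) \<Rightarrow> nat \<Rightarrow> complex" where
  "wcoeff \<alpha> f n = (\<Sum>k\<le>n. of_real (Gamma (real (n - k) + \<alpha>) / (Gamma \<alpha> * fact (n - k))) * taylor_coeff f k)"

text \<open>
The inner sum in the definition of the operator is the Cauchy product of the Taylor series of
\<open>f\<close> with the binomial series.
\<close>

lemma weighted_sums:
  assumes f: "f holomorphic_on ball 0 1" and z: "norm z < 1" and \<alpha>: "\<alpha> > 0"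
  shows "(\<lambda>n. wcoeff \<alpha> f n * z ^ n) sums weighted \<alpha> f z"
proof -
  let ?b = "\<lambda>n. of_real (Gamma (real n + \<alpha>) / (Gamma \<alpha> * fact n)) :: complex"
  have A: "(\<lambda>n. taylor_coeff f n * w ^ n) sums f w" if "norm w < 1" for w
    using holomorphic_power_series[OF f, of w] that by (simp add: taylor_coeff_def)
  have B: "(\<lambda>n. ?b n * w ^ n) sums (1 - w) powr (- of_real \<alpha>)" if "norm w < 1" for w
    using one_minus_powr_sums[OF that \<alpha>] .
  obtain \<rho> where \<rho>: "norm z < \<rho>" "\<rho> < 1" using z dense by blast
  then have \<rho>n: "norm (of_real \<rho> :: complex) = \<rho>" using norm_ge_zero[of z] by (simp del: norm_ge_zero)
  have "summable (\<lambda>n. norm (taylor_coeff f n * z ^ n))"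
    by (rule powser_insidea[of _ "of_real \<rho>"]) (use A[of "of_real \<rho>"] \<rho> \<rho>n in \<open>auto simp: sums_iff\<close>)
  moreover have "summable (\<lambda>n. norm (?b n * z ^ n))"
    by (rule powser_insidea[of _ "of_real \<rho>"]) (use B[of "of_real \<rho>"] \<rho> \<rho>n in \<open>auto simp: sums_iff\<close>)
  ultimately have "(\<lambda>n. \<Sum>k\<le>n. (taylor_coeff f k * z ^ k) * (?b (n - k) * z ^ (n - k))) sums
     ((\<Sum>n. taylor_coeff f n * z ^ n) * (\<Sum>n. ?b n * z ^ n))"
    by (rule Cauchy_product_sums)
  also have "(\<lambda>n. \<Sum>k\<le>n. (taylor_coeff f k * z ^ k) * (?b (n - k) * z ^ (n - k))) = (\<lambda>n. wcoeff \<alpha> f n * z ^ n)"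
  proof
    fix n
    have "z ^ k * z ^ (n - k) = z ^ n" if "k \<le> n" for k using that by (simp flip: power_add)
    then show "(\<Sum>k\<le>n. (taylor_coeff f k * z ^ k) * (?b (n - k) * z ^ (n - k))) = wcoeff \<alpha> f n * z ^ n"
      unfolding wcoeff_def sum_distrib_right by (intro sum.cong) (auto simp: algebra_simps)
  qed
  also have "(\<Sum>n. taylor_coeff f n * z ^ n) * (\<Sum>n. ?b n * z ^ n) = weighted \<alpha> f z"
    using A[OF z] B[OF z] by (simp add: sums_iff weighted_def)
  finally show ?thesis .
qed

lemma powser_deriv:
  fixes c :: "nat \<Rightarrow> complex"
  assumes F: "\<And>z. norm z < 1 \<Longrightarrow> (\<lambda>n. c n * z ^ n) sums F z"
  shows "\<And>z. norm z < 1 \<Longrightarrow> (\<lambda>n. of_nat (Suc n) * c (Suc n) * z ^ n) sums deriv F z"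
    and "F holomorphic_on ball 0 1"
proof -
  have D: "(F has_field_derivative (\<Sum>n. diffs c n * z ^ n)) (at z)" if z: "norm z < 1" for z
  proof -
    obtain \<rho> where \<rho>: "norm z < \<rho>" "\<rho> < 1" using z dense by blast
    have "((\<lambda>z. \<Sum>n. c n * z ^ n) has_field_derivative (\<Sum>n. diffs c n * z ^ n)) (at z)"
      by (rule termdiffs_strong[of c "of_real \<rho>"])
       (use F[of "of_real \<rho>"] \<rho> norm_ge_zero[of z] in \<open>auto simp: sums_iff\<close>)
    then show ?thesis
      by (rule has_field_derivative_transform_within_open[of _ _ _ "ball 0 1"])
         (use z F in \<open>auto simp: sums_iff\<close>)
  qed
  show "F holomorphic_on ball 0 1"
    using D by (auto simp: holomorphic_on_open intro!: exI)
  show "(\<lambda>n. of_nat (Suc n) * c (Suc n) * z ^ n) sums deriv F z" if z: "norm z < 1" for z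
  proof -
    obtain \<rho> where \<rho>: "norm z < \<rho>" "\<rho> < 1" using z dense by blast
    have "summable (\<lambda>n. diffs c n * z ^ n)"
      by (rule termdiff_converges[of _ 1]) (use z F in \<open>auto simp: sums_iff\<close>)
    then show ?thesis
      using DERIV_imp_deriv[OF D[OF z]] by (simp add: summable_sums diffs_def)
  qed
qed

text \<open>
The operator and its derivatives as integrals: all three power series arise from that of the
weighted function and its derivatives by inserting moments.
\<close>

lemma cesaro_like_facts:
  assumes \<mu>: "finite_measure \<mu>" "sets \<mu> = sets (restrict_space borel {0..<1::real})"
    and f: "f holomorphic_on ball 0 1" and \<alpha>: "\<alpha> > 0"
  shows cesaro_like_integral: "\<And>z. norm z < 1 \<Longrightarrow>
        cesaro_like \<mu> \<alpha> f z = (LINT t|\<mu>. weighted \<alpha> f (of_real t * z))"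
    and cesaro_like_deriv: "\<And>z. norm z < 1 \<Longrightarrow>
        deriv (cesaro_like \<mu> \<alpha> f) z = (LINT t|\<mu>. of_real t * deriv (weighted \<alpha> f) (of_real t * z))"
    and cesaro_like_deriv2: "\<And>z. norm z < 1 \<Longrightarrow>
        deriv (deriv (cesaro_like \<mu> \<alpha> f)) z = (LINT t|\<mu>. of_real t ^ 2 * deriv (deriv (weighted \<alpha> f)) (of_real t * z))"
    and cesaro_like_integrable: "\<And>z. norm z < 1 \<Longrightarrow> integrable \<mu> (\<lambda>t. weighted \<alpha> f (of_real t * z))"
    and cesaro_like_deriv2_integrable: "\<And>z. norm z < 1 \<Longrightarrow>
           integrable \<mu> (\<lambda>t. of_real t ^ 2 * deriv (deriv (weighted \<alpha> f)) (of_real t * z))"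
    and cesaro_like_hol_disk: "cesaro_like \<mu> \<alpha> f \<in> hol_disk"
proof -
  interpret finite_measure \<mu> by fact
  note sp = unit_interval_measure(1)[OF assms(1,2)]
  let ?c = "wcoeff \<alpha> f" and ?F = "weighted \<alpha> f"
  let ?c1 = "\<lambda>n. of_nat (Suc n) * ?c (Suc n)"
  let ?c2 = "\<lambda>n. of_nat (Suc n) * ?c1 (Suc n)"
  have F0: "(\<lambda>n. ?c n * z ^ n) sums ?F z" if "norm z < 1" for z
    using weighted_sums[OF f that \<alpha>] .
  have F1: "(\<lambda>n. ?c1 n * z ^ n) sums deriv ?F z" if "norm z < 1" for z
    using powser_deriv(1)[OF F0] that by blast
  have F2: "(\<lambda>n. ?c2 n * z ^ n) sums deriv (deriv ?F) z" if "norm z < 1" for z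
    using powser_deriv(1)[OF F1] that by blast
  have tz: "norm (of_real t * z) < 1" if "norm z < 1" "t \<in> space \<mu>" for z :: complex and t
    using that sp mult_strict_mono'[of t 1 "norm z" 1] by (auto simp: norm_mult)
  have gen: "(\<lambda>n. of_real (moment \<mu> (n + m)) * c n * z ^ n) sums
           (LINT t|\<mu>. of_real t ^ m * G (of_real t * z))"
       "integrable \<mu> (\<lambda>t. of_real t ^ m * G (of_real t * z))"
    if G: "\<And>z. norm z < 1 \<Longrightarrow> (\<lambda>n. c n * z ^ n) sums G z" and z: "norm z < 1" for c G and z :: complex and m
  proof -
    have eq: "(\<Sum>n. c n * (of_real t * z) ^ n) = G (of_real t * z)" if "t \<in> space \<mu>" for t
      using G[OF tz[OF z that]] by (simp add: sums_iff)
    note p = power_series_moments[OF \<mu> sums_summable[OF G] z, where m=m]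
    show "(\<lambda>n. of_real (moment \<mu> (n + m)) * c n * z ^ n) sums
           (LINT t|\<mu>. of_real t ^ m * G (of_real t * z))"
      using p(1) eq by (simp cong: Bochner_Integration.integral_cong)
    show "integrable \<mu> (\<lambda>t. of_real t ^ m * G (of_real t * z))"
      using p(2) eq by (simp cong: Bochner_Integration.integrable_cong)
  qed
  let ?C = "cesaro_like \<mu> \<alpha> f"
  have C0: "(\<lambda>n. (of_real (moment \<mu> n) * ?c n) * z ^ n) sums ?C z" if "norm z < 1" for z
  proof -
    have "(\<lambda>n. of_real (moment \<mu> n) * ?c n * z ^ n) sums (LINT t|\<mu>. ?F (of_real t * z))"
      using gen(1)[OF F0 that, of 0] by simp
    moreover have "?C z = (\<Sum>n. of_real (moment \<mu> n) * ?c n * z ^ n)"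
      using that by (simp add: cesaro_like_def wcoeff_def)
    ultimately show ?thesis by (simp add: sums_iff)
  qed
  have C1: "(\<lambda>n. (of_real (moment \<mu> (Suc n)) * ?c1 n) * z ^ n) sums deriv ?C z" if "norm z < 1" for z
    using powser_deriv(1)[OF C0] that by (simp add: mult_ac)
  have C2: "(\<lambda>n. (of_real (moment \<mu> (Suc (Suc n))) * ?c2 n) * z ^ n) sums deriv (deriv ?C) z" if "norm z < 1" for z
    using powser_deriv(1)[OF C1] that by (simp add: mult_ac)
  show "?C \<in> hol_disk"
  proof -
    have "?C holomorphic_on ball 0 1" by (rule powser_deriv(2)[OF C0])
    moreover have "?C z = 0" if "z \<notin> ball 0 1" for z using that by (simp only: cesaro_like_def if_False)
    ultimately show ?thesis by (simp add: hol_disk_def)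
  qed
  fix z :: complex assume z: "norm z < 1"
  show "?C z = (LINT t|\<mu>. ?F (of_real t * z))"
    using sums_unique2[OF C0[OF z]] gen(1)[OF F0 z, of 0] by simp
  show "deriv ?C z = (LINT t|\<mu>. of_real t * deriv ?F (of_real t * z))"
    using sums_unique2[OF C1[OF z]] gen(1)[OF F1 z, of 1] by simp
  show "deriv (deriv ?C) z = (LINT t|\<mu>. of_real t ^ 2 * deriv (deriv ?F) (of_real t * z))"
    using sums_unique2[OF C2[OF z]] gen(1)[OF F2 z, of 2] by simp
  show "integrable \<mu> (\<lambda>t. ?F (of_real t * z))"
    using gen(2)[OF F0 z, of 0] by simp
  show "integrable \<mu> (\<lambda>t. of_real t ^ 2 * deriv (deriv ?F) (of_real t * z))"
    using gen(2)[OF F2 z, of 2] by simp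
qed

section \<open>Growth of Bloch functions and their weighted derivatives\<close>

lemma cball_half_gap_subset:
  fixes z :: complex assumes z: "norm z < 1"
  shows "cball z ((1 - norm z) / 2) \<subseteq> ball 0 1"
proof
  fix x assume "x \<in> cball z ((1 - norm z) / 2)"
  then have "norm x \<le> norm z + (1 - norm z) / 2"
    using norm_triangle_ineq[of z "x - z"] by (simp add: dist_norm norm_minus_commute[of z] field_simps)
  then show "x \<in> ball 0 1" using z by (simp add: field_simps)
qed

text \<open>
The second derivative is controlled by the Cauchy estimate on the circle that reaches half way
to the boundary, and the function itself by integrating the first derivative along a radius.
\<close>

lemma bloch_growth:
  assumes f: "f holomorphic_on ball 0 1" and f0: "norm (f 0) \<le> A"
    and fA: "\<And>z. norm z < 1 \<Longrightarrow> (1 - (norm z)\<^sup>2) * norm (deriv f z) \<le> A"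
    and z: "norm z < 1"
  shows bloch_deriv_le: "norm (deriv f z) \<le> A / (1 - norm z)"
    and bloch_deriv2_le: "norm (deriv (deriv f) z) \<le> 4 * A / (1 - norm z)\<^sup>2"
    and bloch_fun_le: "norm (f z) \<le> A * ln (exp 1 / (1 - norm z))"
proof -
  have A0: "A \<ge> 0" using f0 norm_ge_zero order_trans by blast
  have 1: "norm (deriv f z) \<le> A / (1 - norm z)" if "norm z < 1" for z
  proof -
    have "(1 - norm z) * norm (deriv f z) \<le> (1 - (norm z)\<^sup>2) * norm (deriv f z)"
      using that power_decreasing[of 1 2 "norm z"] by (intro mult_right_mono) auto
    also have "\<dots> \<le> A" by (rule fA[OF that])
    finally show ?thesis using that by (simp add: field_simps)
  qed
  show "norm (deriv f z) \<le> A / (1 - norm z)" using 1 z .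
  have hd: "deriv f holomorphic_on ball 0 1" using f by (intro holomorphic_deriv) auto
  show "norm (deriv (deriv f) z) \<le> 4 * A / (1 - norm z)\<^sup>2"
  proof -
    let ?r = "(1 - norm z) / 2"
    have sub: "cball z ?r \<subseteq> ball 0 1" by (rule cball_half_gap_subset[OF z])
    have "norm ((deriv ^^ 1) (deriv f) z) \<le> fact 1 * (A / ?r) / ?r ^ 1"
    proof (rule Cauchy_inequality)
      show "deriv f holomorphic_on ball z ?r"
        by (rule holomorphic_on_subset[OF hd]) (use sub ball_subset_cball in blast)
      show "continuous_on (cball z ?r) (deriv f)"
        by (intro holomorphic_on_imp_continuous_on holomorphic_on_subset[OF hd sub])
      show "0 < ?r" using z by simp
      fix x assume x: "norm (z - x) = ?r"
      then have "norm x \<le> norm z + ?r"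
        using norm_triangle_ineq[of z "x - z"] by (simp add: norm_minus_commute[of z] field_simps)
      then have x1: "?r \<le> 1 - norm x" by (simp add: field_simps)
      then have "norm (deriv f x) \<le> A / (1 - norm x)" using z by (intro 1) auto
      also have "\<dots> \<le> A / ?r" using x1 z A0 by (intro divide_left_mono) auto
      finally show "norm (deriv f x) \<le> A / ?r" .
    qed
    then show ?thesis by (simp add: power2_eq_square field_simps)
  qed
  show "norm (f z) \<le> A * ln (exp 1 / (1 - norm z))"
  proof -
    have tz: "norm (of_real t * z) < 1" "t * norm z < 1" if "0 \<le> t" "t \<le> 1" for t
    proof -
      have "t * norm z \<le> 1 * norm z" using that by (intro mult_right_mono) auto
      then show "norm (of_real t * z) < 1" "t * norm z < 1" using z that by (auto simp: norm_mult)
    qed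
    have df: "(f has_field_derivative deriv f w) (at w)" if "norm w < 1" for w
      using f that by (intro holomorphic_derivI[OF f]) auto
    have der: "((\<lambda>t. f (of_real t * z)) has_vector_derivative z * deriv f (of_real t * z)) (at t)"
      if "0 \<le> t" "t \<le> 1" for t
    proof -
      have "((\<lambda>t. of_real t * z) has_vector_derivative z) (at t)"
        by (auto intro!: derivative_eq_intros)
      from field_vector_diff_chain_at[OF this df[OF tz(1)[OF that]]] show ?thesis by (simp add: o_def)
    qed
    have der2: "((\<lambda>t. - A * ln (1 - t * norm z)) has_vector_derivative norm z * (A / (1 - t * norm z))) (at t)"
      if "0 \<le> t" "t \<le> 1" for t
      unfolding has_real_derivative_iff_has_vector_derivative[symmetric]
      using tz(2)[OF that] by (auto intro!: derivative_eq_intros simp: field_simps)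
    have "norm (f (of_real 1 * z) - f (of_real 0 * z)) \<le> - A * ln (1 - 1 * norm z) - - A * ln (1 - 0 * norm z)"
    proof (rule differentiable_bound_general[where f' = "\<lambda>t. z * deriv f (of_real t * z)"
            and \<phi>' = "\<lambda>t. norm z * (A / (1 - t * norm z))" and f = "\<lambda>t. f (of_real t * z)"
            and \<phi> = "\<lambda>t. - A * ln (1 - t * norm z)" and a = 0 and b = 1])
      show "continuous_on {0..1} (\<lambda>t. f (of_real t * z))"
        using der by (intro continuous_at_imp_continuous_on)
          (auto intro!: has_vector_derivative_continuous)
      show "continuous_on {0..1} (\<lambda>t. - A * ln (1 - t * norm z))"
        using der2 by (intro continuous_at_imp_continuous_on)
          (metis atLeastAtMost_iff has_vector_derivative_continuous)
      fix t :: real assume t: "0 < t" "t < 1"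
      show "norm (z * deriv f (of_real t * z)) \<le> norm z * (A / (1 - t * norm z))"
        unfolding norm_mult[of z] using 1[OF tz(1)[of t]] t
        by (intro mult_left_mono) (simp_all add: norm_mult)
    qed (use der der2 in auto)
    then have "norm (f z - f 0) \<le> - A * ln (1 - norm z)" by simp
    then have "norm (f z) \<le> A - A * ln (1 - norm z)"
      using f0 norm_triangle_ineq[of "f z - f 0" "f 0"] by simp
    then show ?thesis using z by (simp add: ln_div algebra_simps)
  qed
qed

lemma norm_complex_powr_real:
  "w \<noteq> 0 \<Longrightarrow> norm (w powr of_real a) = norm w powr a" for w :: complex
  by (simp add: powr_def norm_exp_eq_Re)

lemma one_minus_powr_deriv:
  fixes w :: complex assumes "norm w < 1"
  shows "((\<lambda>w. (1 - w) powr (of_real a)) has_field_derivative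
      of_real (- a) * (1 - w) powr (of_real (a - 1))) (at w)"
  using one_minus_not_nonpos[OF assms]
  by (auto intro!: derivative_eq_intros simp: algebra_simps)

lemma deriv_weighted:
  assumes f: "f holomorphic_on ball 0 1" and w: "norm w < 1"
  shows "deriv (weighted \<alpha> f) w = deriv f w * (1 - w) powr (of_real (- \<alpha>))
      + of_real \<alpha> * f w * (1 - w) powr (of_real (- \<alpha> - 1))"
proof -
  have df: "(f has_field_derivative deriv f w) (at w)"
    using f w by (intro holomorphic_derivI[OF f]) auto
  show ?thesis
    unfolding weighted_def using DERIV_mult[OF df one_minus_powr_deriv[OF w, of "- \<alpha>"]]
    by (intro DERIV_imp_deriv) (simp add: algebra_simps)
qed

lemma deriv2_weighted:
  assumes f: "f holomorphic_on ball 0 1" and z: "norm z < 1"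
  shows "deriv (deriv (weighted \<alpha> f)) z =
     deriv (deriv f) z * (1 - z) powr (of_real (- \<alpha>))
     + 2 * of_real \<alpha> * deriv f z * (1 - z) powr (of_real (- \<alpha> - 1))
     + of_real (\<alpha> * (\<alpha> + 1)) * f z * (1 - z) powr (of_real (- \<alpha> - 2))" (is "_ = ?rhs")
proof -
  have df: "(f has_field_derivative deriv f z) (at z)"
    using z by (intro holomorphic_derivI[OF f]) auto
  have hd: "deriv f holomorphic_on ball 0 1" using f by (intro holomorphic_deriv) auto
  have ddf: "(deriv f has_field_derivative deriv (deriv f) z) (at z)"
    using z by (intro holomorphic_derivI[OF hd]) auto
  note dp = one_minus_powr_deriv[OF z]
  have "((\<lambda>w. deriv f w * (1 - w) powr (of_real (- \<alpha>))
       + of_real \<alpha> * f w * (1 - w) powr (of_real (- \<alpha> - 1))) has_field_derivative ?rhs) (at z)"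
    using DERIV_add[OF DERIV_mult[OF ddf dp[of "- \<alpha>"]]
        DERIV_mult[OF DERIV_cmult[OF df, of "of_real \<alpha>"] dp[of "- \<alpha> - 1"]]]
    by (rule DERIV_cong) (simp add: algebra_simps)
  then have "(deriv (weighted \<alpha> f) has_field_derivative ?rhs) (at z)"
    by (rule has_field_derivative_transform_within_open[of _ _ _ "ball 0 1"])
       (use z deriv_weighted[OF f] in auto)
  then show ?thesis by (rule DERIV_imp_deriv)
qed

text \<open>
In the product rule, the negative powers of \<open>|1 - w|\<close> are reduced to the exponents \<open>-1\<close> and
\<open>-2\<close> by means of \<open>1 - |w| \<le> |1 - w|\<close>. The condition \<open>\<alpha> \<ge> 1\<close> enters here: the power of
\<open>1/|1 - w|\<close> attached to \<open>f''\<close> must be at least the first.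
\<close>

lemma deriv2_weighted_le:
  assumes f: "f holomorphic_on ball 0 1" and f0: "norm (f 0) \<le> A"
    and fA: "\<And>z. norm z < 1 \<Longrightarrow> (1 - (norm z)\<^sup>2) * norm (deriv f z) \<le> A"
    and z: "norm z < 1" and \<alpha>: "1 \<le> \<alpha>"
  shows "norm (deriv (deriv (weighted \<alpha> f)) z) \<le> (4 + 2 * \<alpha> + \<alpha> * (\<alpha> + 1)) * A * majorant \<alpha> z"
proof -
  have A0: "A \<ge> 0" using f0 norm_ge_zero order_trans by blast
  let ?u = "norm (1 - z)" and ?v = "1 - norm z"
  let ?L = "ln (exp 1 / ?v)"
  have v: "0 < ?v" "?v \<le> ?u" using z norm_triangle_ineq2[of 1 z] by auto
  have L: "1 \<le> ?L" using ln_ge_one[of "norm z"] z by simp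
  have np: "norm ((1 - z) powr (of_real a)) = ?u powr a" for a
    using v by (intro norm_complex_powr_real) auto
  have pm: "?u powr (- \<alpha> - b) \<le> ?u powr (- c) * ?v powr (c - \<alpha> - b)" if "c \<le> \<alpha> + b" for b c
  proof -
    have "?u powr (- \<alpha> - b) = ?u powr (- c) * ?u powr (c - \<alpha> - b)" by (simp flip: powr_add)
    also have "\<dots> \<le> ?u powr (- c) * ?v powr (c - \<alpha> - b)"
      using v that by (intro mult_left_mono powr_mono2') auto
    finally show ?thesis .
  qed
  let ?k1 = "1 / ?u * ?v powr (- \<alpha> - 1)" and ?k2 = "?u powr (-2) * (?v powr (- \<alpha>) * ?L)"
  have k0: "0 \<le> ?k1" "0 \<le> ?k2" using L v by (auto intro!: mult_nonneg_nonneg simp del: ln_ge_zero_iff)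
  have u1: "?u powr (-1) = 1 / ?u" using v by (simp add: powr_minus_divide)
  have v2: "?v powr (-2) = 1 / ?v\<^sup>2" "?v powr (-1) = 1 / ?v" using v by (simp_all add: powr_minus_divide)
  have t1: "norm (deriv (deriv f) z * (1 - z) powr (of_real (- \<alpha>))) \<le> 4 * A * ?k1"
  proof -
    have "norm (deriv (deriv f) z * (1 - z) powr (of_real (- \<alpha>))) \<le>
        (4 * A / ?v\<^sup>2) * (?u powr (- 1) * ?v powr (1 - \<alpha>))"
      unfolding norm_mult np using bloch_deriv2_le[OF f f0 fA z] pm[of 1 0] \<alpha> A0
      by (intro mult_mono) auto
    also have "(4 * A / ?v\<^sup>2) * (?u powr (- 1) * ?v powr (1 - \<alpha>)) = 4 * A * (1 / ?u * (?v powr (1 - \<alpha>) / ?v\<^sup>2))"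
      unfolding u1 by simp
    also have "?v powr (1 - \<alpha>) / ?v\<^sup>2 = ?v powr (- \<alpha> - 1)"
    proof -
      have "- \<alpha> - 1 = 1 - \<alpha> + (-2)" by simp
      then show ?thesis using v2 by (simp only: powr_add) simp
    qed
    finally show ?thesis .
  qed
  have t2: "norm (2 * of_real \<alpha> * deriv f z * (1 - z) powr (of_real (- \<alpha> - 1))) \<le> 2 * \<alpha> * A * ?k1"
  proof -
    have "norm (2 * of_real \<alpha> * deriv f z * (1 - z) powr (of_real (- \<alpha> - 1))) \<le>
        2 * \<alpha> * (A / ?v) * (?u powr (- 1) * ?v powr (- \<alpha>))"
      unfolding norm_mult np using bloch_deriv_le[OF f f0 fA z] pm[of 1 1] \<alpha> A0 v
      by (intro mult_mono) auto
    also have "2 * \<alpha> * (A / ?v) * (?u powr (- 1) * ?v powr (- \<alpha>)) = 2 * \<alpha> * A * (1 / ?u * (?v powr (- \<alpha>) / ?v))"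
      unfolding u1 by simp
    also have "?v powr (- \<alpha>) / ?v = ?v powr (- \<alpha> - 1)"
    proof -
      have "- \<alpha> - 1 = - \<alpha> + (-1)" by simp
      then show ?thesis using v2 by (simp only: powr_add) simp
    qed
    finally show ?thesis .
  qed
  have na: "norm (of_real (\<alpha> * (\<alpha> + 1)) :: complex) = \<alpha> * (\<alpha> + 1)"
    unfolding norm_of_real using \<alpha> by simp
  have t3: "norm (of_real (\<alpha> * (\<alpha> + 1)) * f z * (1 - z) powr (of_real (- \<alpha> - 2))) \<le> \<alpha> * (\<alpha> + 1) * A * ?k2"
  proof -
    have "norm (of_real (\<alpha> * (\<alpha> + 1)) * f z * (1 - z) powr (of_real (- \<alpha> - 2))) \<le>
        \<alpha> * (\<alpha> + 1) * (A * ?L) * (?u powr (- 2) * ?v powr (- \<alpha>))"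
      unfolding norm_mult[where 'a=complex and x = "_ * f z"] norm_mult[where 'a=complex and y = "f z"] na np
      using bloch_fun_le[OF f f0 fA z] pm[of 2 2] \<alpha> A0 v L
      by (intro mult_mono) (auto intro!: mult_nonneg_nonneg simp del: ln_ge_zero_iff)
    then show ?thesis by (simp add: algebra_simps)
  qed
  have "norm (deriv (deriv (weighted \<alpha> f)) z) \<le> 4 * A * ?k1 + 2 * \<alpha> * A * ?k1 + \<alpha> * (\<alpha> + 1) * A * ?k2"
    unfolding deriv2_weighted[OF f z] by (intro norm_triangle_mono t1 t2 t3)
  also have "\<dots> \<le> (4 + 2 * \<alpha> + \<alpha> * (\<alpha> + 1)) * A * (?k1 + ?k2)"
  proof -
    have "4 * A * p + 2 * \<alpha> * A * p + \<alpha> * (\<alpha> + 1) * A * q \<le> (4 + 2 * \<alpha> + \<alpha> * (\<alpha> + 1)) * A * (p + q)"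
      if "0 \<le> p" "0 \<le> q" for p q
    proof -
      have "0 \<le> \<alpha> * (\<alpha> + 1) * A * p" "0 \<le> (4 + 2 * \<alpha>) * A * q" using that A0 \<alpha> by auto
      then show ?thesis by (simp add: algebra_simps)
    qed
    then show ?thesis using k0 by blast
  qed
  finally show ?thesis by (simp add: majorant_def)
qed

section \<open>Uniform boundedness and the embedding into the Bloch space\<close>

lemma subspace_hol_disk_diff:
  assumes "subspace_hol_disk X" "f \<in> X" "g \<in> X"
  shows "(\<lambda>z. f z - g z) \<in> X"
proof -
  have add: "\<forall>f\<in>X. \<forall>g\<in>X. (\<lambda>z. f z + g z) \<in> X" and scale: "\<forall>c. \<forall>f\<in>X. (\<lambda>z. c * f z) \<in> X"
    using assms(1) by (auto simp: subspace_hol_disk_def)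
  have "(\<lambda>z. (-1) * g z) \<in> X" by (rule scale[THEN spec, THEN bspec, OF assms(3)])
  from add[THEN bspec, OF assms(2), THEN bspec, OF this] show ?thesis by simp
qed

text \<open>
The Banach-Steinhaus theorem for an abstract complete norm on a space of functions. If no
uniform bound exists, nested closed balls with radii tending to 0 can be chosen such that at the
\<open>n\<close>-th step some functional is at least \<open>n\<close> throughout the new ball; their common point
contradicts pointwise boundedness.
\<close>

lemma uniform_boundedness:
  fixes X :: "(complex \<Rightarrow> complex) set" and T :: "'i \<Rightarrow> (complex \<Rightarrow> complex) \<Rightarrow> complex"
  assumes X: "subspace_hol_disk X" "norm_on X N" "complete_on X N"
    and add: "\<And>i f g. i \<in> I \<Longrightarrow> f \<in> X \<Longrightarrow> g \<in> X \<Longrightarrow> T i (\<lambda>z. f z + g z) = T i f + T i g"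
    and scale: "\<And>i c f. i \<in> I \<Longrightarrow> f \<in> X \<Longrightarrow> T i (\<lambda>z. c * f z) = c * T i f"
    and cont: "\<And>i. i \<in> I \<Longrightarrow> \<exists>C. \<forall>f\<in>X. norm (T i f) \<le> C * N f"
    and bdd: "\<And>f. f \<in> X \<Longrightarrow> \<exists>B. \<forall>i\<in>I. norm (T i f) \<le> B"
  shows "\<exists>A\<ge>0. \<forall>i\<in>I. \<forall>f\<in>X. norm (T i f) \<le> A * N f"
proof (rule ccontr)
  assume "\<not> ?thesis"
  then have unb: "\<exists>i\<in>I. \<exists>f\<in>X. norm (T i f) > A * N f" if "A \<ge> 0" for A
    using that by (meson not_le)
  have Xadd: "(\<lambda>z. f z + g z) \<in> X" if "f \<in> X" "g \<in> X" for f g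
    using X(1) that by (auto simp: subspace_hol_disk_def)
  have Xscale: "(\<lambda>z. c * f z) \<in> X" if "f \<in> X" for f c
    using X(1) that by (auto simp: subspace_hol_disk_def)
  have Xdiff: "(\<lambda>z. f z - g z) \<in> X" if "f \<in> X" "g \<in> X" for f g
    using subspace_hol_disk_diff[OF X(1) that] .
  have Nscale: "N (\<lambda>z. c * f z) = norm c * N f" if "f \<in> X" for f c
    using X(2) that unfolding norm_on_def by blast
  have Ntri: "N (\<lambda>z. f z + g z) \<le> N f + N g" if "f \<in> X" "g \<in> X" for f g
    using X(2) that unfolding norm_on_def by blast
  have N0: "0 \<le> N f" if "f \<in> X" for f using X(2) that unfolding norm_on_def by blast
  have Nzero: "N f = 0 \<longleftrightarrow> f = (\<lambda>z. 0)" if "f \<in> X" for f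
    using X(2) that unfolding norm_on_def by blast
  have Ntri2: "N (\<lambda>z. f z - h z) \<le> N (\<lambda>z. f z - g z) + N (\<lambda>z. g z - h z)"
    if "f \<in> X" "g \<in> X" "h \<in> X" for f g h
    using Ntri[OF Xdiff[OF that(1,2)] Xdiff[OF that(2,3)]] by simp
  have Ncomm: "N (\<lambda>z. f z - g z) = N (\<lambda>z. g z - f z)" if "f \<in> X" "g \<in> X" for f g
    using Nscale[OF Xdiff[OF that], of "-1"] by simp
  have Tdiff: "T i (\<lambda>z. f z - g z) = T i f - T i g" if "i \<in> I" "f \<in> X" "g \<in> X" for i f g
    using add[OF that(1,2) Xscale[OF that(3), of "-1"]] scale[OF that(1,3), of "-1"] by simp
  have step: "\<exists>x' r'. x' \<in> X \<and> 0 < r' \<and> r' \<le> r / 2 \<and> N (\<lambda>z. x' z - x z) \<le> r / 2 \<and>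
      (\<exists>i\<in>I. \<forall>y\<in>X. N (\<lambda>z. y z - x' z) \<le> r' \<longrightarrow> norm (T i y) \<ge> real n)"
    if x: "x \<in> X" and r: "0 < r" for x r n
  proof -
    obtain i f where i: "i \<in> I" and f: "f \<in> X" and big: "norm (T i f) > (2 / r * (real n + 1)) * N f"
      using unb[of "2 / r * (real n + 1)"] r by auto
    have "N f \<noteq> 0"
    proof
      assume "N f = 0"
      then have "f = (\<lambda>z. 0)" using Nzero[OF f] by simp
      then have "T i f = 0" using scale[OF i f, of 0] by simp
      then show False using big \<open>N f = 0\<close> by simp
    qed
    then have Nf: "N f > 0" using N0[OF f] by simp
    define c :: complex where "c = of_real (r / 2 / N f)"
    define \<xi> where "\<xi> = (\<lambda>z. c * f z)"
    have \<xi>: "\<xi> \<in> X" unfolding \<xi>_def by (rule Xscale[OF f])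
    have N\<xi>: "N \<xi> = r / 2" unfolding \<xi>_def Nscale[OF f] using Nf r by (simp add: c_def norm_divide)
    have "norm (T i \<xi>) = r / 2 / N f * norm (T i f)"
      unfolding \<xi>_def scale[OF i f] using Nf r by (simp add: c_def norm_mult norm_divide)
    also have "\<dots> > r / 2 / N f * ((2 / r * (real n + 1)) * N f)"
      using Nf r big by (intro mult_strict_left_mono) auto
    finally have T\<xi>: "norm (T i \<xi>) > real n + 1" using Nf r by simp
    \<comment> \<open>One of \<open>x + \<xi>\<close> and \<open>x - \<xi>\<close> works, because the values of \<open>T i\<close> there differ by \<open>2 T i \<xi>\<close>.\<close>
    have "\<exists>x'\<in>X. N (\<lambda>z. x' z - x z) \<le> r / 2 \<and> norm (T i x') \<ge> real n + 1"
    proof (rule ccontr)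
      assume neg: "\<not> ?thesis"
      have "N (\<lambda>z. (x z + \<xi> z) - x z) \<le> r / 2" using N\<xi> by simp
      then have a: "norm (T i (\<lambda>z. x z + \<xi> z)) < real n + 1" using neg Xadd[OF x \<xi>] by (meson not_le)
      have "N (\<lambda>z. (x z - \<xi> z) - x z) \<le> r / 2" using N\<xi> Nscale[OF \<xi>, of "-1"] by simp
      then have b: "norm (T i (\<lambda>z. x z - \<xi> z)) < real n + 1" using neg Xdiff[OF x \<xi>] by (meson not_le)
      have "2 * norm (T i \<xi>) = norm (2 * T i \<xi>)" by (simp add: norm_mult)
      also have "2 * T i \<xi> = (T i x + T i \<xi>) - (T i x - T i \<xi>)" by simp
      also have "norm \<dots> \<le> norm (T i x + T i \<xi>) + norm (T i x - T i \<xi>)" by (rule norm_triangle_ineq4)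
      also have "\<dots> < 2 * (real n + 1)" using a b unfolding add[OF i x \<xi>] Tdiff[OF i x \<xi>] by simp
      finally show False using T\<xi> by simp
    qed
    then obtain x' where x': "x' \<in> X" "N (\<lambda>z. x' z - x z) \<le> r / 2" "norm (T i x') \<ge> real n + 1" by blast
    obtain C where C: "\<And>f. f \<in> X \<Longrightarrow> norm (T i f) \<le> C * N f" using cont[OF i] by blast
    \<comment> \<open>The second entry keeps the variation of \<open>T i\<close> on the new ball at most 1.\<close>
    define r' where "r' = min (r / 2) (1 / (\<bar>C\<bar> + 1))"
    have r': "0 < r'" "r' \<le> r / 2" "\<bar>C\<bar> * r' \<le> 1"
    proof -
      show "0 < r'" "r' \<le> r / 2" using r by (auto simp: r'_def)
      have "\<bar>C\<bar> * r' \<le> \<bar>C\<bar> * (1 / (\<bar>C\<bar> + 1))" by (intro mult_left_mono) (auto simp: r'_def)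
      also have "\<dots> \<le> 1" by (simp add: field_simps)
      finally show "\<bar>C\<bar> * r' \<le> 1" .
    qed
    have "norm (T i y) \<ge> real n" if y: "y \<in> X" and d: "N (\<lambda>z. y z - x' z) \<le> r'" for y
    proof -
      have "norm (T i y - T i x') \<le> C * N (\<lambda>z. y z - x' z)"
        using C[OF Xdiff[OF y x'(1)]] Tdiff[OF i y x'(1)] by simp
      also have "\<dots> \<le> \<bar>C\<bar> * r'" using d N0[OF Xdiff[OF y x'(1)]] by (intro mult_mono) auto
      finally have "norm (T i y - T i x') \<le> 1" using r' by simp
      then show ?thesis using x'(3) norm_triangle_ineq2[of "T i x'" "T i y"] by (simp add: norm_minus_commute)
    qed
    then show ?thesis using x' r' i by (intro exI[of _ x'] exI[of _ r'] conjI bexI[of _ i] ballI impI)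
  qed
  have "\<exists>s. \<forall>n. (fst (s n) \<in> X \<and> 0 < snd (s n)) \<and>
      (snd (s (Suc n)) \<le> snd (s n) / 2 \<and> N (\<lambda>z. fst (s (Suc n)) z - fst (s n) z) \<le> snd (s n) / 2 \<and>
      (\<exists>i\<in>I. \<forall>y\<in>X. N (\<lambda>z. y z - fst (s (Suc n)) z) \<le> snd (s (Suc n)) \<longrightarrow> norm (T i y) \<ge> real n))"
  proof (rule dependent_nat_choice)
    have "(\<lambda>z. 0) \<in> X" using X(1) by (simp add: subspace_hol_disk_def)
    then show "\<exists>p :: (complex \<Rightarrow> complex) \<times> real. fst p \<in> X \<and> 0 < snd p"
      by - (rule exI[of _ "((\<lambda>z::complex. 0::complex), 1::real)"], simp)
    fix p :: "(complex \<Rightarrow> complex) \<times> real" and n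
    assume "fst p \<in> X \<and> 0 < snd p"
    then have p: "fst p \<in> X" "0 < snd p" by auto
    from step[OF p, of n] obtain x' r' where "x' \<in> X \<and> 0 < r' \<and> r' \<le> snd p / 2 \<and> N (\<lambda>z. x' z - fst p z) \<le> snd p / 2 \<and>
      (\<exists>i\<in>I. \<forall>y\<in>X. N (\<lambda>z. y z - x' z) \<le> r' \<longrightarrow> norm (T i y) \<ge> real n)"
      by (elim exE)
    then show "\<exists>q. (fst q \<in> X \<and> 0 < snd q) \<and> snd q \<le> snd p / 2 \<and> N (\<lambda>z. fst q z - fst p z) \<le> snd p / 2 \<and>
      (\<exists>i\<in>I. \<forall>y\<in>X. N (\<lambda>z. y z - fst q z) \<le> snd q \<longrightarrow> norm (T i y) \<ge> real n)"
      by (intro exI[of _ "(x', r')"]) simp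
  qed
  then obtain s where S: "\<forall>n. (fst (s n) \<in> X \<and> 0 < snd (s n)) \<and>
      (snd (s (Suc n)) \<le> snd (s n) / 2 \<and> N (\<lambda>z. fst (s (Suc n)) z - fst (s n) z) \<le> snd (s n) / 2 \<and>
      (\<exists>i\<in>I. \<forall>y\<in>X. N (\<lambda>z. y z - fst (s (Suc n)) z) \<le> snd (s (Suc n)) \<longrightarrow> norm (T i y) \<ge> real n))"
    by (elim exE)
  note s = S[THEN spec, THEN conjunct1, THEN conjunct1] S[THEN spec, THEN conjunct1, THEN conjunct2]
    S[THEN spec, THEN conjunct2, THEN conjunct1] S[THEN spec, THEN conjunct2, THEN conjunct2, THEN conjunct1]
    S[THEN spec, THEN conjunct2, THEN conjunct2, THEN conjunct2]
  define x where "x n = fst (s n)" for n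
  define r where "r n = snd (s n)" for n
  note s' = s[folded x_def r_def]
  have near: "N (\<lambda>z. x (n + k) z - x n z) \<le> r n - r (n + k)" for n k
  proof (induction k)
    case 0
    then show ?case using Nzero[of "\<lambda>z. 0"] X(1) by (simp add: subspace_hol_disk_def)
  next
    case (Suc k)
    have "N (\<lambda>z. x (n + Suc k) z - x n z) \<le> N (\<lambda>z. x (Suc (n + k)) z - x (n + k) z) + N (\<lambda>z. x (n + k) z - x n z)"
      using Ntri2[OF s'(1)[of "Suc (n + k)"] s'(1)[of "n + k"] s'(1)[of n]] by simp
    also have "\<dots> \<le> r (n + k) / 2 + (r n - r (n + k))" by (intro add_mono s'(4) Suc.IH)
    also have "\<dots> \<le> r n - r (n + Suc k)" using s'(3)[of "n + k"] by simp
    finally show ?case .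
  qed
  have r_small: "r n \<le> r 0 / 2 ^ n" for n
  proof (induction n)
    case (Suc n)
    have "r (Suc n) \<le> r n / 2" by (rule s')
    also have "\<dots> \<le> r 0 / 2 ^ n / 2" using Suc.IH by simp
    finally show ?case by simp
  qed simp
  have r0: "r \<longlonglongrightarrow> 0"
  proof (rule tendsto_sandwich[OF _ _ tendsto_const])
    show "(\<lambda>n. r 0 / 2 ^ n) \<longlonglongrightarrow> 0"
      using tendsto_mult_right_zero[OF LIMSEQ_power_zero[of "1/2::real"], of "r 0"] by (simp add: power_divide)
    show "\<forall>\<^sub>F n in sequentially. 0 \<le> r n" by (auto intro!: always_eventually less_imp_le s'(2))
    show "\<forall>\<^sub>F n in sequentially. r n \<le> r 0 / 2 ^ n" using r_small by auto
  qed
  have near': "N (\<lambda>z. x m z - x n z) \<le> r n" if "n \<le> m" for m n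
    using near[of n "m - n"] that s'(2)[of m] by simp
  have "\<forall>e>0. \<exists>M. \<forall>m\<ge>M. \<forall>n\<ge>M. N (\<lambda>z. x m z - x n z) < e"
  proof (intro allI impI)
    fix e :: real assume "0 < e"
    then obtain M where M: "r M < e / 2"
      using r0[THEN order_tendstoD(2), of "e/2"] by (auto simp: eventually_sequentially)
    have "N (\<lambda>z. x m z - x n z) < e" if "m \<ge> M" "n \<ge> M" for m n
    proof -
      have "N (\<lambda>z. x m z - x n z) \<le> N (\<lambda>z. x m z - x M z) + N (\<lambda>z. x M z - x n z)"
        by (rule Ntri2) (rule s')+
      also have "N (\<lambda>z. x M z - x n z) = N (\<lambda>z. x n z - x M z)" by (rule Ncomm) (rule s')+
      also have "N (\<lambda>z. x m z - x M z) + \<dots> \<le> r M + r M" using that by (intro add_mono near')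
      finally show ?thesis using M by simp
    qed
    then show "\<exists>M. \<forall>m\<ge>M. \<forall>n\<ge>M. N (\<lambda>z. x m z - x n z) < e" by blast
  qed
  then obtain f where f: "f \<in> X" and lim: "(\<lambda>n. N (\<lambda>z. x n z - f z)) \<longlonglongrightarrow> 0"
    using X(3) s'(1) unfolding complete_on_def by blast
  have close: "N (\<lambda>z. f z - x n z) \<le> r n" for n
  proof (rule LIMSEQ_le_const)
    show "(\<lambda>m. N (\<lambda>z. x m z - f z) + r n) \<longlonglongrightarrow> r n"
      using tendsto_add[OF lim tendsto_const[of "r n"]] by simp
  next
    have "N (\<lambda>z. f z - x n z) \<le> N (\<lambda>z. x m z - f z) + r n" if "n \<le> m" for m
      using Ntri2[OF f s'(1)[of m] s'(1)[of n]] near'[OF that] Ncomm[OF f s'(1)[of m]] by simp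
    then show "\<exists>M. \<forall>m\<ge>M. N (\<lambda>z. f z - x n z) \<le> N (\<lambda>z. x m z - f z) + r n" by blast
  qed
  obtain B where B: "\<And>i. i \<in> I \<Longrightarrow> norm (T i f) \<le> B" using bdd[OF f] by blast
  obtain n :: nat where "real n > B" using reals_Archimedean2 by blast
  moreover obtain i where "i \<in> I" "norm (T i f) \<ge> real n" using s'(5)[of n] close[of "Suc n"] f by blast
  ultimately show False using B[of i] by simp
qed

lemma banach_subspace_bounded_on_compact:
  assumes "banach_subspace X N" "compact K" "K \<subseteq> ball 0 1"
  shows "\<exists>C\<ge>0. \<forall>f\<in>X. \<forall>z\<in>K. norm (f z) \<le> C * N f"
proof -
  have X: "subspace_hol_disk X" "norm_on X N" using assms(1) by (auto simp: banach_subspace_def)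
  have z: "(\<lambda>z. 0) \<in> X" using X(1) by (simp add: subspace_hol_disk_def)
  have "\<forall>f\<in>X. \<forall>K e. compact K \<and> K \<subseteq> ball 0 1 \<and> 0 < e
     \<longrightarrow> (\<exists>d>0. \<forall>g\<in>X. N (\<lambda>z. g z - f z) < d \<longrightarrow> (\<forall>z\<in>K. dist (g z) (f z) < e))"
    using assms(1) unfolding banach_subspace_def by (elim conjE)
  from this[THEN bspec, OF z, THEN spec, of K, THEN spec, of 1] assms(2,3)
  have "\<exists>d>0. \<forall>g\<in>X. N g < d \<longrightarrow> (\<forall>z\<in>K. norm (g z) < 1)" by simp
  then obtain d where d: "d > 0" "\<And>g z. g \<in> X \<Longrightarrow> N g < d \<Longrightarrow> z \<in> K \<Longrightarrow> norm (g z) < 1" by blast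
  have "norm (f z) \<le> 2 / d * N f" if f: "f \<in> X" and z: "z \<in> K" for f z
  proof (cases "N f = 0")
    case True
    then have "f = (\<lambda>z. 0)" using X(2) f by (simp add: norm_on_def)
    then show ?thesis using True by simp
  next
    case False
    then have Nf: "N f > 0" using X(2) f by (simp add: norm_on_def order_less_le)
    let ?c = "of_real (d / 2 / N f) :: complex"
    have c: "norm ?c = d / 2 / N f" using Nf d by (simp add: norm_divide)
    have "N (\<lambda>z. ?c * f z) = norm ?c * N f" using X(2) f unfolding norm_on_def by blast
    also have "\<dots> < d" unfolding c using Nf d by simp
    finally have "N (\<lambda>z. ?c * f z) < d" .
    moreover have "(\<lambda>z. ?c * f z) \<in> X" using X(1) f unfolding subspace_hol_disk_def by blast
    ultimately have "norm (?c * f z) < 1" using d(2)[of "\<lambda>z. ?c * f z" z] z by simp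
    then have "d / 2 / N f * norm (f z) < 1" by (simp only: norm_mult c)
    then show ?thesis using Nf d by (simp add: field_simps)
  qed
  then show ?thesis using d by (intro exI[of _ "2 / d"]) auto
qed

text \<open>
Each functional \<open>f \<mapsto> (1 - |z|\<^sup>2) f'(z)\<close> is continuous on \<open>X\<close> by the Cauchy estimate, and the
inclusion of \<open>X\<close> in the Bloch space bounds them pointwise. Uniform boundedness therefore takes the
place of the closed graph theorem.
\<close>

lemma banach_subspace_bloch_bound:
  assumes B: "banach_subspace X N" and Xb: "X \<subseteq> bloch"
  shows "\<exists>A\<ge>0. \<forall>f\<in>X. norm (f 0) \<le> A * N f \<and> (\<forall>z. norm z < 1 \<longrightarrow> (1 - (norm z)\<^sup>2) * norm (deriv f z) \<le> A * N f)"
proof -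
  have X: "subspace_hol_disk X" "norm_on X N" "complete_on X N" using B by (auto simp: banach_subspace_def)
  have hol: "f holomorphic_on ball 0 1" if "f \<in> X" for f
    using X(1) that by (auto simp: subspace_hol_disk_def hol_disk_def)
  have diff: "f field_differentiable at z" if "f \<in> X" "norm z < 1" for f z
    using hol[OF that(1)] that(2) by (intro holomorphic_on_imp_differentiable_at[of f "ball 0 1"]) auto
  have N0: "0 \<le> N f" if "f \<in> X" for f using X(2) that unfolding norm_on_def by blast
  let ?w = "\<lambda>z. of_real (1 - (norm z)\<^sup>2) :: complex"
  have nw: "norm (?w z) = 1 - (norm z)\<^sup>2" if "norm z < 1" for z :: complex
    using that by (simp only: norm_of_real) (simp add: abs_square_le_1)
  have "\<exists>A\<ge>0. \<forall>z\<in>ball 0 1. \<forall>f\<in>X. norm (?w z * deriv f z) \<le> A * N f"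
  proof (rule uniform_boundedness[OF X])
    fix z :: complex assume "z \<in> ball 0 1"
    then have z: "norm z < 1" by simp
    show "?w z * deriv (\<lambda>z. f z + g z) z = ?w z * deriv f z + ?w z * deriv g z" if "f \<in> X" "g \<in> X" for f g
      using deriv_add[OF diff[OF that(1) z] diff[OF that(2) z]] by (simp add: distrib_left)
    show "?w z * deriv (\<lambda>z. c * f z) z = c * (?w z * deriv f z)" if "f \<in> X" for f c
      using deriv_cmult[OF diff[OF that z]] by simp
    let ?r = "(1 - norm z) / 2"
    have r: "0 < ?r" using z by simp
    have sub: "cball z ?r \<subseteq> ball 0 1" by (rule cball_half_gap_subset[OF z])
    obtain C where C: "\<And>f x. f \<in> X \<Longrightarrow> x \<in> cball z ?r \<Longrightarrow> norm (f x) \<le> C * N f"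
      using banach_subspace_bounded_on_compact[OF B compact_cball sub] by blast
    show "\<exists>C. \<forall>f\<in>X. norm (?w z * deriv f z) \<le> C * N f"
    proof (intro exI ballI)
      fix f assume f: "f \<in> X"
      have "norm ((deriv ^^ 1) f z) \<le> fact 1 * (C * N f) / ?r ^ 1"
      proof (rule Cauchy_inequality)
        show "f holomorphic_on ball z ?r"
          by (rule holomorphic_on_subset[OF hol[OF f]]) (use sub ball_subset_cball in blast)
        show "continuous_on (cball z ?r) f"
          by (intro holomorphic_on_imp_continuous_on holomorphic_on_subset[OF hol[OF f] sub])
        show "norm (f x) \<le> C * N f" if "norm (z - x) = ?r" for x
          using that by (intro C f) (simp add: dist_norm)
      qed (rule r)
      then have "norm (deriv f z) \<le> C * N f / ?r" by simp
      moreover have "norm (?w z * deriv f z) \<le> 1 * norm (deriv f z)"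
        unfolding norm_mult nw[OF z] by (intro mult_right_mono) auto
      ultimately show "norm (?w z * deriv f z) \<le> (C / ?r) * N f" by (simp add: mult_ac)
    qed
  next
    fix f assume f: "f \<in> X"
    then have "bdd_above ((\<lambda>z. (1 - (norm z)\<^sup>2) * norm (deriv f z)) ` ball 0 1)"
      using Xb by (auto simp: bloch_def)
    then obtain M where "\<forall>z\<in>ball 0 1. (1 - (norm z)\<^sup>2) * norm (deriv f z) \<le> M"
      by (auto simp: bdd_above_def)
    then show "\<exists>B. \<forall>z\<in>ball 0 1. norm (?w z * deriv f z) \<le> B"
      by (intro exI[of _ M] ballI) (metis norm_mult nw mem_ball_0)
  qed
  then obtain A where A: "A \<ge> 0" "\<And>z f. norm z < 1 \<Longrightarrow> f \<in> X \<Longrightarrow> norm (?w z * deriv f z) \<le> A * N f" by auto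
  obtain C where C: "C \<ge> 0" "\<And>f. f \<in> X \<Longrightarrow> norm (f 0) \<le> C * N f"
    using banach_subspace_bounded_on_compact[OF B, of "{0}"] by auto
  show ?thesis
  proof (intro exI[of _ "A + C"] conjI ballI allI impI)
    fix f assume f: "f \<in> X"
    have le: "A * N f \<le> (A + C) * N f" "C * N f \<le> (A + C) * N f"
      using A C N0[OF f] by (auto intro!: mult_right_mono)
    show "norm (f 0) \<le> (A + C) * N f" using C(2)[OF f] le by simp
    fix z :: complex assume z: "norm z < 1"
    show "(1 - (norm z)\<^sup>2) * norm (deriv f z) \<le> (A + C) * N f"
      using order_trans[OF A(2)[OF z f] le(1)] unfolding norm_mult nw[OF z] .
  qed (use A C in simp)
qed

section \<open>Necessity: the logarithm as a test function\<close>

text \<open>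
This is \<open>log(e/(1 - z))\<close>: on the radius its values are the logarithms that appear in the integral
condition.
\<close>

definition log_fun :: "complex \<Rightarrow> complex" where
  "log_fun z = (if norm z < 1 then 1 - Ln (1 - z) else 0)"

lemma log_fun_deriv:
  assumes "norm z < 1" shows "(log_fun has_field_derivative 1 / (1 - z)) (at z)"
proof -
  have "((\<lambda>z. 1 - Ln (1 - z)) has_field_derivative 1 / (1 - z)) (at z)"
    using one_minus_not_nonpos[OF assms] by (auto intro!: derivative_eq_intros simp: field_simps)
  then show ?thesis
    by (rule has_field_derivative_transform_within_open[of _ _ _ "ball 0 1"])
       (use assms in \<open>auto simp: log_fun_def\<close>)
qed

lemma log_fun_hol: "log_fun \<in> hol_disk"
  using log_fun_deriv by (auto simp: hol_disk_def holomorphic_on_open log_fun_def intro!: exI)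

text \<open>
The derivative is \<open>1/(1 - z)\<close>, and its integral mean of order \<open>s > 1\<close> grows at
most at the rate that the space allows.
\<close>

lemma log_fun_mean_lipschitz:
  assumes s: "1 < s"
  shows "log_fun \<in> mean_lipschitz s"
proof -
  define K where "K = 20 * 10 powr (s - 1) / (s - 1)"
  have K: "K > 0" using s by (simp add: K_def)
  have "(1 - r) powr (1 - 1 / s) * integral_mean s r (deriv log_fun) \<le> (1 / (2 * pi) * K) powr (1 / s)"
    if r: "r \<in> {0..<1}" for r
  proof -
    have dl: "norm (deriv log_fun (of_real r * exp (\<i> * of_real t))) powr s = norm (1 - of_real r * cis t) powr (- s)" for t
    proof -
      have n: "norm (of_real r * cis t) < 1" using r by (simp add: norm_mult)
      then have "1 - of_real r * cis t \<noteq> 0" using one_minus_not_nonpos[OF n] by auto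
      then show ?thesis
        using DERIV_imp_deriv[OF log_fun_deriv[OF n]]
        by (simp add: cis_conv_exp[symmetric] norm_divide powr_divide powr_minus_divide)
    qed
    let ?I = "LINT t:{0..2*pi}|lborel. norm (1 - of_real r * cis t) powr (- s)"
    have "?I = enn2real (\<integral>\<^sup>+t\<in>{0..2*pi}. ennreal (norm (1 - of_real r * cis t) powr (- s)) \<partial>lborel)"
      unfolding set_lebesgue_integral_def
      by (subst integral_eq_nn_integral) (auto intro!: arg_cong[where f=enn2real] nn_integral_cong simp: indicator_def)
    also have "\<dots> \<le> enn2real (ennreal (K * (1 - r) powr (1 - s)))"
      unfolding K_def using circle_integral_powr_le[of r s] r s by (intro enn2real_mono) auto
    finally have I: "?I \<le> K * (1 - r) powr (1 - s)" using K by simp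
    have I0: "0 \<le> ?I" unfolding set_lebesgue_integral_def by (intro integral_nonneg_AE) auto
    have "integral_mean s r (deriv log_fun) = (1 / (2 * pi) * ?I) powr (1 / s)"
      unfolding integral_mean_def dl ..
    also have "\<dots> \<le> (1 / (2 * pi) * (K * (1 - r) powr (1 - s))) powr (1 / s)"
      using I I0 s by (intro powr_mono2 mult_left_mono) auto
    also have "\<dots> = (1 / (2 * pi) * K) powr (1 / s) * (1 - r) powr ((1 - s) * (1 / s))"
      using K by (simp add: powr_mult powr_powr powr_divide)
    finally have "(1 - r) powr (1 - 1 / s) * integral_mean s r (deriv log_fun) \<le>
       (1 - r) powr (1 - 1 / s) * ((1 / (2 * pi) * K) powr (1 / s) * (1 - r) powr ((1 - s) * (1 / s)))"
      by (intro mult_left_mono) auto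
    also have "\<dots> = (1 / (2 * pi) * K) powr (1 / s) * (1 - r) powr ((1 - 1 / s) + (1 - s) * (1 / s))"
      unfolding powr_add by (simp only: mult_ac)
    also have "(1 - 1 / s) + (1 - s) * (1 / s) = 0" using s by (simp add: field_simps)
    finally show ?thesis using r by simp
  qed
  then have "bdd_above ((\<lambda>r. (1 - r) powr (1 - 1 / s) * integral_mean s r (deriv log_fun)) ` {0..<1})"
    by (intro bdd_aboveI2)
  then show ?thesis using log_fun_hol by (simp add: mean_lipschitz_def)
qed

text \<open>
A pointwise substitute for Hardy's inequality. Cauchy's formula at the point \<open>r\<close> for
\<open>u \<mapsto> h(ru)\<close> over the unit circle expresses \<open>h(r\<^sup>2)\<close> by values of \<open>h\<close> on the circle of radius \<open>r\<close>,
and the Cauchy kernel is at most \<open>1/(1 - r) \<le> 2/(1 - r\<^sup>2)\<close>.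
\<close>

lemma diagonal_value_le_circle_integral:
  assumes h: "h holomorphic_on ball 0 1" and r: "0 \<le> r" "r < 1"
  shows "ennreal (pi * ((1 - r\<^sup>2) * norm (h (of_real (r\<^sup>2))))) \<le> (\<integral>\<^sup>+t\<in>{0..2*pi}. ennreal (norm (h (of_real r * cis t))) \<partial>lborel)"
proof -
  let ?k = "\<lambda>u. h (of_real r * u)"
  have sub: "of_real r * u \<in> ball 0 1" if "norm u \<le> 1" for u :: complex
    using r that mult_left_mono[of "norm u" 1 r] by (simp add: norm_mult)
  have k: "?k holomorphic_on cball 0 1"
    by (rule holomorphic_on_compose_gen[of "\<lambda>u. of_real r * u" _ h, unfolded o_def, OF _ h])
       (use sub in \<open>auto intro!: holomorphic_intros\<close>)
  have "((\<lambda>u. ?k u / (u - of_real r)) has_contour_integral 2 * of_real pi * \<i> * ?k (of_real r)) (circlepath 0 1)"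
    by (rule Cauchy_integral_circlepath_simple[OF k]) (use r in simp)
  then have hi: "((\<lambda>t. ?k (0 + 1 * cis t) / (0 + 1 * cis t - of_real r) * 1 * \<i> * cis t) has_integral 2 * of_real pi * \<i> * ?k (of_real r)) {0..2*pi}"
    unfolding circlepath_def by (subst (asm) has_contour_integral_part_circlepath_iff) auto
  let ?f = "\<lambda>t. ?k (cis t) / (cis t - of_real r) * \<i> * cis t"
  have ne: "1 - r \<le> norm (cis t - of_real r)" for t
    using norm_triangle_ineq2[of "cis t" "of_real r"] r by simp
  have cont: "continuous_on {0..2*pi} ?f"
  proof -
    have "continuous_on {0..2*pi} (\<lambda>t. ?k (cis t))"
      by (rule continuous_on_compose2[OF holomorphic_on_imp_continuous_on[OF k]]) (auto intro!: continuous_intros)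
    moreover have "cis t - of_real r \<noteq> 0" for t using ne[of t] r by auto
    ultimately show ?thesis by (intro continuous_intros) auto
  qed
  have si: "set_integrable lborel {0..2*pi} ?f" by (rule borel_integrable_atLeastAtMost'[OF cont])
  have "(LINT t:{0..2*pi}|lborel. ?f t) = 2 * of_real pi * \<i> * ?k (of_real r)"
    using set_borel_integral_eq_integral(2)[OF si] integral_unique[OF hi] by simp
  then have eq: "norm (LINT t:{0..2*pi}|lborel. ?f t) = 2 * pi * norm (h (of_real (r\<^sup>2)))"
    by (simp add: norm_mult power2_eq_square)
  have "ennreal (2 * pi * norm (h (of_real (r\<^sup>2)))) \<le> (\<integral>\<^sup>+t. norm (indicator {0..2*pi} t *\<^sub>R ?f t) \<partial>lborel)"
    unfolding eq[symmetric] set_lebesgue_integral_def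
    by (rule integral_norm_bound_ennreal) (use si in \<open>simp add: set_integrable_def\<close>)
  also have "\<dots> \<le> (\<integral>\<^sup>+t. ennreal (1 / (1 - r)) * (ennreal (norm (h (of_real r * cis t))) * indicator {0..2*pi} t) \<partial>lborel)"
  proof (rule nn_integral_mono)
    fix t
    have "norm (?f t) \<le> 1 / (1 - r) * norm (h (of_real r * cis t))"
      using ne[of t] r by (simp add: norm_mult norm_divide frac_le)
    then show "ennreal (norm (indicator {0..2*pi} t *\<^sub>R ?f t)) \<le> ennreal (1 / (1 - r)) * (ennreal (norm (h (of_real r * cis t))) * indicator {0..2*pi} t)"
      using r by (cases "t \<in> {0..2*pi}") (simp_all add: ennreal_leI flip: ennreal_mult')
  qed
  also have "\<dots> = ennreal (1 / (1 - r)) * (\<integral>\<^sup>+t\<in>{0..2*pi}. ennreal (norm (h (of_real r * cis t))) \<partial>lborel)"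
  proof (rule nn_integral_cmult)
    have "continuous_on UNIV (\<lambda>t. h (of_real r * cis t))"
      by (rule continuous_on_compose2[OF holomorphic_on_imp_continuous_on[OF k]]) (auto intro!: continuous_intros)
    then have [measurable]: "(\<lambda>t. h (of_real r * cis t)) \<in> borel_measurable borel"
      by (rule borel_measurable_continuous_onI)
    show "(\<lambda>t. ennreal (norm (h (of_real r * cis t))) * indicator {0..2*pi} t) \<in> borel_measurable lborel"
      by measurable
  qed
  finally have main: "ennreal (2 * pi * norm (h (of_real (r\<^sup>2)))) \<le> ennreal (1 / (1 - r)) * (\<integral>\<^sup>+t\<in>{0..2*pi}. ennreal (norm (h (of_real r * cis t))) \<partial>lborel)" .
  have "ennreal (pi * ((1 - r\<^sup>2) * norm (h (of_real (r\<^sup>2))))) \<le> ennreal ((1 - r) * (2 * pi * norm (h (of_real (r\<^sup>2)))))"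
  proof (rule ennreal_leI)
    have "1 - r\<^sup>2 \<le> 2 * (1 - r)" using zero_le_power2[of "1 - r"] by (simp add: power2_eq_square algebra_simps)
    then have "(1 - r\<^sup>2) * (pi * norm (h (of_real (r\<^sup>2)))) \<le> 2 * (1 - r) * (pi * norm (h (of_real (r\<^sup>2))))"
      by (intro mult_right_mono) auto
    then show "pi * ((1 - r\<^sup>2) * norm (h (of_real (r\<^sup>2)))) \<le> (1 - r) * (2 * pi * norm (h (of_real (r\<^sup>2))))"
      by (simp only: mult_ac)
  qed
  also have "\<dots> = ennreal (1 - r) * ennreal (2 * pi * norm (h (of_real (r\<^sup>2))))"
    using r by (intro ennreal_mult') simp
  also have "\<dots> \<le> ennreal (1 - r) * (ennreal (1 / (1 - r)) * (\<integral>\<^sup>+t\<in>{0..2*pi}. ennreal (norm (h (of_real r * cis t))) \<partial>lborel))"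
    by (intro mult_left_mono main) simp
  also have "\<dots> = (\<integral>\<^sup>+t\<in>{0..2*pi}. ennreal (norm (h (of_real r * cis t))) \<partial>lborel)"
    using r by (subst mult.assoc[symmetric], subst ennreal_mult'[symmetric]) auto
  finally show ?thesis .
qed

text \<open>
Integrating the preceding inequality for \<open>g''\<close> in polar coordinates bounds the integral of
\<open>(1 - u) |g''(u)|\<close> over the radius. Taylor's formula with integral remainder then bounds \<open>g\<close>; it is
used in the variable \<open>r = \<surd>u\<close> to match the polar form.
\<close>

lemma B1_bounded_on_radius:
  assumes g: "g \<in> B1_space"
  shows "\<exists>M\<ge>0. \<forall>x. 0 \<le> x \<and> x < 1 \<longrightarrow> norm (g (of_real x)) \<le> M"
proof -
  have hol: "g holomorphic_on ball 0 1" using g by (auto simp: B1_space_def hol_disk_def)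
  have hol1: "deriv g holomorphic_on ball 0 1" by (intro holomorphic_deriv hol) auto
  have hol2: "deriv (deriv g) holomorphic_on ball 0 1" by (intro holomorphic_deriv hol1) auto
  have dg: "(g has_field_derivative deriv g w) (at w)" if "norm w < 1" for w
    using that by (intro holomorphic_derivI[OF hol]) auto
  have ddg: "(deriv g has_field_derivative deriv (deriv g) w) (at w)" if "norm w < 1" for w
    using that by (intro holomorphic_derivI[OF hol1]) auto
  let ?h = "deriv (deriv g)"
  let ?F = "\<lambda>z. indicator (ball 0 1) z *\<^sub>R norm (?h z)"
  have "integrable lborel ?F" using g by (simp add: B1_space_def set_integrable_def)
  then have Fm: "?F \<in> borel_measurable borel" and fin: "(\<integral>\<^sup>+z. ennreal (norm (?F z)) \<partial>lborel) < \<infinity>"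
    by (auto simp: integrable_iff_bounded)
  have Fm'[measurable]: "(\<lambda>z. ennreal (?F z)) \<in> borel_measurable borel" using Fm by measurable
  define V where "V = enn2real (\<integral>\<^sup>+z. ennreal (norm (?F z)) \<partial>lborel)"
  have V0: "V \<ge> 0" by (simp add: V_def)
  have bound: "(\<integral>\<^sup>+r\<in>{0..<1}. ennreal r * ennreal (pi * ((1 - r\<^sup>2) * norm (?h (of_real (r\<^sup>2))))) \<partial>lborel) \<le> ennreal V"
  proof -
    have "ennreal V = (\<integral>\<^sup>+z. ennreal (norm (?F z)) \<partial>lborel)" using fin by (simp add: V_def)
    also have "\<dots> = (\<integral>\<^sup>+z\<in>ball 0 1. ennreal (?F z) \<partial>lborel)"
      by (intro nn_integral_cong) (auto simp: indicator_def)
    also have "\<dots> = (\<integral>\<^sup>+r\<in>{0..<1}. ennreal r * (\<integral>\<^sup>+t\<in>{0..2*pi}. ennreal (?F (of_real r * cis t)) \<partial>lborel) \<partial>lborel)"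
      by (rule nn_integral_polar) (rule Fm')
    also have "\<dots> \<ge> (\<integral>\<^sup>+r\<in>{0..<1}. ennreal r * ennreal (pi * ((1 - r\<^sup>2) * norm (?h (of_real (r\<^sup>2))))) \<partial>lborel)"
    proof (rule nn_integral_mono)
      fix r :: real
      show "ennreal r * ennreal (pi * ((1 - r\<^sup>2) * norm (?h (of_real (r\<^sup>2))))) * indicator {0..<1} r
        \<le> ennreal r * (\<integral>\<^sup>+t\<in>{0..2*pi}. ennreal (?F (of_real r * cis t)) \<partial>lborel) * indicator {0..<1} r"
      proof (cases "r \<in> {0..<1}")
        case True
        then have F: "?F (of_real r * cis t) = norm (?h (of_real r * cis t))" for t by (simp add: norm_mult)
        have r: "0 \<le> r" "r < 1" using True by auto
        show ?thesis
          unfolding F by (intro mult_right_mono mult_left_mono diagonal_value_le_circle_integral[OF hol2 r]) auto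
      qed simp
    qed
    finally show ?thesis .
  qed
  have main: "norm (g (of_real (y\<^sup>2))) \<le> norm (g 0) + norm (deriv g 0) + V" if y: "0 \<le> y" "y < 1" for y
  proof -
    \<comment> \<open>\<open>\<psi>\<close> is Taylor's polynomial for \<open>g(y\<^sup>2)\<close> at the moving centre \<open>r\<^sup>2\<close>; in its derivative the terms
        with \<open>g'\<close> cancel.\<close>
    let ?\<psi> = "\<lambda>r. of_real (y\<^sup>2 - r\<^sup>2) * deriv g (of_real (r\<^sup>2)) + g (of_real (r\<^sup>2))"
    let ?d = "\<lambda>r. of_real (2 * r * (y\<^sup>2 - r\<^sup>2)) * ?h (of_real (r\<^sup>2))"
    have r1: "norm (of_real (r\<^sup>2) :: complex) < 1" if "0 \<le> r" "r \<le> y" for r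
    proof -
      have "r\<^sup>2 < 1" using that y power_strict_mono[of r 1 2] by auto
      then show ?thesis by (simp only: norm_of_real) simp
    qed
    have der: "(?\<psi> has_vector_derivative ?d r) (at r within {0..y})" if r: "0 \<le> r" "r \<le> y" for r
    proof -
      have q: "((\<lambda>r. of_real (r\<^sup>2) :: complex) has_vector_derivative of_real (2 * r)) (at r)"
        by (rule has_vector_derivative_of_real) (auto intro!: derivative_eq_intros)
      have p: "((\<lambda>r. of_real (y\<^sup>2 - r\<^sup>2) :: complex) has_vector_derivative of_real (- 2 * r)) (at r)"
        by (rule has_vector_derivative_of_real) (auto intro!: derivative_eq_intros)
      have a: "((\<lambda>r. deriv g (of_real (r\<^sup>2))) has_vector_derivative of_real (2 * r) * ?h (of_real (r\<^sup>2))) (at r)"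
        using field_vector_diff_chain_at[OF q ddg[OF r1[OF r]]] by (simp add: o_def)
      have b: "((\<lambda>r. g (of_real (r\<^sup>2))) has_vector_derivative of_real (2 * r) * deriv g (of_real (r\<^sup>2))) (at r)"
        using field_vector_diff_chain_at[OF q dg[OF r1[OF r]]] by (simp add: o_def)
      have "(?\<psi> has_vector_derivative ?d r) (at r)"
        using has_vector_derivative_add[OF has_vector_derivative_mult[OF p a] b]
        by (simp add: algebra_simps)
      then show ?thesis by (rule has_vector_derivative_at_within)
    qed
    have cont: "continuous_on {0..y} ?d"
    proof -
      have "continuous_on {0..y} (\<lambda>r. ?h (of_real (r\<^sup>2)))"
        by (rule continuous_on_compose2[OF holomorphic_on_imp_continuous_on[OF hol2]])
           (use r1 in \<open>auto intro!: continuous_intros\<close>)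
      then show ?thesis by (intro continuous_intros)
    qed
    have int: "integrable lborel (\<lambda>r. indicator {0..y} r *\<^sub>R ?d r)"
      using borel_integrable_atLeastAtMost'[OF cont] by (simp add: set_integrable_def)
    have "integral\<^sup>L lborel (\<lambda>r. indicator {0..y} r *\<^sub>R ?d r) = ?\<psi> y - ?\<psi> 0"
      by (rule integral_FTC_atLeastAtMost[OF y(1) der cont])
    then have eq: "g (of_real (y\<^sup>2)) = of_real (y\<^sup>2) * deriv g 0 + g 0 + integral\<^sup>L lborel (\<lambda>r. indicator {0..y} r *\<^sub>R ?d r)"
      by simp
    have tri: "norm (g (of_real (y\<^sup>2))) \<le> norm (of_real (y\<^sup>2) * deriv g 0) + norm (g 0) + norm (integral\<^sup>L lborel (\<lambda>r. indicator {0..y} r *\<^sub>R ?d r))"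
      unfolding eq by (rule order_trans[OF norm_triangle_ineq add_right_mono[OF norm_triangle_ineq]])
    have b1: "norm (of_real (y\<^sup>2) * deriv g 0) \<le> 1 * norm (deriv g 0)"
      unfolding norm_mult norm_of_real using y by (intro mult_right_mono) (simp_all add: power_le_one)
    have b2: "norm (integral\<^sup>L lborel (\<lambda>r. indicator {0..y} r *\<^sub>R ?d r)) \<le> V"
    proof -
      have "ennreal (norm (integral\<^sup>L lborel (\<lambda>r. indicator {0..y} r *\<^sub>R ?d r))) \<le> (\<integral>\<^sup>+r. norm (indicator {0..y} r *\<^sub>R ?d r) \<partial>lborel)"
        by (rule integral_norm_bound_ennreal[OF int])
      also have "\<dots> \<le> (\<integral>\<^sup>+r\<in>{0..<1}. ennreal r * ennreal (pi * ((1 - r\<^sup>2) * norm (?h (of_real (r\<^sup>2))))) \<partial>lborel)"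
      proof (rule nn_integral_mono)
        fix r :: real
        show "ennreal (norm (indicator {0..y} r *\<^sub>R ?d r)) \<le> ennreal r * ennreal (pi * ((1 - r\<^sup>2) * norm (?h (of_real (r\<^sup>2))))) * indicator {0..<1} r"
        proof (cases "r \<in> {0..y}")
          case True
          have yr: "y\<^sup>2 - r\<^sup>2 \<ge> 0" "y\<^sup>2 \<le> 1" using True y by (auto intro: power_mono power_le_one)
          then have yr3: "r\<^sup>2 \<le> 1" by linarith
          have "norm (?d r) = r * (2 * ((y\<^sup>2 - r\<^sup>2) * norm (?h (of_real (r\<^sup>2)))))"
            unfolding norm_mult norm_of_real using True yr by (simp add: abs_mult)
          also have "\<dots> \<le> r * (pi * ((1 - r\<^sup>2) * norm (?h (of_real (r\<^sup>2)))))"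
            using True yr yr3 pi_ge_two by (intro mult_left_mono mult_mono) auto
          finally show ?thesis using True y by (simp add: ennreal_leI flip: ennreal_mult')
        qed simp
      qed
      also have "\<dots> \<le> ennreal V" by (rule bound)
      finally show ?thesis using V0 by simp
    qed
    show ?thesis using tri b1 b2 by linarith
  qed
  show ?thesis
  proof (intro exI[of _ "norm (g 0) + norm (deriv g 0) + V"] conjI allI impI)
    fix x :: real assume "0 \<le> x \<and> x < 1"
    then show "norm (g (of_real x)) \<le> norm (g 0) + norm (deriv g 0) + V"
      using main[of "sqrt x"] by (simp flip: of_real_power)
  qed (use V0 in simp)
qed

text \<open>
On the radius the image of the logarithm is an average of positive dilates of the integrand of
the claim. It is bounded there, and Fatou's lemma along \<open>x = n/(n+1)\<close> removes the dilation.
\<close>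

lemma log_integral_finite_if_cesaro_log_in_B1:
  assumes \<mu>: "finite_measure \<mu>" "sets \<mu> = sets (restrict_space borel {0..<1::real})"
    and \<alpha>: "1 \<le> \<alpha>" and C: "cesaro_like \<mu> \<alpha> log_fun \<in> B1_space"
  shows "(\<integral>\<^sup>+ t. ennreal (ln (exp 1 / (1 - t)) / (1 - t) powr \<alpha>) \<partial>\<mu>) < \<infinity>"
proof -
  note sp = unit_interval_measure(1)[OF assms(1,2)]
  note meas = unit_interval_measure(2)[OF assms(1,2)]
  have hol: "log_fun holomorphic_on ball 0 1" using log_fun_hol by (simp add: hol_disk_def)
  have \<alpha>0: "\<alpha> > 0" using \<alpha> by simp
  let ?G = "\<lambda>t. ln (exp 1 / (1 - t)) / (1 - t) powr \<alpha>"
  obtain M where M: "M \<ge> 0" "\<And>x. 0 \<le> x \<Longrightarrow> x < 1 \<Longrightarrow> norm (cesaro_like \<mu> \<alpha> log_fun (of_real x)) \<le> M"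
    using B1_bounded_on_radius[OF C] by auto
  have bound: "(\<integral>\<^sup>+ t. ennreal (?G (x * t)) \<partial>\<mu>) \<le> ennreal M" if x: "0 \<le> x" "x < 1" for x
  proof -
    have nx: "norm (of_real x :: complex) < 1" using x by simp
    have tx: "0 \<le> x * t" "x * t < 1" if "t \<in> space \<mu>" for t
      using that x sp mult_strict_mono'[of x 1 t 1] by auto
    have W: "weighted \<alpha> log_fun (of_real t * of_real x) = of_real (?G (x * t))" if t: "t \<in> space \<mu>" for t
    proof -
      have n: "norm (of_real (x * t) :: complex) < 1" using tx[OF t] by (simp only: norm_of_real abs_of_nonneg)
      have "log_fun (of_real (x * t)) = 1 - Ln (of_real (1 - x * t))" unfolding log_fun_def using n by simp
      also have "Ln (of_real (1 - x * t)) = of_real (ln (1 - x * t))"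
        using tx[OF t] by (intro Ln_of_real) simp
      also have "1 - complex_of_real (ln (1 - x * t)) = of_real (ln (exp 1 / (1 - x * t)))"
        using tx[OF t] by (simp add: ln_div)
      finally have 1: "log_fun (of_real (x * t)) = of_real (ln (exp 1 / (1 - x * t)))" .
      have 2: "(1 - of_real (x * t)) powr (- of_real \<alpha>) = complex_of_real ((1 - x * t) powr (- \<alpha>))"
        using powr_of_real[of "1 - x * t" "- \<alpha>"] tx[OF t] by simp
      have "weighted \<alpha> log_fun (of_real (x * t)) = of_real (ln (exp 1 / (1 - x * t)) * (1 - x * t) powr (- \<alpha>))"
        unfolding weighted_def 1 2 by simp
      then show ?thesis by (simp add: powr_minus_divide mult.commute)
    qed
    have int: "integrable \<mu> (\<lambda>t. complex_of_real (?G (x * t)))"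
      using cesaro_like_integrable[OF \<mu> hol \<alpha>0 nx] W by (simp cong: Bochner_Integration.integrable_cong)
    then have int': "integrable \<mu> (\<lambda>t. ?G (x * t))" using integrable_Re[OF int] by simp
    have G0: "0 \<le> ?G (x * t)" if t: "t \<in> space \<mu>" for t
      using ln_ge_one[OF tx[OF t]] by (intro divide_nonneg_nonneg) auto
    have "cesaro_like \<mu> \<alpha> log_fun (of_real x) = of_real (LINT t|\<mu>. ?G (x * t))"
      using cesaro_like_integral[OF \<mu> hol \<alpha>0 nx] W
      by (simp add: integral_complex_of_real[symmetric] del: integral_complex_of_real cong: Bochner_Integration.integral_cong)
    then have "\<bar>LINT t|\<mu>. ?G (x * t)\<bar> \<le> M" using M(2)[OF x] by simp
    moreover have "(\<integral>\<^sup>+ t. ennreal (?G (x * t)) \<partial>\<mu>) = ennreal (LINT t|\<mu>. ?G (x * t))"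
      using G0 by (intro nn_integral_eq_integral int' AE_I2) auto
    ultimately show ?thesis by (simp add: ennreal_leI)
  qed
  define x :: "nat \<Rightarrow> real" where "x n = real n / real (Suc n)" for n
  have x: "0 \<le> x n" "x n < 1" for n by (auto simp: x_def)
  have xl: "x \<longlonglongrightarrow> 1" unfolding x_def by (rule LIMSEQ_n_over_Suc_n)
  have lim: "(\<lambda>n. ennreal (?G (x n * t))) \<longlonglongrightarrow> ennreal (?G t)" if "t \<in> space \<mu>" for t
  proof -
    have t: "0 \<le> t" "t < 1" using that sp by auto
    have "(\<lambda>n. ?G (u n)) \<longlonglongrightarrow> ?G t" if "u \<longlonglongrightarrow> t" for u
      using t that by (intro tendsto_intros) auto
    moreover have "(\<lambda>n. x n * t) \<longlonglongrightarrow> 1 * t" by (intro tendsto_intros xl)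
    ultimately have "(\<lambda>n. ?G (x n * t)) \<longlonglongrightarrow> ?G t" by simp
    then show ?thesis by (intro tendsto_ennrealI) simp
  qed
  have "(\<integral>\<^sup>+ t. ennreal (?G t) \<partial>\<mu>) = (\<integral>\<^sup>+ t. liminf (\<lambda>n. ennreal (?G (x n * t))) \<partial>\<mu>)"
    using lim by (intro nn_integral_cong lim_imp_Liminf[symmetric]) auto
  also have "\<dots> \<le> liminf (\<lambda>n. \<integral>\<^sup>+ t. ennreal (?G (x n * t)) \<partial>\<mu>)"
    by (rule nn_integral_liminf) (rule meas, measurable)
  also have "\<dots> \<le> liminf (\<lambda>n. ennreal M)"
    by (intro Liminf_mono always_eventually allI bound x)
  also have "\<dots> = ennreal M" by (simp add: Liminf_const)
  also have "\<dots> < \<infinity>" by simp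
  finally show ?thesis .
qed

section \<open>Moments and the logarithmic integral\<close>

text \<open>
The coefficient of \<open>t\<^sup>n\<close> in \<open>(1 - t)\<^bsup>-\<beta>\<^esup>\<close>.
\<close>

definition bincoeff :: "real \<Rightarrow> nat \<Rightarrow> real" where
  "bincoeff \<beta> n = Gamma (real n + \<beta>) / (Gamma \<beta> * fact n)"

lemma bincoeff_sums:
  assumes "0 \<le> t" "t < 1" "\<beta> > 0"
  shows "(\<lambda>n. bincoeff \<beta> n * t ^ n) sums (1 - t) powr (- \<beta>)"
proof -
  have "(\<lambda>n. of_real (bincoeff \<beta> n) * complex_of_real t ^ n) sums (1 - of_real t) powr (- of_real \<beta>)"
    unfolding bincoeff_def by (rule one_minus_powr_sums) (use assms in auto)
  also have "(1 - of_real t) powr (- of_real \<beta>) = complex_of_real ((1 - t) powr (- \<beta>))"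
    using powr_of_real[of "1 - t" "- \<beta>"] assms by simp
  finally have "(\<lambda>n. complex_of_real (bincoeff \<beta> n * t ^ n)) sums complex_of_real ((1 - t) powr (- \<beta>))"
    by simp
  then show ?thesis by (simp only: sums_of_real_iff)
qed

lemma bincoeff_pos: "\<beta> > 0 \<Longrightarrow> bincoeff \<beta> n > 0"
  by (simp add: bincoeff_def Gamma_real_pos)

text \<open>
This is the Euler limit formula for \<open>\<Gamma>(\<beta>)\<close>.
\<close>

lemma bincoeff_asymp:
  assumes \<beta>: "\<beta> > 0"
  shows "(\<lambda>n. bincoeff \<beta> n / real (n + 1) powr (\<beta> - 1)) \<longlonglongrightarrow> 1 / Gamma \<beta>"
proof -
  have nn: "\<beta> \<notin> \<int>\<^sub>\<le>\<^sub>0" using \<beta> by (auto elim!: nonpos_Ints_cases)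
  have "Gamma_series' \<beta> \<longlonglongrightarrow> Gamma \<beta>" by (rule Gamma_series'_LIMSEQ)
  moreover have "(\<lambda>n. real n / real (n + 1)) \<longlonglongrightarrow> 1" using LIMSEQ_n_over_Suc_n by simp
  then have "(\<lambda>n. (real n / real (n + 1)) powr (\<beta> - 1)) \<longlonglongrightarrow> 1 powr (\<beta> - 1)"
    by (intro tendsto_powr tendsto_const) auto
  ultimately have "(\<lambda>n. (real n / real (n + 1)) powr (\<beta> - 1) / Gamma_series' \<beta> n) \<longlonglongrightarrow> 1 powr (\<beta> - 1) / Gamma \<beta>"
    using Gamma_real_pos[OF \<beta>] by (intro tendsto_divide) auto
  moreover have "\<forall>\<^sub>F n in sequentially. (real n / real (n + 1)) powr (\<beta> - 1) / Gamma_series' \<beta> n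
      = bincoeff \<beta> n / real (n + 1) powr (\<beta> - 1)"
    using eventually_gt_at_top[of 0]
  proof eventually_elim
    fix n :: nat assume n: "n > 0"
    have p: "pochhammer \<beta> n = Gamma (\<beta> + real n) / Gamma \<beta>" using pochhammer_Gamma[OF nn] by simp
    have f: "fact n = real n * fact (n - 1)" using n by (simp add: fact_reduce)
    have e: "exp (\<beta> * ln (real n)) = real n powr (\<beta> - 1) * real n"
      using n powr_add[of "real n" "\<beta> - 1" 1] by (simp add: powr_def)
    show "(real n / real (n + 1)) powr (\<beta> - 1) / Gamma_series' \<beta> n = bincoeff \<beta> n / real (n + 1) powr (\<beta> - 1)"
      using n unfolding Gamma_series'_def bincoeff_def p f by (simp add: e powr_divide add.commute)
  qed
  ultimately show ?thesis by (auto dest: Lim_transform_eventually)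
qed

lemma bincoeff_bounds:
  assumes \<beta>: "\<beta> > 0"
  shows "\<exists>c>0. \<exists>C>0. \<forall>n. c * bincoeff \<beta> n \<le> real (n + 1) powr (\<beta> - 1)
    \<and> real (n + 1) powr (\<beta> - 1) \<le> C * bincoeff \<beta> n"
proof -
  let ?q = "\<lambda>n. bincoeff \<beta> n / real (n + 1) powr (\<beta> - 1)"
  have q: "?q n > 0" for n using bincoeff_pos[OF \<beta>, of n] by simp
  have G: "Gamma \<beta> > 0" using \<beta> by (rule Gamma_real_pos)
  have "Bseq ?q" using bincoeff_asymp[OF \<beta>] by (intro convergent_imp_Bseq convergentI)
  then obtain K where K: "K > 0" "\<And>n. norm (?q n) \<le> K" by (auto simp: Bseq_def)
  have "(\<lambda>n. inverse (?q n)) \<longlonglongrightarrow> inverse (1 / Gamma \<beta>)"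
    using bincoeff_asymp[OF \<beta>] G by (intro tendsto_inverse) auto
  then have "Bseq (\<lambda>n. inverse (?q n))" by (intro convergent_imp_Bseq convergentI)
  then obtain L where L: "L > 0" "\<And>n. norm (inverse (?q n)) \<le> L" by (auto simp: Bseq_def)
  show ?thesis
  proof (rule exI[of _ "1 / K"], rule conjI, use K in simp, rule exI[of _ L], intro conjI allI)
    fix n
    have "?q n \<le> K" using K(2)[of n] q[of n] by (simp only: real_norm_def abs_of_pos)
    then show "1 / K * bincoeff \<beta> n \<le> real (n + 1) powr (\<beta> - 1)" using K(1) by (simp add: field_simps)
    have "inverse (?q n) \<le> L" using L(2)[of n] q[of n]
      by (simp only: real_norm_def abs_of_pos positive_imp_inverse_positive)
    then show "real (n + 1) powr (\<beta> - 1) \<le> L * bincoeff \<beta> n"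
      using q[of n] bincoeff_pos[OF \<beta>, of n] by (simp add: field_simps)
  qed (use K L in auto)
qed

text \<open>
The weights \<open>(n+1)\<^bsup>\<beta>-1\<^esup>\<close> are comparable with the binomial coefficients of
\<open>(1 - t)\<^bsup>-\<beta>\<^esup>\<close>.
\<close>

lemma power_weight_series:
  assumes \<beta>: "\<beta> > 0"
  shows "\<exists>c>0. \<exists>C>0. \<forall>t. 0 \<le> t \<and> t < 1 \<longrightarrow> summable (\<lambda>n. real (n + 1) powr (\<beta> - 1) * t ^ n)
    \<and> c * (1 - t) powr (- \<beta>) \<le> (\<Sum>n. real (n + 1) powr (\<beta> - 1) * t ^ n)
    \<and> (\<Sum>n. real (n + 1) powr (\<beta> - 1) * t ^ n) \<le> C * (1 - t) powr (- \<beta>)"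
proof -
  from bincoeff_bounds[OF \<beta>] obtain c C where cC: "0 < c" "0 < C"
    "\<forall>n. c * bincoeff \<beta> n \<le> real (n + 1) powr (\<beta> - 1) \<and> real (n + 1) powr (\<beta> - 1) \<le> C * bincoeff \<beta> n"
    by (elim exE conjE)
  note c = cC(1) cC(3)[THEN spec, THEN conjunct1] cC(3)[THEN spec, THEN conjunct2] cC(2)
  have sm: "summable (\<lambda>n. real (n + 1) powr (\<beta> - 1) * t ^ n)" if "0 \<le> t" "t < 1" for t
  proof (rule summable_comparison_test')
    show "summable (\<lambda>n. C * (bincoeff \<beta> n * t ^ n))"
      using sums_summable[OF bincoeff_sums[OF that \<beta>]] by (rule summable_mult)
    show "norm (real (n + 1) powr (\<beta> - 1) * t ^ n) \<le> C * (bincoeff \<beta> n * t ^ n)" for n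
      using mult_right_mono[OF c(3)[of n], of "t ^ n"] that by (simp add: abs_mult mult.assoc)
  qed
  show ?thesis
  proof (rule exI[of _ c], rule conjI, rule c(1), rule exI[of _ C], rule conjI, rule c(4), intro conjI allI impI)
    fix t :: real assume "0 \<le> t \<and> t < 1"
    then have t: "0 \<le> t" "t < 1" by auto
    show "summable (\<lambda>n. real (n + 1) powr (\<beta> - 1) * t ^ n)" by (rule sm[OF t])
    have 1: "(\<Sum>n. a * (bincoeff \<beta> n * t ^ n)) = a * (1 - t) powr (- \<beta>)" for a
      using sums_mult[OF bincoeff_sums[OF t \<beta>], of a] by (simp add: sums_iff)
    have 2: "summable (\<lambda>n. a * (bincoeff \<beta> n * t ^ n))" for a
      using sums_summable[OF bincoeff_sums[OF t \<beta>]] by (rule summable_mult)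
    have "(\<Sum>n. c * (bincoeff \<beta> n * t ^ n)) \<le> (\<Sum>n. real (n + 1) powr (\<beta> - 1) * t ^ n)"
      using mult_right_mono[OF c(2), of "t ^ _"] t
      by (intro suminf_le[OF _ 2 sm[OF t]]) (auto simp: mult.assoc)
    then show "c * (1 - t) powr (- \<beta>) \<le> (\<Sum>n. real (n + 1) powr (\<beta> - 1) * t ^ n)" unfolding 1 .
    have "(\<Sum>n. real (n + 1) powr (\<beta> - 1) * t ^ n) \<le> (\<Sum>n. C * (bincoeff \<beta> n * t ^ n))"
      using mult_right_mono[OF c(3), of "t ^ _"] t
      by (intro suminf_le[OF _ sm[OF t] 2]) (auto simp: mult.assoc)
    then show "(\<Sum>n. real (n + 1) powr (\<beta> - 1) * t ^ n) \<le> C * (1 - t) powr (- \<beta>)" unfolding 1 .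
  qed
qed

text \<open>
Both bounds come from the tangent inequality \<open>ln y \<le> y - 1\<close>. With \<open>y = (1-t)(n+2)\<close> it gives
\<open>ln(n+2) \<le> L + 2(1-t)(n+1)\<close> for \<open>L = ln(e/(1-t))\<close>. With \<open>y = ((1-t)(n+1))\<^bsup>-1/2\<^esup>\<close> it gives
\<open>L \<le> ln(n+2) + 2y\<close>; the square root keeps the exponent \<open>\<alpha> - 1/2\<close> of the error series positive even
for \<open>\<alpha> = 1\<close>. In both cases the error series sums to at most a constant times \<open>(1-t)\<^bsup>-\<alpha>\<^esup>\<close>, which is
absorbed by the main term.
\<close>

lemma log_weight_series:
  assumes \<alpha>: "1 \<le> \<alpha>"
  shows "\<exists>c>0. \<exists>C>0. \<forall>t. 0 \<le> t \<and> t < 1 \<longrightarrow> summable (\<lambda>n. real (n + 1) powr (\<alpha> - 1) * ln (real (n + 2)) * t ^ n)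
    \<and> c * (ln (exp 1 / (1 - t)) / (1 - t) powr \<alpha>) \<le> (\<Sum>n. real (n + 1) powr (\<alpha> - 1) * ln (real (n + 2)) * t ^ n)
    \<and> (\<Sum>n. real (n + 1) powr (\<alpha> - 1) * ln (real (n + 2)) * t ^ n) \<le> C * (ln (exp 1 / (1 - t)) / (1 - t) powr \<alpha>)"
proof -
  let ?S = "\<lambda>\<beta> t. \<Sum>n. real (n + 1) powr (\<beta> - 1) * t ^ n"
  let ?u = "\<lambda>t n. real (n + 1) powr (\<alpha> - 1) * ln (real (n + 2)) * t ^ n"
  let ?L = "\<lambda>t. ln (exp 1 / (1 - t :: real))"
  have pos: "\<alpha> > 0" "\<alpha> + 1 > 0" "\<alpha> - 1/2 > 0" using \<alpha> by auto
  from power_weight_series[OF pos(1)] obtain c1 C1 where e1: "0 < c1" "0 < C1"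
    "\<forall>t. 0 \<le> t \<and> t < 1 \<longrightarrow> summable (\<lambda>n. real (n + 1) powr (\<alpha> - 1) * t ^ n)
    \<and> c1 * (1 - t) powr (- \<alpha>) \<le> ?S \<alpha> t \<and> ?S \<alpha> t \<le> C1 * (1 - t) powr (- \<alpha>)"
    by (elim exE conjE)
  have f1: "0 \<le> t \<and> t < 1" if "0 \<le> t" "t < 1" for t :: real using that ..
  note 1 = e1(1,2) e1(3)[THEN spec, THEN mp, OF f1, THEN conjunct1]
    e1(3)[THEN spec, THEN mp, OF f1, THEN conjunct2, THEN conjunct1]
    e1(3)[THEN spec, THEN mp, OF f1, THEN conjunct2, THEN conjunct2]
  from power_weight_series[OF pos(2)] obtain c2 C2 where e2: "0 < c2" "0 < C2"
    "\<forall>t. 0 \<le> t \<and> t < 1 \<longrightarrow> summable (\<lambda>n. real (n + 1) powr (\<alpha> + 1 - 1) * t ^ n)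
    \<and> c2 * (1 - t) powr (- (\<alpha> + 1)) \<le> ?S (\<alpha> + 1) t \<and> ?S (\<alpha> + 1) t \<le> C2 * (1 - t) powr (- (\<alpha> + 1))"
    by (elim exE conjE)
  have f2: "0 \<le> t \<and> t < 1" if "0 \<le> t" "t < 1" for t :: real using that ..
  note 2 = e2(1,2) e2(3)[THEN spec, THEN mp, OF f2, THEN conjunct1]
    e2(3)[THEN spec, THEN mp, OF f2, THEN conjunct2, THEN conjunct1]
    e2(3)[THEN spec, THEN mp, OF f2, THEN conjunct2, THEN conjunct2]
  from power_weight_series[OF pos(3)] obtain c3 C3 where e3: "0 < c3" "0 < C3"
    "\<forall>t. 0 \<le> t \<and> t < 1 \<longrightarrow> summable (\<lambda>n. real (n + 1) powr (\<alpha> - 1/2 - 1) * t ^ n)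
    \<and> c3 * (1 - t) powr (- (\<alpha> - 1/2)) \<le> ?S (\<alpha> - 1/2) t \<and> ?S (\<alpha> - 1/2) t \<le> C3 * (1 - t) powr (- (\<alpha> - 1/2))"
    by (elim exE conjE)
  have f3: "0 \<le> t \<and> t < 1" if "0 \<le> t" "t < 1" for t :: real using that ..
  note 3 = e3(1,2) e3(3)[THEN spec, THEN mp, OF f3, THEN conjunct1]
    e3(3)[THEN spec, THEN mp, OF f3, THEN conjunct2, THEN conjunct1]
    e3(3)[THEN spec, THEN mp, OF f3, THEN conjunct2, THEN conjunct2]
  have Lge: "1 \<le> ?L t" if "0 \<le> t" "t < 1" for t using that by (simp add: ln_div)
  have up: "?u t n \<le> ?L t * (real (n + 1) powr (\<alpha> - 1) * t ^ n)
      + 2 * (1 - t) * (real (n + 1) powr ((\<alpha> + 1) - 1) * t ^ n)" if t: "0 \<le> t" "t < 1" for t n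
  proof -
    have "ln ((1 - t) * real (n + 2)) \<le> (1 - t) * real (n + 2) - 1"
      using t by (intro ln_le_minus_one) auto
    then have "ln (real (n + 2)) \<le> ?L t + (1 - t) * real (n + 2)"
      using t by (simp add: ln_mult ln_div)
    also have "(1 - t) * real (n + 2) \<le> (1 - t) * (2 * real (n + 1))"
      using t by (intro mult_left_mono) auto
    finally have "ln (real (n + 2)) \<le> ?L t + (1 - t) * (2 * real (n + 1))" by simp
    then have "real (n + 1) powr (\<alpha> - 1) * t ^ n * ln (real (n + 2))
       \<le> real (n + 1) powr (\<alpha> - 1) * t ^ n * (?L t + (1 - t) * (2 * real (n + 1)))"
      using t by (intro mult_left_mono) auto
    moreover have "real (n + 1) powr ((\<alpha> + 1) - 1) = real (n + 1) powr (\<alpha> - 1) * real (n + 1)"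
      using powr_add[of "real (n + 1)" "\<alpha> - 1" 1] by simp
    ultimately show ?thesis by (simp only:) (simp add: algebra_simps)
  qed
  have low: "?L t * (real (n + 1) powr (\<alpha> - 1) * t ^ n) \<le> ?u t n
      + 2 * (1 - t) powr (- 1/2) * (real (n + 1) powr ((\<alpha> - 1/2) - 1) * t ^ n)" if t: "0 \<le> t" "t < 1" for t n
  proof -
    let ?x = "(1 - t) powr (- 1/2) * real (n + 1) powr (- 1/2)"
    have "ln ?x \<le> ?x - 1" using t by (intro ln_le_minus_one) auto
    then have "- ln (1 - t) \<le> ln (real (n + 1)) + 2 * ?x - 2"
      using t by (simp add: ln_mult ln_powr)
    moreover have "ln (real (n + 1)) \<le> ln (real (n + 2))" by simp
    moreover have "?L t = 1 - ln (1 - t)" using t by (simp add: ln_div)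
    ultimately have "?L t \<le> ln (real (n + 2)) + 2 * ?x" by linarith
    then have "real (n + 1) powr (\<alpha> - 1) * t ^ n * ?L t
       \<le> real (n + 1) powr (\<alpha> - 1) * t ^ n * (ln (real (n + 2)) + 2 * ?x)"
      using t by (intro mult_left_mono) auto
    moreover have "real (n + 1) powr ((\<alpha> - 1/2) - 1) = real (n + 1) powr (\<alpha> - 1) * real (n + 1) powr (- 1/2)"
      using powr_add[of "real (n + 1)" "\<alpha> - 1" "-1/2"] by simp
    ultimately show ?thesis by (simp only:) (simp add: algebra_simps)
  qed
  have u0: "0 \<le> ?u t n" if "0 \<le> t" for t n using that by simp
  have sm: "summable (?u t)" if t: "0 \<le> t" "t < 1" for t
  proof (rule summable_comparison_test'[OF summable_add[OF summable_mult[OF 1(3)[OF t], of "?L t"]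
      summable_mult[OF 2(3)[OF t], of "2 * (1 - t)"]]])
    show "norm (?u t n) \<le> ?L t * (real (n + 1) powr (\<alpha> - 1) * t ^ n)
      + 2 * (1 - t) * (real (n + 1) powr ((\<alpha> + 1) - 1) * t ^ n)" for n
      using up[OF t, of n] u0[OF t(1), of n] by simp
  qed
  \<comment> \<open>The error term \<open>2 C3 (1-t)\<^bsup>-\<alpha>\<^esup>\<close> of the lower bound is itself at most \<open>2 C3 / (c1 ln 2)\<close> times the
      series, since every logarithm in it is at least \<open>ln 2\<close>.\<close>
  define c where "c = c1 / (1 + 2 * C3 / (c1 * ln 2))"
  have cpos: "0 < c" using 1 3 by (auto simp: c_def intro!: divide_pos_pos add_pos_nonneg)
  show ?thesis
  proof (rule exI[of _ c], rule conjI, rule cpos, rule exI[of _ "C1 + 2 * C2"], intro conjI allI impI)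
    show "0 < C1 + 2 * C2" using 1 2 by simp
    fix t :: real assume "0 \<le> t \<and> t < 1"
    then have t: "0 \<le> t" "t < 1" by auto
    show "summable (?u t)" by (rule sm[OF t])
    let ?p = "(1 - t) powr (- \<alpha>)"
    have p: "?p > 0" "?L t / (1 - t) powr \<alpha> = ?L t * ?p" using t by (auto simp: powr_minus_divide)
    have L0: "0 \<le> ?L t" using Lge[OF t] by linarith
    have p2: "(1 - t) * (1 - t) powr (- (\<alpha> + 1)) = ?p"
      using powr_add[of "1 - t" 1 "- (\<alpha> + 1)"] t by simp
    have p3: "(1 - t) powr (- 1/2) * (1 - t) powr (- (\<alpha> - 1/2)) = ?p"
      using powr_add[of "1 - t" "-1/2" "- (\<alpha> - 1/2)"] t by simp
    have "suminf (?u t) \<le> (\<Sum>n. ?L t * (real (n + 1) powr (\<alpha> - 1) * t ^ n)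
      + 2 * (1 - t) * (real (n + 1) powr ((\<alpha> + 1) - 1) * t ^ n))"
      by (intro suminf_le up t sm summable_add summable_mult 1 2)
    also have "\<dots> = ?L t * ?S \<alpha> t + 2 * (1 - t) * ?S (\<alpha> + 1) t"
      by (simp only: suminf_add[OF summable_mult[OF 1(3)[OF t]] summable_mult[OF 2(3)[OF t]], symmetric]
          suminf_mult[OF 1(3)[OF t]] suminf_mult[OF 2(3)[OF t]])
    also have "\<dots> \<le> ?L t * (C1 * ?p) + 2 * (1 - t) * (C2 * (1 - t) powr (- (\<alpha> + 1)))"
      by (intro add_mono mult_left_mono 1(5)[OF t] 2(5)[OF t] L0) (use t in simp)
    also have "\<dots> = ?L t * (C1 * ?p) + 1 * (2 * C2 * ?p)" unfolding p2[symmetric] by (simp only: mult_ac mult_1)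
    also have "\<dots> \<le> ?L t * (C1 * ?p) + ?L t * (2 * C2 * ?p)"
      by (intro add_mono mult_right_mono order_refl Lge[OF t]) (use 2 p in simp)
    also have "\<dots> = (C1 + 2 * C2) * (?L t / (1 - t) powr \<alpha>)" unfolding p(2) by (simp add: algebra_simps)
    finally show "suminf (?u t) \<le> (C1 + 2 * C2) * (?L t / (1 - t) powr \<alpha>)" .
    have "?L t * ?S \<alpha> t = (\<Sum>n. ?L t * (real (n + 1) powr (\<alpha> - 1) * t ^ n))"
      by (rule suminf_mult[OF 1(3)[OF t], symmetric])
    also have "\<dots> \<le> (\<Sum>n. ?u t n + 2 * (1 - t) powr (- 1/2) * (real (n + 1) powr ((\<alpha> - 1/2) - 1) * t ^ n))"
      by (intro suminf_le low t sm summable_add summable_mult 1 3)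
    also have "\<dots> = suminf (?u t) + (\<Sum>n. 2 * (1 - t) powr (- 1/2) * (real (n + 1) powr ((\<alpha> - 1/2) - 1) * t ^ n))"
      by (rule suminf_add[symmetric]) (intro sm t summable_mult 3)+
    also have "(\<Sum>n. 2 * (1 - t) powr (- 1/2) * (real (n + 1) powr ((\<alpha> - 1/2) - 1) * t ^ n))
      = 2 * (1 - t) powr (- 1/2) * ?S (\<alpha> - 1/2) t" by (rule suminf_mult[OF 3(3)[OF t]])
    also have "\<dots> \<le> 2 * (1 - t) powr (- 1/2) * (C3 * (1 - t) powr (- (\<alpha> - 1/2)))"
      using 3(5)[OF t] by (intro mult_left_mono) auto
    also have "\<dots> = 2 * C3 * ?p" unfolding p3[symmetric] by (simp only: mult_ac)
    also have "\<dots> \<le> 2 * C3 * (suminf (?u t) / (c1 * ln 2))"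
    proof (intro mult_left_mono)
      have "ln 2 * ?S \<alpha> t = (\<Sum>n. ln 2 * (real (n + 1) powr (\<alpha> - 1) * t ^ n))"
        by (rule suminf_mult[OF 1(3)[OF t], symmetric])
      also have "\<dots> \<le> suminf (?u t)"
      proof (intro suminf_le sm t summable_mult 1)
        fix n
        have "ln 2 * (real (n + 1) powr (\<alpha> - 1) * t ^ n) \<le> ln (real (n + 2)) * (real (n + 1) powr (\<alpha> - 1) * t ^ n)"
          using t by (intro mult_right_mono) auto
        then show "ln 2 * (real (n + 1) powr (\<alpha> - 1) * t ^ n) \<le> ?u t n" by (simp add: mult_ac)
      qed
      finally have "ln 2 * ?S \<alpha> t \<le> suminf (?u t)" .
      moreover have "ln 2 * (c1 * ?p) \<le> ln 2 * ?S \<alpha> t" using 1(4)[OF t] by (intro mult_left_mono) auto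
      ultimately have "ln 2 * (c1 * ?p) \<le> suminf (?u t)" by (rule order_trans[rotated])
      then have "?p * (c1 * ln 2) \<le> suminf (?u t)" by (simp only: mult_ac)
      then show "?p \<le> suminf (?u t) / (c1 * ln 2)" using 1(1) by (subst pos_le_divide_eq) simp_all
    qed (use 3 in auto)
    finally have *: "?L t * ?S \<alpha> t \<le> suminf (?u t) * (1 + 2 * C3 / (c1 * ln 2))"
      by (simp add: algebra_simps)
    have "c1 * (?L t * ?p) \<le> ?L t * ?S \<alpha> t"
      using mult_left_mono[OF 1(4)[OF t] L0] by (simp only: mult_ac)
    from this * have "c1 * (?L t * ?p) \<le> suminf (?u t) * (1 + 2 * C3 / (c1 * ln 2))" by (rule order_trans)
    moreover have "1 + 2 * C3 / (c1 * ln 2) > 0" using 1 3 by (auto intro!: add_pos_nonneg)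
    ultimately have "c1 * (?L t * ?p) / (1 + 2 * C3 / (c1 * ln 2)) \<le> suminf (?u t)"
      by (subst pos_divide_le_eq)
    then show "c * (?L t / (1 - t) powr \<alpha>) \<le> suminf (?u t)"
      unfolding p(2) c_def by (simp only: times_divide_eq_left)
  qed
qed

lemma moment_series_iff_log_integral:
  assumes \<mu>: "finite_measure \<mu>" "sets \<mu> = sets (restrict_space borel {0..<1::real})" and \<alpha>: "1 \<le> \<alpha>"
  shows "summable (\<lambda>n. real (n + 1) powr (\<alpha> - 1) * moment \<mu> n * ln (real (n + 2)))
     \<longleftrightarrow> (\<integral>\<^sup>+ t. ennreal (ln (exp 1 / (1 - t)) / (1 - t) powr \<alpha>) \<partial>\<mu>) < \<infinity>"
proof -
  interpret finite_measure \<mu> by fact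
  note sp = unit_interval_measure(1)[OF assms(1,2)]
  note meas = unit_interval_measure(2)[OF assms(1,2)]
  from log_weight_series[OF \<alpha>] obtain c C where e: "0 < c" "0 < C"
    "\<forall>t. 0 \<le> t \<and> t < 1 \<longrightarrow> summable (\<lambda>n. real (n + 1) powr (\<alpha> - 1) * ln (real (n + 2)) * t ^ n)
    \<and> c * (ln (exp 1 / (1 - t)) / (1 - t) powr \<alpha>) \<le> (\<Sum>n. real (n + 1) powr (\<alpha> - 1) * ln (real (n + 2)) * t ^ n)
    \<and> (\<Sum>n. real (n + 1) powr (\<alpha> - 1) * ln (real (n + 2)) * t ^ n) \<le> C * (ln (exp 1 / (1 - t)) / (1 - t) powr \<alpha>)"
    by (elim exE conjE)
  have f: "0 \<le> t \<and> t < 1" if "0 \<le> t" "t < 1" for t :: real using that ..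
  note c = e(1,2) e(3)[THEN spec, THEN mp, OF f, THEN conjunct1]
    e(3)[THEN spec, THEN mp, OF f, THEN conjunct2, THEN conjunct1]
    e(3)[THEN spec, THEN mp, OF f, THEN conjunct2, THEN conjunct2]
  let ?G = "\<lambda>t. ln (exp 1 / (1 - t)) / (1 - t) powr \<alpha>"
  define w where "w n = real (n + 1) powr (\<alpha> - 1) * ln (real (n + 2))" for n
  note c = c[folded w_def]
  have w0: "0 \<le> w n" for n by (simp add: w_def)
  have [measurable]: "(\<lambda>t. ennreal (?G t)) \<in> borel_measurable \<mu>" by (rule meas) measurable
  have [measurable]: "(\<lambda>t. ennreal (w n * t ^ n)) \<in> borel_measurable \<mu>" for n by (rule meas) measurable
  have pm: "(\<lambda>t. t ^ n) \<in> borel_measurable \<mu>" for n by (rule meas) measurable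
  have int: "integrable \<mu> (\<lambda>t. t ^ n)" for n
    by (rule integrable_const_bound[where B = 1, OF _ pm]) (use sp in \<open>auto simp: power_le_one\<close>)
  have m: "(\<integral>\<^sup>+ t. ennreal (w n * t ^ n) \<partial>\<mu>) = ennreal (w n * moment \<mu> n)" for n
    unfolding moment_def
    by (subst nn_integral_eq_integral) (use int sp w0 in \<open>auto intro!: mult_nonneg_nonneg\<close>)
  have m0: "0 \<le> moment \<mu> n" for n unfolding moment_def using sp by (intro integral_nonneg_AE) auto
  have D: "(\<Sum>n. ennreal (w n * t ^ n)) = ennreal (\<Sum>n. w n * t ^ n)" if "t \<in> space \<mu>" for t
    using that sp c(3)[of t] w0 by (intro suminf_ennreal2) auto
  have Dint: "(\<integral>\<^sup>+ t. ennreal (\<Sum>n. w n * t ^ n) \<partial>\<mu>) = (\<Sum>n. ennreal (w n * moment \<mu> n))"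
  proof -
    have "(\<integral>\<^sup>+ t. ennreal (\<Sum>n. w n * t ^ n) \<partial>\<mu>) = (\<integral>\<^sup>+ t. (\<Sum>n. ennreal (w n * t ^ n)) \<partial>\<mu>)"
      by (intro nn_integral_cong D[symmetric])
    also have "\<dots> = (\<Sum>n. \<integral>\<^sup>+ t. ennreal (w n * t ^ n) \<partial>\<mu>)" by (rule nn_integral_suminf) measurable
    finally show ?thesis by (simp only: m)
  qed
  have "summable (\<lambda>n. real (n + 1) powr (\<alpha> - 1) * moment \<mu> n * ln (real (n + 2))) \<longleftrightarrow> summable (\<lambda>n. w n * moment \<mu> n)"
    by (simp only: w_def mult_ac)
  also have "\<dots> \<longleftrightarrow> (\<Sum>n. ennreal (w n * moment \<mu> n)) < \<infinity>"
  proof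
    assume "summable (\<lambda>n. w n * moment \<mu> n)"
    then show "(\<Sum>n. ennreal (w n * moment \<mu> n)) < \<infinity>"
      using w0 m0 by (subst suminf_ennreal2) auto
  next
    assume "(\<Sum>n. ennreal (w n * moment \<mu> n)) < \<infinity>"
    then show "summable (\<lambda>n. w n * moment \<mu> n)"
      using w0 m0 by (intro summable_suminf_not_top) (auto simp: less_top)
  qed
  also have "\<dots> \<longleftrightarrow> (\<integral>\<^sup>+ t. ennreal (?G t) \<partial>\<mu>) < \<infinity>"
  proof
    assume fin: "(\<Sum>n. ennreal (w n * moment \<mu> n)) < \<infinity>"
    have "(\<integral>\<^sup>+ t. ennreal (?G t) \<partial>\<mu>) \<le> (\<integral>\<^sup>+ t. ennreal (1 / c) * ennreal (\<Sum>n. w n * t ^ n) \<partial>\<mu>)"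
    proof (rule nn_integral_mono)
      fix t assume "t \<in> space \<mu>"
      then have "?G t \<le> 1 / c * (\<Sum>n. w n * t ^ n)" using sp c(4)[of t] c(1) by (simp add: field_simps)
      then show "ennreal (?G t) \<le> ennreal (1 / c) * ennreal (\<Sum>n. w n * t ^ n)"
        using c(1) by (simp add: ennreal_leI flip: ennreal_mult')
    qed
    also have "\<dots> = (\<integral>\<^sup>+ t. ennreal (1 / c) * (\<Sum>n. ennreal (w n * t ^ n)) \<partial>\<mu>)"
      by (intro nn_integral_cong) (simp only: D)
    also have "\<dots> = ennreal (1 / c) * (\<integral>\<^sup>+ t. (\<Sum>n. ennreal (w n * t ^ n)) \<partial>\<mu>)"
      by (rule nn_integral_cmult) measurable
    also have "(\<integral>\<^sup>+ t. (\<Sum>n. ennreal (w n * t ^ n)) \<partial>\<mu>) = (\<Sum>n. ennreal (w n * moment \<mu> n))"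
      unfolding Dint[symmetric] by (intro nn_integral_cong D)
    also have "ennreal (1 / c) * \<dots> < \<infinity>" using fin by (simp add: ennreal_mult_less_top)
    finally show "(\<integral>\<^sup>+ t. ennreal (?G t) \<partial>\<mu>) < \<infinity>" .
  next
    assume fin: "(\<integral>\<^sup>+ t. ennreal (?G t) \<partial>\<mu>) < \<infinity>"
    have "(\<Sum>n. ennreal (w n * moment \<mu> n)) \<le> (\<integral>\<^sup>+ t. ennreal C * ennreal (?G t) \<partial>\<mu>)"
      unfolding Dint[symmetric]
    proof (rule nn_integral_mono)
      fix t assume "t \<in> space \<mu>"
      then have "(\<Sum>n. w n * t ^ n) \<le> C * ?G t" using sp c(5)[of t] by simp
      then show "ennreal (\<Sum>n. w n * t ^ n) \<le> ennreal C * ennreal (?G t)"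
        using c(2) by (simp add: ennreal_leI flip: ennreal_mult')
    qed
    also have "\<dots> = ennreal C * (\<integral>\<^sup>+ t. ennreal (?G t) \<partial>\<mu>)" by (rule nn_integral_cmult) measurable
    also have "\<dots> < \<infinity>" using fin by (simp add: ennreal_mult_less_top)
    finally show "(\<Sum>n. ennreal (w n * moment \<mu> n)) < \<infinity>" .
  qed
  finally show ?thesis .
qed

section \<open>Sufficiency: boundedness and compactness\<close>

lemma weighted_linear: "weighted \<alpha> (\<lambda>z. a * f z + b * g z) w = a * weighted \<alpha> f w + b * weighted \<alpha> g w"
  by (simp add: weighted_def algebra_simps)

lemma cesaro_like_linear:
  assumes \<mu>: "finite_measure \<mu>" "sets \<mu> = sets (restrict_space borel {0..<1::real})"
    and f: "f holomorphic_on ball 0 1" and g: "g holomorphic_on ball 0 1" and \<alpha>: "\<alpha> > 0"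
  shows "cesaro_like \<mu> \<alpha> (\<lambda>z. a * f z + b * g z) = (\<lambda>z. a * cesaro_like \<mu> \<alpha> f z + b * cesaro_like \<mu> \<alpha> g z)"
proof
  fix z :: complex
  have h: "(\<lambda>z. a * f z + b * g z) holomorphic_on ball 0 1" by (intro holomorphic_intros f g)
  show "cesaro_like \<mu> \<alpha> (\<lambda>z. a * f z + b * g z) z = a * cesaro_like \<mu> \<alpha> f z + b * cesaro_like \<mu> \<alpha> g z"
  proof (cases "norm z < 1")
    case True
    note i = cesaro_like_integrable[OF \<mu> f \<alpha> True] cesaro_like_integrable[OF \<mu> g \<alpha> True]
    show ?thesis
      unfolding cesaro_like_integral[OF \<mu> h \<alpha> True] cesaro_like_integral[OF \<mu> f \<alpha> True]
        cesaro_like_integral[OF \<mu> g \<alpha> True] weighted_linear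
      using i by simp
  next
    case False
    then show ?thesis by (simp add: cesaro_like_def)
  qed
qed

text \<open>
Cutting off outside the disk makes this function Borel measurable on the whole plane.
\<close>

definition deriv2_disk :: "real \<Rightarrow> (complex \<Rightarrow> complex) \<Rightarrow> complex \<Rightarrow> complex" where
  "deriv2_disk \<alpha> f w = indicator (ball 0 1) w *\<^sub>R deriv (deriv (weighted \<alpha> f)) w"

lemma deriv2_disk_measurable:
  assumes "f holomorphic_on ball 0 1"
  shows "deriv2_disk \<alpha> f \<in> borel_measurable borel"
proof -
  have 1: "deriv (weighted \<alpha> f) holomorphic_on ball 0 1"
    by (intro holomorphic_deriv holomorphic_weighted assms) auto
  have "deriv (deriv (weighted \<alpha> f)) holomorphic_on ball 0 1"
    by (intro holomorphic_deriv 1) auto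
  then show ?thesis
    unfolding deriv2_disk_def
    by (intro borel_measurable_continuous_on_indicator holomorphic_on_imp_continuous_on) auto
qed

text \<open>
Its integral over the product of \<open>\<mu>\<close> and the plane bounds the area integral of the second
derivative of the image of \<open>f\<close>. On the product space a single application of dominated convergence
covers both integrations.
\<close>

definition area_density :: "real \<Rightarrow> (complex \<Rightarrow> complex) \<Rightarrow> real \<times> complex \<Rightarrow> ennreal" where
  "area_density \<alpha> f p = ennreal (fst p * norm (deriv2_disk \<alpha> f (of_real (fst p) * snd p))) * indicator (ball 0 1) (snd p)"

definition majorant_density :: "real \<Rightarrow> real \<times> complex \<Rightarrow> ennreal" where
  "majorant_density \<alpha> p = ennreal (fst p * majorant \<alpha> (of_real (fst p) * snd p)) * indicator (ball 0 1) (snd p)"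

lemma density_measurable:
  assumes \<mu>: "finite_measure \<mu>" "sets \<mu> = sets (restrict_space borel {0..<1::real})"
  shows area_density_measurable: "f holomorphic_on ball 0 1 \<Longrightarrow> area_density \<alpha> f \<in> borel_measurable (\<mu> \<Otimes>\<^sub>M lborel)"
    and majorant_density_measurable: "majorant_density \<alpha> \<in> borel_measurable (\<mu> \<Otimes>\<^sub>M lborel)"
proof -
  have [measurable]: "(\<lambda>t. t) \<in> \<mu> \<rightarrow>\<^sub>M borel" by (rule unit_interval_measure(2)[OF \<mu>]) measurable
  have [measurable]: "fst \<in> \<mu> \<Otimes>\<^sub>M lborel \<rightarrow>\<^sub>M borel"
    using measurable_compose[OF measurable_fst \<open>(\<lambda>t. t) \<in> \<mu> \<rightarrow>\<^sub>M borel\<close>] by simp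
  have [measurable]: "snd \<in> \<mu> \<Otimes>\<^sub>M lborel \<rightarrow>\<^sub>M (borel :: complex measure)"
    using measurable_snd[of \<mu> "lborel :: complex measure"] by simp
  have [measurable]: "(indicator (ball (0::complex) 1) :: complex \<Rightarrow> ennreal) \<in> borel_measurable borel"
    by (intro borel_measurable_indicator) simp
  show "area_density \<alpha> f \<in> borel_measurable (\<mu> \<Otimes>\<^sub>M lborel)" if "f holomorphic_on ball 0 1"
  proof -
    have [measurable]: "deriv2_disk \<alpha> f \<in> borel_measurable borel" by (rule deriv2_disk_measurable[OF that])
    show ?thesis unfolding area_density_def by measurable
  qed
  show "majorant_density \<alpha> \<in> borel_measurable (\<mu> \<Otimes>\<^sub>M lborel)"
    unfolding majorant_density_def by measurable
qed

text \<open>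
The factor \<open>t\<^sup>2\<close> from differentiating twice is weakened to \<open>t\<close>, the form in which the area
integral of the majorant is bounded.
\<close>

lemma cesaro_area_le:
  assumes \<mu>: "finite_measure \<mu>" "sets \<mu> = sets (restrict_space borel {0..<1::real})"
    and f: "f holomorphic_on ball 0 1" and \<alpha>: "\<alpha> > 0"
  shows "(\<integral>\<^sup>+z\<in>ball 0 1. ennreal (norm (deriv (deriv (cesaro_like \<mu> \<alpha> f)) z)) \<partial>lborel)
      \<le> (\<integral>\<^sup>+p. area_density \<alpha> f p \<partial>(\<mu> \<Otimes>\<^sub>M lborel))"
proof -
  interpret finite_measure \<mu> by fact
  interpret P: pair_sigma_finite \<mu> "lborel :: complex measure" ..
  note sp = unit_interval_measure(1)[OF \<mu>]
  have "(\<integral>\<^sup>+z\<in>ball 0 1. ennreal (norm (deriv (deriv (cesaro_like \<mu> \<alpha> f)) z)) \<partial>lborel)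
     \<le> (\<integral>\<^sup>+z. (\<integral>\<^sup>+t. area_density \<alpha> f (t, z) \<partial>\<mu>) \<partial>lborel)"
  proof (rule nn_integral_mono)
    fix z :: complex
    show "ennreal (norm (deriv (deriv (cesaro_like \<mu> \<alpha> f)) z)) * indicator (ball 0 1) z \<le> (\<integral>\<^sup>+t. area_density \<alpha> f (t, z) \<partial>\<mu>)"
    proof (cases "norm z < 1")
      case z: True
      have "ennreal (norm (deriv (deriv (cesaro_like \<mu> \<alpha> f)) z))
         \<le> (\<integral>\<^sup>+t. norm (of_real t ^ 2 * deriv (deriv (weighted \<alpha> f)) (of_real t * z)) \<partial>\<mu>)"
        unfolding cesaro_like_deriv2[OF \<mu> f \<alpha> z]
        by (rule integral_norm_bound_ennreal[OF cesaro_like_deriv2_integrable[OF \<mu> f \<alpha> z]])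
      also have "\<dots> \<le> (\<integral>\<^sup>+t. area_density \<alpha> f (t, z) \<partial>\<mu>)"
      proof (rule nn_integral_mono)
        fix t assume "t \<in> space \<mu>"
        then have t: "0 \<le> t" "t < 1" using sp by auto
        have tz: "norm (of_real t * z) < 1" using t z mult_strict_mono'[of t 1 "norm z" 1] by (simp add: norm_mult)
        have "norm (of_real t ^ 2 * deriv (deriv (weighted \<alpha> f)) (of_real t * z))
            = t ^ 2 * norm (deriv2_disk \<alpha> f (of_real t * z))"
          using t tz by (simp add: deriv2_disk_def norm_mult norm_power)
        also have "\<dots> \<le> t * norm (deriv2_disk \<alpha> f (of_real t * z))"
          using t power_decreasing[of 1 2 t] by (intro mult_right_mono) auto
        finally show "ennreal (norm (of_real t ^ 2 * deriv (deriv (weighted \<alpha> f)) (of_real t * z))) \<le> area_density \<alpha> f (t, z)"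
          using z by (simp add: area_density_def ennreal_leI)
      qed
      finally show ?thesis using z by simp
    qed simp
  qed
  also have "\<dots> = (\<integral>\<^sup>+p. area_density \<alpha> f p \<partial>(\<mu> \<Otimes>\<^sub>M lborel))"
    by (rule P.nn_integral_snd) (rule area_density_measurable[OF \<mu> f])
  finally show ?thesis .
qed

lemma majorant_density_integral_le:
  assumes \<mu>: "finite_measure \<mu>" "sets \<mu> = sets (restrict_space borel {0..<1::real})" and \<alpha>: "1 \<le> \<alpha>"
  shows "(\<integral>\<^sup>+p. majorant_density \<alpha> p \<partial>(\<mu> \<Otimes>\<^sub>M lborel)) \<le> 240 * (\<integral>\<^sup>+ t. ennreal (ln (exp 1 / (1 - t)) / (1 - t) powr \<alpha>) \<partial>\<mu>)"
proof -
  note sp = unit_interval_measure(1)[OF \<mu>]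
  have "(\<integral>\<^sup>+p. majorant_density \<alpha> p \<partial>(\<mu> \<Otimes>\<^sub>M lborel)) = (\<integral>\<^sup>+t. (\<integral>\<^sup>+z. majorant_density \<alpha> (t, z) \<partial>lborel) \<partial>\<mu>)"
    by (rule lborel.nn_integral_fst[symmetric]) (rule majorant_density_measurable[OF \<mu>])
  also have "\<dots> \<le> (\<integral>\<^sup>+t. 240 * ennreal (ln (exp 1 / (1 - t)) / (1 - t) powr \<alpha>) \<partial>\<mu>)"
  proof (rule nn_integral_mono)
    fix t assume "t \<in> space \<mu>"
    then have t: "0 \<le> t" "t < 1" using sp by auto
    have "(\<integral>\<^sup>+z. majorant_density \<alpha> (t, z) \<partial>lborel) \<le> ennreal (240 * (ln (exp 1 / (1 - t)) / (1 - t) powr \<alpha>))"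
      using area_integral_majorant_le[OF t \<alpha>] by (simp add: majorant_density_def)
    then show "(\<integral>\<^sup>+z. majorant_density \<alpha> (t, z) \<partial>lborel) \<le> 240 * ennreal (ln (exp 1 / (1 - t)) / (1 - t) powr \<alpha>)"
      by (simp only: ennreal_mult' ennreal_numeral zero_le_numeral)
  qed
  also have "\<dots> = 240 * (\<integral>\<^sup>+ t. ennreal (ln (exp 1 / (1 - t)) / (1 - t) powr \<alpha>) \<partial>\<mu>)"
    by (rule nn_integral_cmult) (rule unit_interval_measure(2)[OF \<mu>], measurable)
  finally show ?thesis .
qed

text \<open>
A bound for each part of the Bloch norm, rather than for their sum, which is the form required by the growth estimates.
\<close>

definition bloch_le :: "real \<Rightarrow> (complex \<Rightarrow> complex) \<Rightarrow> bool" where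
  "bloch_le A f \<longleftrightarrow> f \<in> hol_disk \<and> norm (f 0) \<le> A \<and> (\<forall>z. norm z < 1 \<longrightarrow> (1 - (norm z)\<^sup>2) * norm (deriv f z) \<le> A)"

lemma area_density_le:
  assumes \<mu>: "finite_measure \<mu>" "sets \<mu> = sets (restrict_space borel {0..<1::real})" and \<alpha>: "1 \<le> \<alpha>"
    and f: "bloch_le A f" and p: "p \<in> space (\<mu> \<Otimes>\<^sub>M lborel)"
  shows "area_density \<alpha> f p \<le> ennreal ((4 + 2 * \<alpha> + \<alpha> * (\<alpha> + 1)) * A) * majorant_density \<alpha> p"
proof (cases "norm (snd p) < 1")
  case True
  let ?K = "(4 + 2 * \<alpha> + \<alpha> * (\<alpha> + 1)) * A"
  let ?w = "of_real (fst p) * snd p"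
  have A0: "A \<ge> 0" using f norm_ge_zero order_trans unfolding bloch_le_def by blast
  have t: "0 \<le> fst p" "fst p < 1" using p unit_interval_measure(1)[OF \<mu>] by (auto simp: space_pair_measure)
  have w: "norm ?w < 1" using t True mult_strict_mono'[of "fst p" 1 "norm (snd p)" 1] by (simp add: norm_mult)
  have "norm (deriv2_disk \<alpha> f ?w) \<le> ?K * majorant \<alpha> ?w"
    using deriv2_weighted_le[of f A ?w \<alpha>] f w \<alpha> by (simp add: deriv2_disk_def bloch_le_def hol_disk_def)
  then have "fst p * norm (deriv2_disk \<alpha> f ?w) \<le> fst p * (?K * majorant \<alpha> ?w)"
    by (rule mult_left_mono[OF _ t(1)])
  then have "ennreal (fst p * norm (deriv2_disk \<alpha> f ?w)) \<le> ennreal (?K * (fst p * majorant \<alpha> ?w))"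
    by (intro ennreal_leI) (simp only: mult_ac)
  also have "\<dots> = ennreal ?K * ennreal (fst p * majorant \<alpha> ?w)"
    using A0 \<alpha> by (intro ennreal_mult') simp
  finally show ?thesis using True by (simp add: area_density_def majorant_density_def)
qed (simp add: area_density_def)

lemma cesaro_like_in_B1:
  assumes \<mu>: "finite_measure \<mu>" "sets \<mu> = sets (restrict_space borel {0..<1::real})"
    and f: "f \<in> hol_disk" and \<alpha>: "\<alpha> > 0"
    and fin: "(\<integral>\<^sup>+p. area_density \<alpha> f p \<partial>(\<mu> \<Otimes>\<^sub>M lborel)) < \<infinity>"
  shows "cesaro_like \<mu> \<alpha> f \<in> B1_space"
    and "B1_norm (cesaro_like \<mu> \<alpha> f) \<le> measure \<mu> (space \<mu>) * norm (f 0)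
       + measure \<mu> (space \<mu>) * (norm (deriv f 0) + \<alpha> * norm (f 0))
       + 1 / pi * enn2real (\<integral>\<^sup>+p. area_density \<alpha> f p \<partial>(\<mu> \<Otimes>\<^sub>M lborel))"
proof -
  interpret finite_measure \<mu> by fact
  note sp = unit_interval_measure(1)[OF \<mu>]
  let ?g = "cesaro_like \<mu> \<alpha> f" and ?m = "measure \<mu> (space \<mu>)"
  let ?F = "\<lambda>z. indicator (ball 0 1) z *\<^sub>R norm (deriv (deriv ?g) z)"
  have fh: "f holomorphic_on ball 0 1" using f by (simp add: hol_disk_def)
  have g: "?g \<in> hol_disk" by (rule cesaro_like_hol_disk[OF \<mu> fh \<alpha>])
  then have gh: "?g holomorphic_on ball 0 1" by (simp add: hol_disk_def)
  have gh1: "deriv ?g holomorphic_on ball 0 1" by (intro holomorphic_deriv gh) auto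
  have gh2: "deriv (deriv ?g) holomorphic_on ball 0 1" by (intro holomorphic_deriv gh1) auto
  have Fm: "?F \<in> borel_measurable borel"
    by (intro borel_measurable_continuous_on_indicator continuous_on_norm holomorphic_on_imp_continuous_on gh2) auto
  have "(\<integral>\<^sup>+z. ennreal (?F z) \<partial>lborel) = (\<integral>\<^sup>+z\<in>ball 0 1. ennreal (norm (deriv (deriv ?g) z)) \<partial>lborel)"
    by (intro nn_integral_cong) (auto simp: indicator_def)
  also note cesaro_area_le[OF \<mu> fh \<alpha>]
  finally have le: "(\<integral>\<^sup>+z. ennreal (?F z) \<partial>lborel) \<le> (\<integral>\<^sup>+p. area_density \<alpha> f p \<partial>(\<mu> \<Otimes>\<^sub>M lborel))" .
  have "integrable lborel ?F"
    using Fm le_less_trans[OF le fin] by (simp add: integrable_iff_bounded)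
  then show "?g \<in> B1_space" using g by (simp add: B1_space_def set_integrable_def)
  have "(LINT z:ball 0 1|lborel. norm (deriv (deriv ?g) z)) = enn2real (\<integral>\<^sup>+z. ennreal (?F z) \<partial>lborel)"
    unfolding set_lebesgue_integral_def by (rule integral_eq_nn_integral) (use Fm in auto)
  also have "\<dots> \<le> enn2real (\<integral>\<^sup>+p. area_density \<alpha> f p \<partial>(\<mu> \<Otimes>\<^sub>M lborel))"
    using fin by (intro enn2real_mono le) auto
  finally have 3: "(LINT z:ball 0 1|lborel. norm (deriv (deriv ?g) z)) \<le> enn2real (\<integral>\<^sup>+p. area_density \<alpha> f p \<partial>(\<mu> \<Otimes>\<^sub>M lborel))" .
  have "?g 0 = ?m *\<^sub>R f 0" using cesaro_like_integral[OF \<mu> fh \<alpha>, of 0] by (simp add: weighted_def)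
  then have 1: "norm (?g 0) = ?m * norm (f 0)" by simp
  have W: "deriv (weighted \<alpha> f) 0 = deriv f 0 + of_real \<alpha> * f 0"
    using deriv_weighted[OF fh, of 0 \<alpha>] by simp
  have tm: "(\<lambda>t. t) \<in> borel_measurable \<mu>" by (rule unit_interval_measure(2)[OF \<mu>]) measurable
  have ti: "integrable \<mu> (\<lambda>t. t)"
    by (rule integrable_const_bound[where B = 1, OF _ tm]) (use sp in auto)
  have "deriv ?g 0 = of_real (LINT t|\<mu>. t) * deriv (weighted \<alpha> f) 0"
    using cesaro_like_deriv[OF \<mu> fh \<alpha>, of 0] by simp
  moreover have "\<bar>LINT t|\<mu>. t\<bar> \<le> ?m"
  proof -
    have "(LINT t|\<mu>. t) \<le> (LINT t|\<mu>. 1)" using sp by (intro integral_mono ti) auto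
    moreover have "0 \<le> (LINT t|\<mu>. t)" using sp by (intro integral_nonneg_AE AE_I2) auto
    ultimately show ?thesis by simp
  qed
  moreover have "norm (deriv (weighted \<alpha> f) 0) \<le> norm (deriv f 0) + \<alpha> * norm (f 0)"
    unfolding W using norm_triangle_ineq[of "deriv f 0" "of_real \<alpha> * f 0"] \<alpha> by (simp add: norm_mult)
  ultimately have 2: "norm (deriv ?g 0) \<le> ?m * (norm (deriv f 0) + \<alpha> * norm (f 0))"
    by (simp only: norm_mult norm_of_real) (intro mult_mono; simp)
  show "B1_norm ?g \<le> ?m * norm (f 0) + ?m * (norm (deriv f 0) + \<alpha> * norm (f 0))
       + 1 / pi * enn2real (\<integral>\<^sup>+p. area_density \<alpha> f p \<partial>(\<mu> \<Otimes>\<^sub>M lborel))"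
    unfolding B1_norm_def 1 by (intro add_mono mult_left_mono 2 3) auto
qed

lemma compact_limit_higher_deriv:
  assumes hol: "\<And>n. u n holomorphic_on ball 0 1"
    and lim: "\<And>K. compact K \<Longrightarrow> K \<subseteq> ball 0 1 \<Longrightarrow> uniform_limit K u v sequentially"
    and z: "norm z < (1::real)"
  shows "(\<lambda>n. (deriv ^^ m) (u n) z) \<longlonglongrightarrow> (deriv ^^ m) v z"
proof -
  obtain e where e: "e > 0" "cball z e \<subseteq> ball 0 1"
    using z open_contains_cball[of "ball (0::complex) 1"] by (metis mem_ball_0 open_ball)
  have sub: "ball z e \<subseteq> cball z e" by (rule ball_subset_cball)
  have "uniform_limit (ball z e) u v sequentially"
    by (rule uniform_limit_on_subset[OF lim[OF compact_cball e(2)] sub])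
  moreover have "\<forall>\<^sub>F n in sequentially. u n holomorphic_on ball z e"
    using holomorphic_on_subset[OF hol] sub e(2) by (intro always_eventually) blast
  ultimately show ?thesis
    by (rule higher_deriv_complex_uniform_limit) (use e in auto)
qed


text \<open>
Local uniform convergence passes to derivatives, so the second derivatives of the weighted
functions tend to zero pointwise, and the common Bloch bound supplies an integrable majorant on the
product space.
\<close>

lemma B1_norm_cesaro_like_tendsto_zero:
  assumes \<mu>: "finite_measure \<mu>" "sets \<mu> = sets (restrict_space borel {0..<1::real})" and \<alpha>: "1 \<le> \<alpha>"
    and fin: "(\<integral>\<^sup>+ t. ennreal (ln (exp 1 / (1 - t)) / (1 - t) powr \<alpha>) \<partial>\<mu>) < \<infinity>"
    and h: "\<And>n. bloch_le A (h n)"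
    and lim: "\<And>K. compact K \<Longrightarrow> K \<subseteq> ball 0 1 \<Longrightarrow> uniform_limit K h (\<lambda>_. 0) sequentially"
  shows "(\<lambda>n. B1_norm (cesaro_like \<mu> \<alpha> (h n))) \<longlonglongrightarrow> 0"
proof -
  let ?P = "\<mu> \<Otimes>\<^sub>M (lborel :: complex measure)"
  let ?K = "(4 + 2 * \<alpha> + \<alpha> * (\<alpha> + 1)) * A"
  let ?m = "measure \<mu> (space \<mu>)"
  note sp = unit_interval_measure(1)[OF \<mu>]
  have \<alpha>0: "\<alpha> > 0" using \<alpha> by simp
  have hd: "h n \<in> hol_disk" for n using h by (simp add: bloch_le_def)
  then have hol: "h n holomorphic_on ball 0 1" for n by (simp add: hol_disk_def)
  have kfin: "(\<integral>\<^sup>+p. ennreal ?K * majorant_density \<alpha> p \<partial>?P) < \<infinity>"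
  proof -
    have "(\<integral>\<^sup>+p. ennreal ?K * majorant_density \<alpha> p \<partial>?P) = ennreal ?K * (\<integral>\<^sup>+p. majorant_density \<alpha> p \<partial>?P)"
      by (rule nn_integral_cmult) (rule majorant_density_measurable[OF \<mu>])
    also have "\<dots> \<le> ennreal ?K * (240 * (\<integral>\<^sup>+ t. ennreal (ln (exp 1 / (1 - t)) / (1 - t) powr \<alpha>) \<partial>\<mu>))"
      by (intro mult_left_mono majorant_density_integral_le[OF \<mu> \<alpha>]) simp
    also have "\<dots> < \<infinity>" using fin by (simp add: ennreal_mult_less_top)
    finally show ?thesis .
  qed
  have dlim: "(\<lambda>n. (deriv ^^ m) (h n) z) \<longlonglongrightarrow> 0" if "norm z < 1" for m and z :: complex
  proof -
    have "(\<lambda>n. (deriv ^^ m) (h n) z) \<longlonglongrightarrow> (deriv ^^ m) (\<lambda>_. 0) z"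
      by (rule compact_limit_higher_deriv[OF hol lim that])
    then show ?thesis by simp
  qed
  have l0: "(\<lambda>n. h n z) \<longlonglongrightarrow> 0" and l1: "(\<lambda>n. deriv (h n) z) \<longlonglongrightarrow> 0"
    and l2: "(\<lambda>n. deriv (deriv (h n)) z) \<longlonglongrightarrow> 0" if "norm z < 1" for z :: complex
    using dlim[OF that, of 0] dlim[OF that, of 1] dlim[OF that, of 2] by (simp_all add: numeral_2_eq_2)
  have wlim: "(\<lambda>n. deriv2_disk \<alpha> (h n) w) \<longlonglongrightarrow> 0" if w: "norm w < 1" for w
  proof -
    have "(\<lambda>n. deriv (deriv (h n)) w * (1 - w) powr (of_real (- \<alpha>))
     + 2 * of_real \<alpha> * deriv (h n) w * (1 - w) powr (of_real (- \<alpha> - 1))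
     + of_real (\<alpha> * (\<alpha> + 1)) * h n w * (1 - w) powr (of_real (- \<alpha> - 2))) \<longlonglongrightarrow>
     0 * (1 - w) powr (of_real (- \<alpha>)) + 2 * of_real \<alpha> * 0 * (1 - w) powr (of_real (- \<alpha> - 1))
     + of_real (\<alpha> * (\<alpha> + 1)) * 0 * (1 - w) powr (of_real (- \<alpha> - 2))"
      by (intro tendsto_add tendsto_mult tendsto_const l0 l1 l2 w)
    then show ?thesis using w by (simp add: deriv2_disk_def deriv2_weighted[OF hol w])
  qed
  have "(\<lambda>n. \<integral>\<^sup>+p. area_density \<alpha> (h n) p \<partial>?P) \<longlonglongrightarrow> (\<integral>\<^sup>+p. 0 \<partial>?P)"
  proof (rule nn_integral_dominated_convergence[OF _ _ _ _ kfin])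
    show "area_density \<alpha> (h n) \<in> borel_measurable ?P" for n by (rule area_density_measurable[OF \<mu> hol])
    show "(\<lambda>p. ennreal ?K * majorant_density \<alpha> p) \<in> borel_measurable ?P"
      by (intro borel_measurable_times_ennreal borel_measurable_const majorant_density_measurable[OF \<mu>])
    show "AE p in ?P. area_density \<alpha> (h n) p \<le> ennreal ?K * majorant_density \<alpha> p" for n
      by (intro AE_I2 area_density_le[OF \<mu> \<alpha> h])
    show "AE p in ?P. (\<lambda>n. area_density \<alpha> (h n) p) \<longlonglongrightarrow> 0"
    proof (rule AE_I2)
      fix p assume p: "p \<in> space ?P"
      show "(\<lambda>n. area_density \<alpha> (h n) p) \<longlonglongrightarrow> 0"
      proof (cases "norm (snd p) < 1")
        case True
        have t: "0 \<le> fst p" "fst p < 1" using p sp by (auto simp: space_pair_measure)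
        have w: "norm (of_real (fst p) * snd p) < 1"
          using t True mult_strict_mono'[of "fst p" 1 "norm (snd p)" 1] by (simp add: norm_mult)
        have "(\<lambda>n. ennreal (fst p * norm (deriv2_disk \<alpha> (h n) (of_real (fst p) * snd p)))) \<longlonglongrightarrow> ennreal (fst p * norm (0::complex))"
          by (intro tendsto_ennrealI tendsto_mult tendsto_const tendsto_norm wlim w)
        then show ?thesis using True by (simp add: area_density_def)
      qed (simp add: area_density_def)
    qed
  qed simp
  then have Q0: "(\<lambda>n. \<integral>\<^sup>+p. area_density \<alpha> (h n) p \<partial>?P) \<longlonglongrightarrow> ennreal 0" by simp
  have Q: "(\<lambda>n. enn2real (\<integral>\<^sup>+p. area_density \<alpha> (h n) p \<partial>?P)) \<longlonglongrightarrow> 0"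
    using tendsto_enn2real[OF Q0] by simp
  have Qfin: "(\<integral>\<^sup>+p. area_density \<alpha> (h n) p \<partial>?P) < \<infinity>" for n
    by (rule le_less_trans[OF nn_integral_mono kfin]) (rule area_density_le[OF \<mu> \<alpha> h])
  have "(\<lambda>n. ?m * norm (h n 0) + ?m * (norm (deriv (h n) 0) + \<alpha> * norm (h n 0))
     + 1 / pi * enn2real (\<integral>\<^sup>+p. area_density \<alpha> (h n) p \<partial>?P)) \<longlonglongrightarrow>
     ?m * norm (0::complex) + ?m * (norm (0::complex) + \<alpha> * norm (0::complex)) + 1 / pi * 0"
    by (intro tendsto_add tendsto_mult tendsto_const tendsto_norm l0 l1 Q) simp_all
  then have ub: "(\<lambda>n. ?m * norm (h n 0) + ?m * (norm (deriv (h n) 0) + \<alpha> * norm (h n 0))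
     + 1 / pi * enn2real (\<integral>\<^sup>+p. area_density \<alpha> (h n) p \<partial>?P)) \<longlonglongrightarrow> 0" by simp
  show ?thesis
  proof (rule tendsto_sandwich[OF _ _ tendsto_const ub])
    show "\<forall>\<^sub>F n in sequentially. 0 \<le> B1_norm (cesaro_like \<mu> \<alpha> (h n))"
      by (intro always_eventually allI) (auto simp: B1_norm_def set_lebesgue_integral_def intro!: add_nonneg_nonneg mult_nonneg_nonneg integral_nonneg_AE)
    show "\<forall>\<^sub>F n in sequentially. B1_norm (cesaro_like \<mu> \<alpha> (h n)) \<le> ?m * norm (h n 0) + ?m * (norm (deriv (h n) 0) + \<alpha> * norm (h n 0))
     + 1 / pi * enn2real (\<integral>\<^sup>+p. area_density \<alpha> (h n) p \<partial>?P)"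
      by (intro always_eventually allI cesaro_like_in_B1(2)[OF \<mu> hd \<alpha>0 Qfin])
  qed
qed

text \<open>
Montel's theorem; the Bloch bound survives because the derivatives converge pointwise.
\<close>

lemma bloch_le_normal_family:
  assumes F: "\<And>n. bloch_le A (F n)"
    and loc: "\<And>K. compact K \<Longrightarrow> K \<subseteq> ball 0 1 \<Longrightarrow> \<exists>B. \<forall>n. \<forall>z\<in>K. norm (F n z) \<le> B"
  shows "\<exists>g r. strict_mono (r :: nat \<Rightarrow> nat) \<and> bloch_le A g \<and>
     (\<forall>K. compact K \<and> K \<subseteq> ball 0 1 \<longrightarrow> uniform_limit K (\<lambda>n. F (r n)) g sequentially)"
proof -
  have hol: "F n holomorphic_on ball 0 1" for n using F by (simp add: bloch_le_def hol_disk_def)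
  obtain g0 r where g0: "g0 holomorphic_on ball 0 1" and r: "strict_mono (r :: nat \<Rightarrow> nat)"
    and lim0: "\<And>K. compact K \<Longrightarrow> K \<subseteq> ball 0 1 \<Longrightarrow> uniform_limit K (F \<circ> r) g0 sequentially"
  proof (rule Montel[of "ball 0 1" "range F" F])
    show "\<exists>B. \<forall>h\<in>range F. \<forall>z\<in>K. norm (h z) \<le> B" if "compact K" "K \<subseteq> ball 0 1" for K
      using loc[OF that] by auto
  qed (use hol in auto)
  define g where "g z = (if z \<in> ball 0 1 then g0 z else 0)" for z
  have gh: "g \<in> hol_disk"
  proof -
    have "g holomorphic_on ball 0 1"
      by (rule holomorphic_transform[OF g0]) (simp add: g_def)
    then show ?thesis by (auto simp: hol_disk_def g_def)
  qed
  have lim: "uniform_limit K (\<lambda>n. F (r n)) g sequentially" if "compact K" "K \<subseteq> ball 0 1" for K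
  proof -
    have "uniform_limit K (\<lambda>n. F (r n)) g0 sequentially" using lim0[OF that] by (simp add: o_def)
    then show ?thesis
      by (rule uniform_limit_cong'[THEN iffD1, rotated 2]) (use that in \<open>auto simp: g_def\<close>)
  qed
  have d: "(\<lambda>n. (deriv ^^ m) (F (r n)) z) \<longlonglongrightarrow> (deriv ^^ m) g z" if "norm z < 1" for m and z :: complex
    by (rule compact_limit_higher_deriv[OF hol lim that])
  have "norm (g 0) \<le> A"
  proof (rule LIMSEQ_le_const2)
    show "(\<lambda>n. norm (F (r n) 0)) \<longlonglongrightarrow> norm (g 0)" using d[of 0 0] by (intro tendsto_norm) simp
    show "\<exists>N. \<forall>n\<ge>N. norm (F (r n) 0) \<le> A" using F by (auto simp: bloch_le_def)
  qed
  moreover have "(1 - (norm z)\<^sup>2) * norm (deriv g z) \<le> A" if z: "norm z < 1" for z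
  proof (rule LIMSEQ_le_const2)
    show "(\<lambda>n. (1 - (norm z)\<^sup>2) * norm (deriv (F (r n)) z)) \<longlonglongrightarrow> (1 - (norm z)\<^sup>2) * norm (deriv g z)"
      using d[OF z, of 1] by (intro tendsto_mult tendsto_const tendsto_norm) simp
    show "\<exists>N. \<forall>n\<ge>N. (1 - (norm z)\<^sup>2) * norm (deriv (F (r n)) z) \<le> A" using F z by (auto simp: bloch_le_def)
  qed
  ultimately have "bloch_le A g" using gh by (simp add: bloch_le_def)
  then show ?thesis using r lim by blast
qed

lemma bloch_le_diff:
  assumes f: "bloch_le A f" and g: "bloch_le B g"
  shows "bloch_le (A + B) (\<lambda>z. f z - g z)"
proof -
  have hol: "f holomorphic_on ball 0 1" "g holomorphic_on ball 0 1"
    using f g by (auto simp: bloch_le_def hol_disk_def)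
  have "(\<lambda>z. f z - g z) \<in> hol_disk"
    using f g by (auto simp: bloch_le_def hol_disk_def intro!: holomorphic_intros)
  moreover have "norm (f 0 - g 0) \<le> A + B"
    using f g norm_triangle_ineq4[of "f 0" "g 0"] by (auto simp: bloch_le_def)
  moreover have "(1 - (norm z)\<^sup>2) * norm (deriv (\<lambda>z. f z - g z) z) \<le> A + B" if z: "norm z < 1" for z
  proof -
    have "deriv (\<lambda>z. f z - g z) z = deriv f z - deriv g z"
      by (intro deriv_diff holomorphic_on_imp_differentiable_at[OF hol(1)] holomorphic_on_imp_differentiable_at[OF hol(2)])
         (use z in auto)
    then have "(1 - (norm z)\<^sup>2) * norm (deriv (\<lambda>z. f z - g z) z) \<le> (1 - (norm z)\<^sup>2) * (norm (deriv f z) + norm (deriv g z))"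
      using z norm_triangle_ineq4[of "deriv f z" "deriv g z"] by (intro mult_left_mono) (auto simp: power_le_one)
    also have "\<dots> \<le> A + B" using f g z unfolding bloch_le_def distrib_left by (intro add_mono) auto
    finally show ?thesis .
  qed
  ultimately show ?thesis by (simp add: bloch_le_def)
qed

theorem corollary1p2:
  fixes \<alpha> s :: real and \<mu> :: "real measure"
    and X :: "(complex \<Rightarrow> complex) set" and N :: "(complex \<Rightarrow> complex) \<Rightarrow> real"
  assumes "1 \<le> \<alpha>" and "1 < s"
    and "finite_measure \<mu>" and "sets \<mu> = sets (restrict_space borel {0..<1})"
    and "banach_subspace X N"
    and "mean_lipschitz s \<subseteq> X" and "X \<subseteq> bloch"
  shows "(bounded_operator X N B1_space B1_norm (cesaro_like \<mu> \<alpha>)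
            \<longleftrightarrow> compact_operator X N B1_space B1_norm (cesaro_like \<mu> \<alpha>))
       \<and> (compact_operator X N B1_space B1_norm (cesaro_like \<mu> \<alpha>)
            \<longleftrightarrow> summable (\<lambda>n. real (n + 1) powr (\<alpha> - 1) * moment \<mu> n * ln (real (n + 2))))
       \<and> (summable (\<lambda>n. real (n + 1) powr (\<alpha> - 1) * moment \<mu> n * ln (real (n + 2)))
            \<longleftrightarrow> (\<integral>\<^sup>+ t. ennreal (ln (exp 1 / (1 - t)) / (1 - t) powr \<alpha>) \<partial>\<mu>) < \<infinity>)"
proof -
  let ?C = "cesaro_like \<mu> \<alpha>"
  let ?fin = "(\<integral>\<^sup>+ t. ennreal (ln (exp 1 / (1 - t)) / (1 - t) powr \<alpha>) \<partial>\<mu>) < \<infinity>"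
  note \<alpha> = assms(1) and \<mu> = assms(3,4)
  have \<alpha>0: "\<alpha> > 0" using \<alpha> by simp
  have X: "subspace_hol_disk X" using assms(5) by (simp add: banach_subspace_def)
  have Xd: "f \<in> hol_disk" if "f \<in> X" for f using X that by (auto simp: subspace_hol_disk_def)
  have Xh: "f holomorphic_on ball 0 1" if "f \<in> X" for f using Xd[OF that] by (simp add: hol_disk_def)
  have necessary: ?fin if "linear_between X B1_space ?C"
  proof (rule log_integral_finite_if_cesaro_log_in_B1[OF \<mu> \<alpha>])
    have "log_fun \<in> X" using log_fun_mean_lipschitz[OF assms(2)] assms(6) by blast
    then show "?C log_fun \<in> B1_space" using that by (simp add: linear_between_def)
  qed
  from banach_subspace_bloch_bound[OF assms(5,7)] obtain A where A: "A \<ge> 0" and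
    AX: "\<And>f. f \<in> X \<Longrightarrow> bloch_le (A * N f) f"
    using Xd unfolding bloch_le_def by blast
  have sufficient: "bounded_operator X N B1_space B1_norm ?C \<and> compact_operator X N B1_space B1_norm ?C" if fin: ?fin
  proof -
    let ?P = "\<mu> \<Otimes>\<^sub>M (lborel :: complex measure)"
    let ?J = "\<integral>\<^sup>+p. majorant_density \<alpha> p \<partial>?P"
    let ?K = "4 + 2 * \<alpha> + \<alpha> * (\<alpha> + 1)"
    have Jfin: "?J < \<infinity>"
      using le_less_trans[OF majorant_density_integral_le[OF \<mu> \<alpha>]] fin by (simp add: ennreal_mult_less_top)
    have Q: "(\<integral>\<^sup>+p. area_density \<alpha> f p \<partial>?P) \<le> ennreal (?K * B) * ?J" if "bloch_le B f" for B f
    proof -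
      have "(\<integral>\<^sup>+p. area_density \<alpha> f p \<partial>?P) \<le> (\<integral>\<^sup>+p. ennreal (?K * B) * majorant_density \<alpha> p \<partial>?P)"
        by (intro nn_integral_mono area_density_le[OF \<mu> \<alpha> that])
      also have "\<dots> = ennreal (?K * B) * ?J"
        by (rule nn_integral_cmult) (rule majorant_density_measurable[OF \<mu>])
      finally show ?thesis .
    qed
    have Qfin: "(\<integral>\<^sup>+p. area_density \<alpha> f p \<partial>?P) < \<infinity>" if "bloch_le B f" for B f
      using le_less_trans[OF Q[OF that]] Jfin by (simp add: ennreal_mult_less_top)
    have inB1: "?C f \<in> B1_space" if "bloch_le B f" for B f
      using cesaro_like_in_B1(1)[OF \<mu> _ \<alpha>0 Qfin[OF that]] that by (simp add: bloch_le_def)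
    have lin: "linear_between X B1_space ?C"
      unfolding linear_between_def
    proof (intro conjI allI ballI)
      show "?C f \<in> B1_space" if "f \<in> X" for f using inB1[OF AX[OF that]] .
      show "?C (\<lambda>z. f z + g z) = (\<lambda>z. ?C f z + ?C g z)" if "f \<in> X" "g \<in> X" for f g
        using cesaro_like_linear[OF \<mu> Xh[OF that(1)] Xh[OF that(2)] \<alpha>0, of 1 1] by simp
      show "?C (\<lambda>z. c * f z) = (\<lambda>z. c * ?C f z)" if "f \<in> X" for f c
        using cesaro_like_linear[OF \<mu> Xh[OF that] Xh[OF that] \<alpha>0, of c 0] by simp
    qed
    have bounded: "bounded_operator X N B1_space B1_norm ?C"
    proof -
      let ?m = "measure \<mu> (space \<mu>)"
      let ?D = "?m * A + ?m * (A + \<alpha> * A) + 1 / pi * (?K * A * enn2real ?J)"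
      have "B1_norm (?C f) \<le> ?D * N f" if f: "f \<in> X" for f
      proof -
        note b = AX[OF f]
        have N0: "0 \<le> A * N f" using b norm_ge_zero order_trans unfolding bloch_le_def by blast
        have f0: "norm (f 0) \<le> A * N f" using b by (simp add: bloch_le_def)
        have "\<forall>z. norm z < 1 \<longrightarrow> (1 - (norm z)\<^sup>2) * norm (deriv f z) \<le> A * N f"
          using b by (simp add: bloch_le_def)
        from this[THEN spec, of 0] have f1: "norm (deriv f 0) \<le> A * N f" by simp
        have "enn2real (\<integral>\<^sup>+p. area_density \<alpha> f p \<partial>?P) \<le> enn2real (ennreal (?K * (A * N f)) * ?J)"
          using Jfin by (intro enn2real_mono Q[OF b]) (simp add: ennreal_mult_less_top)
        also have "\<dots> = ?K * (A * N f) * enn2real ?J"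
          using N0 \<alpha> by (simp add: enn2real_mult)
        finally have f2: "enn2real (\<integral>\<^sup>+p. area_density \<alpha> f p \<partial>?P) \<le> ?K * (A * N f) * enn2real ?J" .
        have "B1_norm (?C f) \<le> ?m * norm (f 0) + ?m * (norm (deriv f 0) + \<alpha> * norm (f 0))
           + 1 / pi * enn2real (\<integral>\<^sup>+p. area_density \<alpha> f p \<partial>?P)"
          by (rule cesaro_like_in_B1(2)[OF \<mu> Xd[OF f] \<alpha>0 Qfin[OF b]])
        also have "\<dots> \<le> ?m * (A * N f) + ?m * (A * N f + \<alpha> * (A * N f)) + 1 / pi * (?K * (A * N f) * enn2real ?J)"
          using \<alpha> by (intro add_mono mult_left_mono f0 f1 f2) auto
        also have "\<dots> = ?D * N f" by (simp add: algebra_simps)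
        finally show ?thesis .
      qed
      then show ?thesis using lin unfolding bounded_operator_def by blast
    qed
    have compact: "compact_operator X N B1_space B1_norm ?C"
      unfolding compact_operator_def
    proof (intro conjI allI impI, rule lin)
      fix F :: "nat \<Rightarrow> complex \<Rightarrow> complex" assume "(\<forall>n. F n \<in> X) \<and> (\<exists>C. \<forall>n. N (F n) \<le> C)"
      then obtain C where F: "\<And>n. F n \<in> X" and C: "\<And>n. N (F n) \<le> C" by blast
      have bl: "bloch_le (A * C) (F n)" for n
        using AX[OF F[of n]] mult_left_mono[OF C[of n] A] unfolding bloch_le_def by (meson order_trans)
      have "\<exists>B. \<forall>n. \<forall>z\<in>K. norm (F n z) \<le> B" if K: "compact K" "K \<subseteq> ball 0 1" for K
      proof -
        obtain D where D: "D \<ge> 0" "\<And>f z. f \<in> X \<Longrightarrow> z \<in> K \<Longrightarrow> norm (f z) \<le> D * N f"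
          using banach_subspace_bounded_on_compact[OF assms(5) K] by blast
        have "norm (F n z) \<le> D * C" if "z \<in> K" for n z
          using order_trans[OF D(2)[OF F[of n] that] mult_left_mono[OF C[of n] D(1)]] .
        then show ?thesis by blast
      qed
      from bloch_le_normal_family[OF bl this]
      obtain g r where r: "strict_mono (r :: nat \<Rightarrow> nat)" and g: "bloch_le (A * C) g"
        and lim: "\<And>K. compact K \<Longrightarrow> K \<subseteq> ball 0 1 \<Longrightarrow> uniform_limit K (\<lambda>n. F (r n)) g sequentially"
        by blast
      have gh: "g holomorphic_on ball 0 1" using g by (simp add: bloch_le_def hol_disk_def)
      let ?h = "\<lambda>n z. F (r n) z - g z"
      have "(\<lambda>n. B1_norm (?C (?h n))) \<longlonglongrightarrow> 0"
      proof (rule B1_norm_cesaro_like_tendsto_zero[OF \<mu> \<alpha> fin])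
        show "bloch_le (A * C + A * C) (?h n)" for n by (rule bloch_le_diff[OF bl g])
        show "uniform_limit K ?h (\<lambda>_. 0) sequentially" if "compact K" "K \<subseteq> ball 0 1" for K
          using uniform_limit_minus[OF lim[OF that] uniform_limit_const[of g K]] by simp
      qed
      moreover have "?C (?h n) = (\<lambda>z. ?C (F (r n)) z - ?C g z)" for n
        using cesaro_like_linear[OF \<mu> Xh[OF F[of "r n"]] gh \<alpha>0, of 1 "-1"] by simp
      ultimately have "(\<lambda>n. B1_norm (\<lambda>z. ?C (F (r n)) z - ?C g z)) \<longlonglongrightarrow> 0" by simp
      then show "\<exists>g\<in>B1_space. \<exists>r. strict_mono r \<and> (\<lambda>n. B1_norm (\<lambda>z. ?C (F (r n)) z - g z)) \<longlonglongrightarrow> 0"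
        using inB1[OF g] r by blast
    qed
    show ?thesis using bounded compact by blast
  qed
  have "bounded_operator X N B1_space B1_norm ?C \<longleftrightarrow> ?fin"
    using necessary sufficient unfolding bounded_operator_def by blast
  moreover have "compact_operator X N B1_space B1_norm ?C \<longleftrightarrow> ?fin"
    using necessary sufficient unfolding compact_operator_def by blast
  moreover note moment_series_iff_log_integral[OF \<mu> \<alpha>]
  ultimately show ?thesis by blast
qed

end
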